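(* Let $\alpha=1$. Fix the nonlocality parameter $\epsilon>0$ and the value $k>0$. Assume that $V$ and $\zeta$ satisfy the hypotheses of the context. Then, for offset parameter $B$ sufficiently large, $V_0<0$, and $|V_0|$ sufficiently small, the solution $\phi_\omega(x)e^{-i\omega t}$ of the nonlocal Gross-Pitaevskii equation is orbitally stable with respect to perturbations with periods $T=\frac{2\pi n}{k}$, where $n\in\mathbb N$ (that is, orbitally stable in $H_1(S_T)$ for such $T$).
   Context: $S_T$ is the circle of circumference $T$. $H_s(S_T)$ is the Sobolev space of $T$-periodic complex-valued functions $f\in L^2(S_T)$ with $\sum_{j\in\mathbb Z}\left(1+\frac{4\pi^2j^2}{T^2}\right)^s|\hat f_j|^2<\infty$, where $\hat f_j$ are the Fourier coefficients of $f$. Fourier transform on $\mathbb R$: $\hat h(\tilde s)=\int_{\mathbb R}e^{-i\tilde sx}h(x)\,dx$. Hypotheses: $V(x)=V_0\sin^2(kx)$; $\zeta\ge0$, $\zeta$ is even, and $\|\zeta\|_{L^1(\mathbb R)}=1$; $\hat\zeta>0$; and $\hat\zeta(\tilde s)\le(1+|\tilde s|)^{-1/2-\tilde\epsilon}$ for some $\tilde\epsilon>0$. Kernel: $R(x;\epsilon)=\frac1\epsilon\zeta(\frac x\epsilon)$. Nonlocal Gross-Pitaevskii equation: $i\partial_t\psi=-\frac12\partial_x^2\psi+\alpha\,\psi(x)\int_{-\infty}^\infty R(x-y;\epsilon)|\psi(y)|^2dy+V(x)\psi$. With $\beta(k;\epsilon)=\int_{\mathbb R}R(x;\epsilon)\cos(2kx)\,dx$,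 $A=\frac{-V_0}{\alpha\beta(k;\epsilon)}$ and a constant $B\ge\max\{-A,0\}$ (the offset size, or offset parameter), this equation has the explicit solution $\psi(x,t)=\phi_\omega(x)e^{-i\omega t}$ with $\phi_\omega(x)=\sqrt B\cos(kx)+i\sqrt{B+A}\,\sin(kx)$ and $\omega=\frac{V_0+k^2}{2}+\alpha B-\frac{V_0}{2\beta(k;\epsilon)}$. Orbital stability in $H_1(S_T)$: for any $\rho>0$ there is a $\delta>0$ such that if $\|\psi_0-\phi_\omega\|_{H_1(S_T)}<\delta$, then the solution $\psi(x,t)$ of the nonlocal Gross-Pitaevskii equation with initial condition $\psi_0$ satisfies $\sup_{t>0}\inf_{c\in[0,2\pi)}\|\psi(\cdot,t)-\phi_\omega e^{ic}\|_{H_1(S_T)}<\rho$. *)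

theory Defs
  imports "HOL-Analysis.Analysis"
begin

text \<open>
  Functions on the circle are \<open>T\<close>-periodic functions on the line.  Fourier coefficients are
  normalised by \<open>1 / T\<close>, so that the coefficients of \<open>x \<mapsto> cis (2 * pi * j * x / T)\<close> are 0 or 1.
\<close>

definition fourier_coeff :: "real \<Rightarrow> (real \<Rightarrow> complex) \<Rightarrow> int \<Rightarrow> complex" where
  "fourier_coeff T f j =
     (LINT x:{0..T}|lborel. cis (- (2 * pi * of_int j * x / T)) * f x) / of_real T"

definition L2_circle :: "real \<Rightarrow> (real \<Rightarrow> complex) set" where
  "L2_circle T = {f. f \<in> borel_measurable borel \<and> (\<forall>x. f (x + T) = f x) \<and>
                     set_integrable lborel {0..T} (\<lambda>x. (cmod (f x))\<^sup>2)}"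

definition sobolev_weight :: "real \<Rightarrow> real \<Rightarrow> int \<Rightarrow> real" where
  "sobolev_weight T s j = (1 + 4 * pi\<^sup>2 * (of_int j)\<^sup>2 / T\<^sup>2) powr s"

definition sobolev_space :: "real \<Rightarrow> real \<Rightarrow> (real \<Rightarrow> complex) set" where
  "sobolev_space s T = {f \<in> L2_circle T.
     (\<lambda>j. sobolev_weight T s j * (cmod (fourier_coeff T f j))\<^sup>2) summable_on UNIV}"

definition sobolev_norm :: "real \<Rightarrow> real \<Rightarrow> (real \<Rightarrow> complex) \<Rightarrow> real" where
  "sobolev_norm s T f =
     sqrt (\<Sum>\<^sub>\<infinity>j. sobolev_weight T s j * (cmod (fourier_coeff T f j))\<^sup>2)"

definition fourier_transform :: "(real \<Rightarrow> real) \<Rightarrow> real \<Rightarrow> complex" where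
  "fourier_transform h s = (LINT x|lborel. exp (- (\<i> * of_real (s * x))) * of_real (h x))"

text \<open>
  The transform of an even real function is real; \<open>\<in> \<real>\<close> is kept in the positivity condition because
  \<^const>\<open>fourier_transform\<close> is complex-valued.
\<close>

definition admissible_zeta :: "(real \<Rightarrow> real) \<Rightarrow> bool" where
  "admissible_zeta \<zeta> \<longleftrightarrow>
     (\<forall>x. 0 \<le> \<zeta> x) \<and>
     (\<forall>x. \<zeta> (- x) = \<zeta> x) \<and>
     integrable lborel \<zeta> \<and> (LINT x|lborel. \<bar>\<zeta> x\<bar>) = 1 \<and>
     (\<forall>s. fourier_transform \<zeta> s \<in> \<real> \<and> 0 < Re (fourier_transform \<zeta> s)) \<and>
     (\<exists>e>0. \<forall>s. Re (fourier_transform \<zeta> s) \<le> (1 + \<bar>s\<bar>) powr (- 1/2 - e))"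

definition R_kernel :: "(real \<Rightarrow> real) \<Rightarrow> real \<Rightarrow> real \<Rightarrow> real" where
  "R_kernel \<zeta> \<epsilon> x = (1 / \<epsilon>) * \<zeta> (x / \<epsilon>)"

definition beta :: "(real \<Rightarrow> real) \<Rightarrow> real \<Rightarrow> real \<Rightarrow> real" where
  "beta \<zeta> k \<epsilon> = (LINT x|lborel. R_kernel \<zeta> \<epsilon> x * cos (2 * k * x))"

definition gp_potential :: "real \<Rightarrow> real \<Rightarrow> real \<Rightarrow> real" where
  "gp_potential V0 k x = V0 * (sin (k * x))\<^sup>2"

definition gp_lower_order ::
  "real \<Rightarrow> real \<Rightarrow> (real \<Rightarrow> real) \<Rightarrow> (real \<Rightarrow> real) \<Rightarrow> (real \<Rightarrow> complex) \<Rightarrow> real \<Rightarrow> complex" where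
  "gp_lower_order \<alpha> \<epsilon> \<zeta> V u x =
     of_real \<alpha> * u x * of_real (LINT y|lborel. R_kernel \<zeta> \<epsilon> (x - y) * (cmod (u y))\<^sup>2)
     + of_real (V x) * u x"

text \<open>
  Global forward solutions in \<open>C([0,\<infinity>); H_1)\<close>.  The Laplacian of an \<open>H_1\<close> function is only an element
  of \<open>H_{-1}\<close>, so the equation is read in \<open>H_{-1}\<close>: it is required of every Fourier coefficient
  (equivalently, after pairing with any trigonometric polynomial), where the second space
  derivative acts as multiplication by \<open>(2 * pi * \<i> * j / T)\<^sup>2\<close>.
\<close>

definition gp_solution ::
  "real \<Rightarrow> real \<Rightarrow> real \<Rightarrow> (real \<Rightarrow> real) \<Rightarrow> (real \<Rightarrow> real) \<Rightarrow> (real \<Rightarrow> complex) \<Rightarrow>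
   (real \<Rightarrow> real \<Rightarrow> complex) \<Rightarrow> bool" where
  "gp_solution T \<alpha> \<epsilon> \<zeta> V \<psi>0 \<psi> \<longleftrightarrow>
     (\<forall>t\<ge>0. \<psi> t \<in> sobolev_space 1 T) \<and>
     (\<forall>t\<ge>0. ((\<lambda>s. sobolev_norm 1 T (\<lambda>x. \<psi> s x - \<psi> t x)) \<longlongrightarrow> 0) (at t within {0..})) \<and>
     (\<forall>t\<ge>0. \<forall>j. \<exists>D.
        ((\<lambda>s. fourier_coeff T (\<psi> s) j) has_vector_derivative D) (at t within {0..}) \<and>
        \<i> * D = - (1/2) * (2 * of_real pi * \<i> * of_int j / of_real T)\<^sup>2 * fourier_coeff T (\<psi> t) j
                + fourier_coeff T (gp_lower_order \<alpha> \<epsilon> \<zeta> V (\<psi> t)) j) \<and>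
     (AE x in lborel. \<psi> 0 x = \<psi>0 x)"

text \<open>
  The supremum and infimum are taken in \<^typ>\<open>ereal\<close>, since the real-valued \<open>Sup\<close> of an unbounded set
  is a junk value.  The existence clause makes explicit that the data have a global solution, so that
  the estimate is not vacuous.
\<close>

definition orbitally_stable ::
  "real \<Rightarrow> real \<Rightarrow> real \<Rightarrow> (real \<Rightarrow> real) \<Rightarrow> (real \<Rightarrow> real) \<Rightarrow> (real \<Rightarrow> complex) \<Rightarrow> bool" where
  "orbitally_stable T \<alpha> \<epsilon> \<zeta> V \<phi> \<longleftrightarrow>
     (\<forall>\<rho>>0. \<exists>\<delta>>0. \<forall>\<psi>0 \<in> sobolev_space 1 T.
        sobolev_norm 1 T (\<lambda>x. \<psi>0 x - \<phi> x) < \<delta> \<longrightarrow>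
        (\<exists>\<psi>. gp_solution T \<alpha> \<epsilon> \<zeta> V \<psi>0 \<psi>) \<and>
        (\<forall>\<psi>. gp_solution T \<alpha> \<epsilon> \<zeta> V \<psi>0 \<psi> \<longrightarrow>
           (SUP t\<in>{0<..}. INF c\<in>{0..<2 * pi}.
              ereal (sobolev_norm 1 T (\<lambda>x. \<psi> t x - \<phi> x * exp (\<i> * of_real c)))) < ereal \<rho>))"

definition A_const :: "real \<Rightarrow> real \<Rightarrow> (real \<Rightarrow> real) \<Rightarrow> real \<Rightarrow> real \<Rightarrow> real" where
  "A_const \<alpha> \<epsilon> \<zeta> V0 k = - V0 / (\<alpha> * beta \<zeta> k \<epsilon>)"

definition phi_omega ::
  "real \<Rightarrow> real \<Rightarrow> (real \<Rightarrow> real) \<Rightarrow> real \<Rightarrow> real \<Rightarrow> real \<Rightarrow> real \<Rightarrow> complex" where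
  "phi_omega \<alpha> \<epsilon> \<zeta> V0 k B x =
     of_real (sqrt B * cos (k * x)) +
     \<i> * of_real (sqrt (B + A_const \<alpha> \<epsilon> \<zeta> V0 k) * sin (k * x))"

definition omega :: "real \<Rightarrow> real \<Rightarrow> (real \<Rightarrow> real) \<Rightarrow> real \<Rightarrow> real \<Rightarrow> real \<Rightarrow> real" where
  "omega \<alpha> \<epsilon> \<zeta> V0 k B = (V0 + k\<^sup>2) / 2 + \<alpha> * B - V0 / (2 * beta \<zeta> k \<epsilon>)"

lemma admissible_zeta_cos_sin:
  assumes "admissible_zeta \<zeta>"
  shows "integrable lborel (\<lambda>x. \<zeta> x * cos (s * x))" "integrable lborel (\<lambda>x. \<zeta> x * sin (s * x))"
    and "0 < (LINT x|lborel. \<zeta> x * cos (s * x))" "(LINT x|lborel. \<zeta> x * sin (s * x)) = 0"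
    and "integrable lborel \<zeta>" "(LINT x|lborel. \<zeta> x) = 1"
proof -
  show iz: "integrable lborel \<zeta>" and "(LINT x|lborel. \<zeta> x) = 1"
    using assms by (auto simp: admissible_zeta_def)
  have m[measurable]: "\<zeta> \<in> borel_measurable borel"
    using borel_measurable_integrable[OF iz] by simp
  show "integrable lborel (\<lambda>x. \<zeta> x * cos (s * x))"
    by (rule Bochner_Integration.integrable_bound[OF iz]) (auto simp: abs_mult mult_left_le)
  show "integrable lborel (\<lambda>x. \<zeta> x * sin (s * x))"
    by (rule Bochner_Integration.integrable_bound[OF iz]) (auto simp: abs_mult mult_left_le)
  note ic = \<open>integrable lborel (\<lambda>x. \<zeta> x * cos (s * x))\<close>
    and isn = \<open>integrable lborel (\<lambda>x. \<zeta> x * sin (s * x))\<close>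
  have e: "exp (- (\<i> * of_real (s * x))) * of_real (\<zeta> x)
      = complex_of_real (\<zeta> x * cos (s * x)) - \<i> * of_real (\<zeta> x * sin (s * x))" for x
  proof -
    have "exp (- (\<i> * of_real (s * x))) = cis (- (s * x))" by (simp add: cis_conv_exp)
    then show ?thesis by (simp add: complex_eq_iff)
  qed
  have "fourier_transform \<zeta> s = of_real (LINT x|lborel. \<zeta> x * cos (s * x))
        - \<i> * of_real (LINT x|lborel. \<zeta> x * sin (s * x))"
    unfolding fourier_transform_def e using ic isn
    by (subst Bochner_Integration.integral_diff) (auto simp del: of_real_mult)
  moreover have "fourier_transform \<zeta> s \<in> \<real>" "0 < Re (fourier_transform \<zeta> s)"
    using assms by (auto simp: admissible_zeta_def)
  ultimately show "0 < (LINT x|lborel. \<zeta> x * cos (s * x))" "(LINT x|lborel. \<zeta> x * sin (s * x)) = 0"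
    by (auto simp: complex_is_Real_iff)
qed

lemma R_kernel_integral:
  assumes "\<epsilon> > 0"
  shows "(LINT y|lborel. R_kernel \<zeta> \<epsilon> (x - y) * g y) = (LINT v|lborel. \<zeta> v * g (x - \<epsilon> * v))"
proof -
  have "(LINT y|lborel. R_kernel \<zeta> \<epsilon> (x - y) * g y)
      = \<bar>- \<epsilon>\<bar> *\<^sub>R (LINT v|lborel. R_kernel \<zeta> \<epsilon> (x - (x + - \<epsilon> * v)) * g (x + - \<epsilon> * v))"
    using assms by (intro lborel_integral_real_affine) auto
  also have "(\<lambda>v. R_kernel \<zeta> \<epsilon> (x - (x + - \<epsilon> * v)) * g (x + - \<epsilon> * v))
      = (\<lambda>v. (1 / \<epsilon>) * (\<zeta> v * g (x - \<epsilon> * v)))"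
    using assms by (simp add: R_kernel_def fun_eq_iff)
  also have "\<bar>- \<epsilon>\<bar> *\<^sub>R (LINT v|lborel. (1 / \<epsilon>) * (\<zeta> v * g (x - \<epsilon> * v)))
      = (LINT v|lborel. \<zeta> v * g (x - \<epsilon> * v))"
    unfolding integral_mult_right_zero using assms by simp
  finally show ?thesis .
qed

lemma beta_conv:
  assumes "admissible_zeta \<zeta>" "\<epsilon> > 0"
  shows "beta \<zeta> k \<epsilon> = (LINT u|lborel. \<zeta> u * cos (2 * k * \<epsilon> * u))"
proof -
  have "R_kernel \<zeta> \<epsilon> (0 - x) = R_kernel \<zeta> \<epsilon> x" for x
    using assms(1) by (simp add: R_kernel_def admissible_zeta_def)
  then have "beta \<zeta> k \<epsilon> = (LINT y|lborel. R_kernel \<zeta> \<epsilon> (0 - y) * cos (2 * k * y))"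
    unfolding beta_def by simp
  also have "\<dots> = (LINT v|lborel. \<zeta> v * cos (2 * k * (0 - \<epsilon> * v)))"
    by (rule R_kernel_integral[OF assms(2)])
  finally show ?thesis by (simp add: mult.assoc)
qed

lemma beta_pos:
  assumes "admissible_zeta \<zeta>" "\<epsilon> > 0"
  shows "beta \<zeta> k \<epsilon> > 0"
  using admissible_zeta_cos_sin(3)[OF assms(1)] assms by (simp add: beta_conv)

lemma cmod_phi_omega:
  assumes "B \<ge> max (- A_const \<alpha> \<epsilon> \<zeta> V0 k) 0"
  shows "(cmod (phi_omega \<alpha> \<epsilon> \<zeta> V0 k B x))\<^sup>2 = B + A_const \<alpha> \<epsilon> \<zeta> V0 k * (sin (k * x))\<^sup>2"
proof -
  have "(cmod (phi_omega \<alpha> \<epsilon> \<zeta> V0 k B x))\<^sup>2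
      = B * (cos (k * x))\<^sup>2 + (B + A_const \<alpha> \<epsilon> \<zeta> V0 k) * (sin (k * x))\<^sup>2"
    using assms unfolding phi_omega_def by (simp add: cmod_power2 power_mult_distrib)
  then show ?thesis
    by (simp add: cos_squared_eq algebra_simps)
qed

lemma effective_potential_const:
  fixes u :: "real \<Rightarrow> complex"
  assumes z: "admissible_zeta \<zeta>" and e: "\<epsilon> > 0" and a: "\<alpha> \<noteq> 0"
    and u: "\<And>y. (cmod (u y))\<^sup>2 = B + A_const \<alpha> \<epsilon> \<zeta> V0 k * (sin (k * y))\<^sup>2"
  shows "gp_lower_order \<alpha> \<epsilon> \<zeta> (gp_potential V0 k) u x
       = of_real (omega \<alpha> \<epsilon> \<zeta> V0 k B - k\<^sup>2 / 2) * u x"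
proof -
  define A where "A = A_const \<alpha> \<epsilon> \<zeta> V0 k"
  define \<beta> where "\<beta> = beta \<zeta> k \<epsilon>"
  have b: "\<beta> > 0" unfolding \<beta>_def by (rule beta_pos[OF z e])
  have ab: "\<alpha> * A * \<beta> = - V0" unfolding A_def A_const_def using a b \<beta>_def by simp
  note cs = admissible_zeta_cos_sin(1-4)[OF z, of "2 * k * \<epsilon>"] admissible_zeta_cos_sin(5,6)[OF z]
  have g: "B + A * (sin (k * (x - \<epsilon> * v)))\<^sup>2 = (B + A / 2)
      - A / 2 * (cos (2 * k * x) * cos (2 * k * \<epsilon> * v) + sin (2 * k * x) * sin (2 * k * \<epsilon> * v))" for v
  proof -
    have "2 * (sin w)\<^sup>2 = 1 - cos (2 * w)" for w :: real
      using cos_double_sin[of w] by simp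
    from this[of "k * (x - \<epsilon> * v)"]
    have s: "(sin (k * (x - \<epsilon> * v)))\<^sup>2 = (1 - cos (2 * k * x - 2 * k * \<epsilon> * v)) / 2"
      by (simp add: algebra_simps)
    show ?thesis
      unfolding s cos_diff by (simp add: algebra_simps diff_divide_distrib add_divide_distrib)
  qed
  have "(LINT y|lborel. R_kernel \<zeta> \<epsilon> (x - y) * (cmod (u y))\<^sup>2)
      = (LINT v|lborel. \<zeta> v * (B + A * (sin (k * (x - \<epsilon> * v)))\<^sup>2))"
    unfolding u A_def[symmetric] by (rule R_kernel_integral[OF e])
  also have "\<dots> = (LINT v|lborel. (B + A / 2) * \<zeta> v
      - (A / 2 * cos (2 * k * x)) * (\<zeta> v * cos (2 * k * \<epsilon> * v))
      - (A / 2 * sin (2 * k * x)) * (\<zeta> v * sin (2 * k * \<epsilon> * v)))"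
    unfolding g by (simp add: algebra_simps)
  also have "\<dots> = (B + A / 2) - (A / 2 * cos (2 * k * x)) * \<beta>"
    using cs e z by (simp add: \<beta>_def beta_conv)
  finally have J: "(LINT y|lborel. R_kernel \<zeta> \<epsilon> (x - y) * (cmod (u y))\<^sup>2)
      = (B + A / 2) - (A / 2 * cos (2 * k * x)) * \<beta>" .
  have V: "gp_potential V0 k x = V0 / 2 - V0 / 2 * cos (2 * k * x)"
  proof -
    have c: "cos (2 * k * x) = 1 - 2 * (sin (k * x))\<^sup>2"
      using cos_double_sin[of "k * x"] by (simp add: mult.assoc)
    show ?thesis unfolding gp_potential_def c by (simp add: algebra_simps)
  qed
  have A2: "\<alpha> * A = - V0 / \<beta>" using ab b by (simp add: field_simps)
  have "\<alpha> * ((B + A / 2) - (A / 2 * cos (2 * k * x)) * \<beta>) + gp_potential V0 k x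
      = \<alpha> * B + (\<alpha> * A) / 2 - (\<alpha> * A * \<beta>) * cos (2 * k * x) / 2 + V0 / 2 - V0 / 2 * cos (2 * k * x)"
    unfolding V by (simp add: algebra_simps)
  also have "\<dots> = omega \<alpha> \<epsilon> \<zeta> V0 k B - k\<^sup>2 / 2"
    unfolding ab unfolding A2 omega_def \<beta>_def[symmetric] using b by (simp add: field_simps)
  finally have m: "\<alpha> * ((B + A / 2) - (A / 2 * cos (2 * k * x)) * \<beta>) + gp_potential V0 k x
      = omega \<alpha> \<epsilon> \<zeta> V0 k B - k\<^sup>2 / 2" .
  show ?thesis
    unfolding gp_lower_order_def J m[symmetric] by (simp add: algebra_simps)
qed

lemma fourier_coeff_cmult: "fourier_coeff T (\<lambda>x. c * f x) j = c * fourier_coeff T f j"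
proof -
  have "(\<lambda>x. cis (- (2 * pi * of_int j * x / T)) * (c * f x))
      = (\<lambda>x. c * (cis (- (2 * pi * of_int j * x / T)) * f x))"
    by (simp add: fun_eq_iff mult_ac)
  then show ?thesis unfolding fourier_coeff_def by simp
qed

lemma fourier_coeff_cis:
  assumes "T > 0"
  shows "fourier_coeff T (\<lambda>x. cis (2 * pi * of_int m * x / T)) j = (if j = m then 1 else 0)"
proof -
  have e: "cis (- (2 * pi * of_int j * x / T)) * cis (2 * pi * of_int m * x / T)
      = cis (2 * pi * of_int (m - j) / T * x)" for x
    by (simp add: cis_mult algebra_simps diff_divide_distrib)
  show ?thesis
  proof (cases "j = m")
    case True
    then show ?thesis
      using assms unfolding fourier_coeff_def e by (simp add: set_lebesgue_integral_def scaleR_conv_of_real)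
  next
    case False
    define c where "c = 2 * pi * of_int (m - j) / T"
    have c: "c \<noteq> 0" using False assms by (simp add: c_def)
    have "((\<lambda>x. cis (c * x) / (\<i> * of_real c)) has_vector_derivative cis (c * x)) (at x within {0..T})" for x
    proof -
      have "((\<lambda>z. exp (\<i> * of_real c * z) / (\<i> * of_real c)) has_field_derivative
          exp (\<i> * of_real c * of_real x)) (at (of_real x))"
        using c by (auto intro!: derivative_eq_intros)
      from has_vector_derivative_real_field[OF this]
      show ?thesis by (simp add: cis_conv_exp mult.assoc)
    qed
    moreover have "continuous_on {0..T} (\<lambda>x. cis (c * x))"
      by (intro continuous_intros)
    ultimately have "(LINT x:{0..T}|lborel. cis (c * x))
        = cis (c * T) / (\<i> * of_real c) - cis (c * 0) / (\<i> * of_real c)"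
      unfolding set_lebesgue_integral_def using assms
      by (intro integral_FTC_atLeastAtMost) auto
    also have "cis (c * T) = 1"
    proof -
      have "c * T = 2 * pi * of_int (m - j)" using assms by (simp add: c_def)
      then show ?thesis using cis_multiple_2pi[of "of_int (m - j)"] by simp
    qed
    finally show ?thesis using False unfolding fourier_coeff_def e c_def[symmetric] by simp
  qed
qed

lemma phi_omega_cis:
  "phi_omega \<alpha> \<epsilon> \<zeta> V0 k B x =
     of_real ((sqrt B + sqrt (B + A_const \<alpha> \<epsilon> \<zeta> V0 k)) / 2) * cis (k * x)
   + of_real ((sqrt B - sqrt (B + A_const \<alpha> \<epsilon> \<zeta> V0 k)) / 2) * cis (- (k * x))"
  unfolding phi_omega_def by (simp add: complex_eq_iff field_simps)

lemma fourier_coeff_phi_omega: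
  assumes k: "k > 0" and n: "n \<ge> 1" and T: "T = 2 * pi * real n / k"
  shows "fourier_coeff T (phi_omega \<alpha> \<epsilon> \<zeta> V0 k B) j =
     (if j = int n then of_real ((sqrt B + sqrt (B + A_const \<alpha> \<epsilon> \<zeta> V0 k)) / 2)
      else if j = - int n then of_real ((sqrt B - sqrt (B + A_const \<alpha> \<epsilon> \<zeta> V0 k)) / 2) else 0)"
    (is "_ = (if _ then ?p else if _ then ?q else 0)")
proof -
  have T0: "T > 0" using assms by simp
  let ?e = "\<lambda>m x. cis (2 * pi * of_int m * x / T)"
  have 1: "phi_omega \<alpha> \<epsilon> \<zeta> V0 k B = (\<lambda>x. ?p * ?e (int n) x + ?q * ?e (- int n) x)"
    using k n unfolding phi_omega_cis T by (simp add: fun_eq_iff field_simps)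
  have i: "set_integrable lborel {0..T} (\<lambda>x. cis (- (2 * pi * of_int j * x / T)) * (c * ?e m x))" for c m
    by (intro borel_integrable_atLeastAtMost' continuous_intros) (use T0 in auto)
  have "fourier_coeff T (phi_omega \<alpha> \<epsilon> \<zeta> V0 k B) j
      = fourier_coeff T (\<lambda>x. ?p * ?e (int n) x) j + fourier_coeff T (\<lambda>x. ?q * ?e (- int n) x) j"
    unfolding 1 fourier_coeff_def distrib_left
    by (subst set_integral_add(2)[OF i i]) (rule add_divide_distrib)
  then show ?thesis
    unfolding fourier_coeff_cmult fourier_coeff_cis[OF T0] using n by auto
qed

lemma phi_omega_solution:
  assumes z: "admissible_zeta \<zeta>" and e: "\<epsilon> > 0" and a: "\<alpha> \<noteq> 0" and k: "k > 0"
    and B: "B \<ge> max (- A_const \<alpha> \<epsilon> \<zeta> V0 k) 0"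
    and n: "n \<ge> 1" and T: "T = 2 * pi * real n / k"
  shows "gp_solution T \<alpha> \<epsilon> \<zeta> (gp_potential V0 k) (phi_omega \<alpha> \<epsilon> \<zeta> V0 k B)
     (\<lambda>t x. phi_omega \<alpha> \<epsilon> \<zeta> V0 k B x * exp (- (\<i> * of_real (omega \<alpha> \<epsilon> \<zeta> V0 k B * t))))"
proof -
  define \<phi> where "\<phi> = phi_omega \<alpha> \<epsilon> \<zeta> V0 k B"
  define w where "w = omega \<alpha> \<epsilon> \<zeta> V0 k B"
  define E where "E t = exp (- (\<i> * of_real (w * t)))" for t :: real
  have T0: "T > 0" using k n T by simp
  have nE: "cmod (E t) = 1" for t unfolding E_def by (simp add: norm_exp_eq_Re)
  have fm: "fourier_coeff T (\<lambda>x. \<phi> x * c) j = c * fourier_coeff T \<phi> j" for c j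
    using fourier_coeff_cmult[of T c \<phi> j] by (simp add: mult.commute)
  have supp: "fourier_coeff T \<phi> j = 0" if "j \<noteq> int n" "j \<noteq> - int n" for j
    using that unfolding \<phi>_def fourier_coeff_phi_omega[OF k n T] by simp
  have cont: "continuous_on UNIV \<phi>"
    unfolding \<phi>_def phi_omega_def by (intro continuous_intros)
  have per: "\<phi> (x + T) = \<phi> x" for x
  proof -
    have "k * (x + T) = k * x + 2 * pi * real n" using k T by (simp add: field_simps)
    then have "cos (k * (x + T)) = cos (k * x)" "sin (k * (x + T)) = sin (k * x)"
      using sin.plus_of_nat[of "k * x" n] cos.plus_of_nat[of "k * x" n]
      by (simp_all add: mult.commute)
    then show ?thesis unfolding \<phi>_def phi_omega_def by simp
  qed
  have mem: "(\<lambda>x. \<phi> x * c) \<in> sobolev_space 1 T" for c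
    unfolding sobolev_space_def L2_circle_def mem_Collect_eq
  proof (intro conjI allI)
    have c': "continuous_on UNIV (\<lambda>x. \<phi> x * c)" by (intro continuous_intros cont)
    then show "(\<lambda>x. \<phi> x * c) \<in> borel_measurable borel"
      by (rule borel_measurable_continuous_onI)
    show "\<phi> (x + T) * c = \<phi> x * c" for x by (simp add: per)
    show "set_integrable lborel {0..T} (\<lambda>x. (cmod (\<phi> x * c))\<^sup>2)"
      by (intro borel_integrable_atLeastAtMost' continuous_intros continuous_on_subset[OF c']) auto
    have "(\<lambda>j. sobolev_weight T 1 j * (cmod (fourier_coeff T (\<lambda>x. \<phi> x * c) j))\<^sup>2)
        summable_on {int n, - int n}"
      by (rule summable_on_finite) simp
    then show "(\<lambda>j. sobolev_weight T 1 j * (cmod (fourier_coeff T (\<lambda>x. \<phi> x * c) j))\<^sup>2)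
        summable_on UNIV"
      by (rule summable_on_cong_neutral[THEN iffD1, rotated -1]) (auto simp: fm supp)
  qed
  have nrm: "sobolev_norm 1 T (\<lambda>x. \<phi> x * c) = cmod c * sobolev_norm 1 T \<phi>" for c
  proof -
    have "(\<Sum>\<^sub>\<infinity>j. sobolev_weight T 1 j * (cmod (fourier_coeff T (\<lambda>x. \<phi> x * c) j))\<^sup>2)
        = (\<Sum>\<^sub>\<infinity>j. (cmod c)\<^sup>2 * (sobolev_weight T 1 j * (cmod (fourier_coeff T \<phi> j))\<^sup>2))"
      unfolding fm norm_mult power_mult_distrib by (simp only: mult.left_commute)
    also have "\<dots> = (cmod c)\<^sup>2 * (\<Sum>\<^sub>\<infinity>j. sobolev_weight T 1 j * (cmod (fourier_coeff T \<phi> j))\<^sup>2)"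
      by (rule infsum_cmult_right')
    finally show ?thesis unfolding sobolev_norm_def by (simp add: real_sqrt_mult)
  qed
  have low: "gp_lower_order \<alpha> \<epsilon> \<zeta> (gp_potential V0 k) (\<lambda>x. \<phi> x * E t)
      = (\<lambda>x. of_real (w - k\<^sup>2 / 2) * (\<phi> x * E t))" for t
    unfolding w_def
    by (rule ext, rule effective_potential_const[OF z e a])
       (simp add: norm_mult nE power_mult_distrib \<phi>_def cmod_phi_omega[OF B])
  have "gp_solution T \<alpha> \<epsilon> \<zeta> (gp_potential V0 k) \<phi> (\<lambda>t x. \<phi> x * E t)"
    unfolding gp_solution_def
  proof (intro conjI allI impI)
    show "(\<lambda>x. \<phi> x * E t) \<in> sobolev_space 1 T" for t by (rule mem)
    show "((\<lambda>s. sobolev_norm 1 T (\<lambda>x. \<phi> x * E s - \<phi> x * E t)) \<longlongrightarrow> 0) (at t within {0..})" for t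
    proof -
      have "(\<lambda>s. sobolev_norm 1 T (\<lambda>x. \<phi> x * E s - \<phi> x * E t))
          = (\<lambda>s. cmod (E s - E t) * sobolev_norm 1 T \<phi>)"
        by (simp add: nrm flip: right_diff_distrib)
      moreover have "(E \<longlongrightarrow> E t) (at t within {0..})"
        unfolding E_def by (intro tendsto_intros)
      then have "((\<lambda>s. cmod (E s - E t) * sobolev_norm 1 T \<phi>) \<longlongrightarrow> cmod (E t - E t) * sobolev_norm 1 T \<phi>)
          (at t within {0..})"
        by (intro tendsto_intros)
      ultimately show ?thesis by simp
    qed
    show "\<exists>D. ((\<lambda>s. fourier_coeff T (\<lambda>x. \<phi> x * E s) j) has_vector_derivative D) (at t within {0..}) \<and>
        \<i> * D = - (1/2) * (2 * of_real pi * \<i> * of_int j / of_real T)\<^sup>2 * fourier_coeff T (\<lambda>x. \<phi> x * E t) j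
          + fourier_coeff T (gp_lower_order \<alpha> \<epsilon> \<zeta> (gp_potential V0 k) (\<lambda>x. \<phi> x * E t)) j" for t j
    proof (intro exI conjI)
      have "(E has_vector_derivative (- (\<i> * of_real w)) * E t) (at t within {0..})"
      proof -
        have "((\<lambda>z. exp (- (\<i> * of_real w * z))) has_field_derivative
            (- (\<i> * of_real w)) * exp (- (\<i> * of_real w * of_real t))) (at (of_real t))"
          by (auto intro!: derivative_eq_intros)
        from has_vector_derivative_real_field[OF this]
        show ?thesis by (simp add: E_def [abs_def] mult.assoc)
      qed
      then show "((\<lambda>s. fourier_coeff T (\<lambda>x. \<phi> x * E s) j) has_vector_derivative
          (- (\<i> * of_real w)) * E t * fourier_coeff T \<phi> j) (at t within {0..})"
        unfolding fm by (rule has_vector_derivative_mult_left)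
      have k2: "(2 * of_real pi * \<i> * of_int j / of_real T)\<^sup>2 * fourier_coeff T \<phi> j
          = - of_real (k\<^sup>2) * fourier_coeff T \<phi> j"
      proof (cases "j = int n \<or> j = - int n")
        case True
        have "2 * pi * real n / T = k" using k n T by simp
        then have "(2 * complex_of_real pi * of_nat n / of_real T) = of_real k"
          by (metis of_real_divide of_real_mult of_real_numeral of_real_of_nat_eq)
        then have "(2 * complex_of_real pi * of_nat n / of_real T)\<^sup>2 = of_real (k\<^sup>2)"
          by simp
        moreover have "(2 * complex_of_real pi * \<i> * of_int j / of_real T)\<^sup>2
            = - ((2 * complex_of_real pi * of_nat n / of_real T)\<^sup>2)"
          using True by (auto simp: power_mult_distrib power_divide)
        ultimately show ?thesis by simp
      qed (simp add: supp)
      have "- (1/2) * (2 * of_real pi * \<i> * of_int j / of_real T)\<^sup>2 * (E t * fourier_coeff T \<phi> j)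
          = - (1/2) * E t * ((2 * of_real pi * \<i> * of_int j / of_real T)\<^sup>2 * fourier_coeff T \<phi> j)"
        by (simp only: mult_ac)
      also have "\<dots> = (1/2) * E t * (of_real (k\<^sup>2) * fourier_coeff T \<phi> j)"
        unfolding k2 by simp
      finally have k3: "- (1/2) * (2 * of_real pi * \<i> * of_int j / of_real T)\<^sup>2 * (E t * fourier_coeff T \<phi> j)
          = (1/2) * E t * (of_real (k\<^sup>2) * fourier_coeff T \<phi> j)" .
      show "\<i> * ((- (\<i> * of_real w)) * E t * fourier_coeff T \<phi> j)
          = - (1/2) * (2 * of_real pi * \<i> * of_int j / of_real T)\<^sup>2 * fourier_coeff T (\<lambda>x. \<phi> x * E t) j
          + fourier_coeff T (gp_lower_order \<alpha> \<epsilon> \<zeta> (gp_potential V0 k) (\<lambda>x. \<phi> x * E t)) j"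
        unfolding low fourier_coeff_cmult fm k3 by (simp add: algebra_simps)
    qed
    show "AE x in lborel. \<phi> x * E 0 = \<phi> x" by (simp add: E_def)
  qed
  then show ?thesis unfolding \<phi>_def w_def E_def .
qed

end

theory Submission
  imports Defs
begin

text \<open>
  On the Fourier side the equation is an evolution equation in a Sobolev space of sequences, which is a
  commutative Banach algebra under convolution.  In the interaction picture it becomes an ordinary
  differential equation with locally Lipschitz right-hand side; energy and mass are conserved (by
  truncating to finitely many modes) and bound the norm, so solutions are global.

  Let \<open>S = E - \<omega> N\<close>, where \<open>E\<close> is the energy, \<open>N\<close> the mass and \<open>\<omega>\<close> the frequency of \<open>\<phi>\<^sub>\<omega>\<close>.
  The effective potential \<open>V + R * |\<phi>\<^sub>\<omega>|\<^sup>2\<close> is constant, so the second variation of \<open>S\<close> at \<open>\<phi>\<^sub>\<omega>\<close> is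
  \<open>\<integral> |p'|\<^sup>2/2 - k\<^sup>2|p|\<^sup>2/2 + \<eta> (R * \<eta>)/2\<close> with \<open>\<eta> = 2 Re (cnj \<phi>\<^sub>\<omega> p)\<close>.  Writing \<open>p = \<phi>\<^sub>\<omega> (u + i v)\<close> and completing
  the square in \<open>v'\<close>, the only negative contribution is of size \<open>(k\<^sup>2/B) \<integral> \<eta>\<^sup>2\<close>.  For large \<open>B\<close> it is
  absorbed, uniformly in the period: at high frequencies by \<open>\<integral> \<eta>'\<^sup>2/B\<close>, at low ones by the interaction,
  because the transform of \<open>\<zeta>\<close> is bounded below on compact sets.  Hence \<open>S\<close> is coercive transversally
  to the phase orbit, and its conservation confines solutions near the orbit.
\<close>

section \<open>Sobolev sequences and their convolution algebra\<close>

text \<open>For n > 1 the kinetic form \<open>dip p p - n^2 * ip p p\<close> is negative on every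
  mode with |j| < n, so positivity of the second variation cannot be read off mode by mode from
  \<open>p\<close>. Dividing by the wave removes this obstacle: the density is bounded below by B >
  0, and after one integration by parts the only indefinite term couples the amplitude u to the
  gradient v' of the phase. The phase v itself never enters with a sign; it is recovered from v' by
  a Poincare inequality whose mean value is fixed by the choice of phase. Rescaling turns every
  period into \<open>2 * pi\<close>, so one sequence space with the weight \<open>1 + j^2\<close>
  serves all of them. The integer n survives only in \<open>lam = k / n\<close> and as the index of
  the mode that carries the wave. The thresholds for B and V0 rest on an inequality at all real
  frequencies and therefore do not involve n; the radius of stability may depend on n, through the
  comparison of norms and the coercivity constants. Solutions are given only through their
  coefficients, so the flow is never differentiated as a curve in \<open>h1\<close> except after
  truncation.\<close>

definition h1_weight :: "int \<Rightarrow> real" where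
  "h1_weight j = 1 + (of_int j)\<^sup>2"

lemma h1_weight_ge1: "1 \<le> h1_weight j"
  by (simp add: h1_weight_def)

lemma h1_weight_pos [simp]: "0 < h1_weight j" "0 \<le> h1_weight j"
  using h1_weight_ge1[of j] by linarith+

text \<open>\<open>sqrt (h1_weight m)\<close> is the Euclidean length of (1, m), so this is the
  triangle inequality in the plane for (1, m - j) + (0, j). It takes the place of the Leibniz rule
  when products are estimated.\<close>

lemma sqrt_h1_weight_le: "sqrt (h1_weight m) \<le> sqrt (h1_weight (m - j)) + sqrt (h1_weight j)"
proof -
  define a b where "a = real_of_int (m - j)" and "b = real_of_int j"
  have m: "h1_weight m = 1 + (a + b)\<^sup>2" by (simp add: a_def b_def h1_weight_def)
  have "sqrt (1\<^sup>2 + (a + b)\<^sup>2) \<le> sqrt (1\<^sup>2 + a\<^sup>2) + sqrt (0\<^sup>2 + b\<^sup>2)"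
    using real_sqrt_sum_squares_triangle_ineq[of 1 0 a b] by simp
  moreover have "sqrt (0\<^sup>2 + b\<^sup>2) \<le> sqrt (1 + b\<^sup>2)" by (intro real_sqrt_le_mono) simp
  ultimately show ?thesis by (simp add: m h1_weight_def a_def b_def)
qed

lemma finite_int_subset_symmetric:
  fixes F :: "int set"
  assumes "finite F"
  obtains N where "F \<subseteq> {-int N..int N}"
proof -
  have "\<forall>j\<in>F. nat \<bar>j\<bar> \<le> (\<Sum>j\<in>F. nat \<bar>j\<bar>)"
    using assms by (auto intro: member_le_sum)
  then have "F \<subseteq> {-int N..int N}" if "N = (\<Sum>j\<in>F. nat \<bar>j\<bar>)" for N
    unfolding that[symmetric] by (auto simp: nat_le_iff abs_le_iff)
  then show ?thesis using that by blast
qed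

lemma sum_inverse_h1_weight_le:
  assumes "finite F"
  shows "(\<Sum>j\<in>F. 1 / h1_weight j) \<le> 5"
proof -
  \<comment> \<open>The tail \<open>4 / (N + 1)\<close> makes the induction close: the two new terms
    are dominated by the telescoping difference \<open>4 / (N + 1) - 4 / (N + 2)\<close>, and N = 0
    holds with equality.\<close>
  have sym: "(\<Sum>j=-int N..int N. 1 / h1_weight j) \<le> 5 - 4 / (real N + 1)" for N
  proof (induction N)
    case 0
    then show ?case by (simp add: h1_weight_def)
  next
    case (Suc N)
    have "{- int (Suc N)..int (Suc N)} = insert (- int (Suc N)) (insert (int (Suc N)) {- int N..int N})"
      by auto
    then have "(\<Sum>j=-int (Suc N)..int (Suc N). 1 / h1_weight j)
        = 2 / (1 + (real N + 1)\<^sup>2) + (\<Sum>j=-int N..int N. 1 / h1_weight j)"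
      by (auto simp: h1_weight_def power2_eq_square algebra_simps)
    moreover have "2 / (1 + (real N + 1)\<^sup>2) \<le> 4 / (real N + 1) - 4 / (real N + 2)"
      by (simp add: divide_simps power2_eq_square) (simp add: algebra_simps)
    ultimately show ?case using Suc by (simp add: algebra_simps)
  qed
  obtain N where "F \<subseteq> {-int N..int N}" by (rule finite_int_subset_symmetric[OF assms])
  then have "(\<Sum>j\<in>F. 1 / h1_weight j) \<le> (\<Sum>j=-int N..int N. 1 / h1_weight j)"
    by (intro sum_mono2) (auto simp: less_imp_le)
  also have "\<dots> \<le> 5" using sym[of N] by (smt (verit) divide_nonneg_nonneg of_nat_0_le_iff)
  finally show ?thesis .
qed

text \<open>Estimates are made on finite partial sums, where \<open>L2_set\<close> provides
  Minkowski and Cauchy-Schwarz; bounds uniform in \<open>F\<close> then pass to the infinite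
  sum.\<close>

abbreviation h1_sum :: "int set \<Rightarrow> (int \<Rightarrow> complex) \<Rightarrow> real" where
  "h1_sum F a \<equiv> L2_set (\<lambda>j. sqrt (h1_weight j) * cmod (a j)) F"

lemma h1_sum_square:
  "(h1_sum F a)\<^sup>2 = (\<Sum>j\<in>F. h1_weight j * (cmod (a j))\<^sup>2)"
  by (simp add: L2_set_def sum_nonneg power_mult_distrib)

lemma h1_sum_triangle: "h1_sum F (\<lambda>j. a j + b j) \<le> h1_sum F a + h1_sum F b"
proof -
  have "h1_sum F (\<lambda>j. a j + b j)
      \<le> L2_set (\<lambda>j. sqrt (h1_weight j) * cmod (a j) + sqrt (h1_weight j) * cmod (b j)) F"
  proof (rule L2_set_mono)
    fix j
    show "sqrt (h1_weight j) * cmod (a j + b j)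
        \<le> sqrt (h1_weight j) * cmod (a j) + sqrt (h1_weight j) * cmod (b j)"
      unfolding distrib_left[symmetric] by (intro mult_left_mono norm_triangle_ineq) simp
  qed simp
  also note L2_set_triangle_ineq
  finally show ?thesis .
qed

text \<open>Cauchy-Schwarz against the summable inverse weights: the embedding of the Sobolev space
  into absolutely convergent Fourier series.\<close>

lemma sum_cmod_le_h1_sum:
  assumes "finite F"
  shows "(\<Sum>j\<in>F. cmod (a j)) \<le> sqrt 5 * h1_sum F a"
proof -
  have "(\<Sum>j\<in>F. cmod (a j)) = (\<Sum>j\<in>F. \<bar>1 / sqrt (h1_weight j)\<bar> * \<bar>sqrt (h1_weight j) * cmod (a j)\<bar>)"
    by (intro sum.cong) (auto simp: abs_mult field_simps, smt (verit) h1_weight_pos)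
  also have "\<dots> \<le> L2_set (\<lambda>j. 1 / sqrt (h1_weight j)) F * h1_sum F a"
    by (rule L2_set_mult_ineq)
  also have "L2_set (\<lambda>j. 1 / sqrt (h1_weight j)) F \<le> sqrt 5"
    using sum_inverse_h1_weight_le[OF assms] by (simp add: L2_set_def power_divide)
  finally show ?thesis by (simp add: mult_right_mono)
qed

lemma h1_bounded_summable:
  assumes "\<And>F. finite F \<Longrightarrow> h1_sum F a \<le> C"
  shows "(\<lambda>j. h1_weight j * (cmod (a j))\<^sup>2) summable_on UNIV"
    and "sqrt (\<Sum>\<^sub>\<infinity>j. h1_weight j * (cmod (a j))\<^sup>2) \<le> C"
proof -
  have C: "0 \<le> C" using assms[of "{}"] by simp
  have b: "(\<Sum>j\<in>F. h1_weight j * (cmod (a j))\<^sup>2) \<le> C\<^sup>2" if "finite F" for F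
    using power_mono[OF assms[OF that] L2_set_nonneg, of 2] by (simp add: h1_sum_square)
  show s: "(\<lambda>j. h1_weight j * (cmod (a j))\<^sup>2) summable_on UNIV"
    by (rule nonneg_bdd_above_summable_on) (auto intro!: bdd_aboveI2 b simp: less_imp_le)
  have "(\<Sum>\<^sub>\<infinity>j. h1_weight j * (cmod (a j))\<^sup>2) \<le> C\<^sup>2"
    by (rule infsum_le_finite_sums[OF s]) (auto intro: b)
  then show "sqrt (\<Sum>\<^sub>\<infinity>j. h1_weight j * (cmod (a j))\<^sup>2) \<le> C"
    using C real_le_lsqrt by (simp add: real_le_lsqrt infsum_nonneg)
qed

lemma h1_sum_le_infsum:
  assumes "(\<lambda>j. h1_weight j * (cmod (a j))\<^sup>2) summable_on UNIV" "finite F"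
  shows "h1_sum F a \<le> sqrt (\<Sum>\<^sub>\<infinity>j. h1_weight j * (cmod (a j))\<^sup>2)"
proof -
  have "(h1_sum F a)\<^sup>2 \<le> (\<Sum>\<^sub>\<infinity>j. h1_weight j * (cmod (a j))\<^sup>2)"
    unfolding h1_sum_square by (rule finite_sum_le_infsum) (use assms in auto)
  then show ?thesis by (rule real_le_rsqrt)
qed

text \<open>
  The Sobolev space \<open>H\<^sub>1\<close> of the circle of length \<open>2\<pi>\<close> on the Fourier side.  The factor 5 in the norm
  makes it submultiplicative for the convolution product defined below.
\<close>

typedef h1 = "{a::int \<Rightarrow> complex. (\<lambda>j. h1_weight j * (cmod (a j))\<^sup>2) summable_on UNIV}"
  morphisms coef Abs_h1
  by (rule exI[of _ "\<lambda>_. 0"]) simp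

setup_lifting type_definition_h1

lemma h1_eqI: "(\<And>j. coef a j = coef b j) \<Longrightarrow> a = b"
  by (metis coef_inject ext)

lemma h1_memI:
  assumes "\<And>F. finite F \<Longrightarrow> h1_sum F a \<le> C"
  shows "(\<lambda>j. h1_weight j * (cmod (a j))\<^sup>2) summable_on UNIV"
  by (rule h1_bounded_summable(1)[OF assms])

lemma h1_sum_bound:
  assumes "(\<lambda>j. h1_weight j * (cmod (a j))\<^sup>2) summable_on UNIV"
  obtains C where "0 \<le> C" "\<And>F. finite F \<Longrightarrow> h1_sum F a \<le> C"
  using h1_sum_le_infsum[OF assms] infsum_nonneg[of UNIV "\<lambda>j. h1_weight j * (cmod (a j))\<^sup>2"]
  by (metis (no_types, lifting) h1_weight_pos(2) mult_nonneg_nonneg real_sqrt_ge_zero zero_le_power2)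

lemma h1_sum_cmult_le:
  assumes "finite F" "0 \<le> M" "\<And>j. cmod (b j) \<le> M * cmod (a j)"
  shows "h1_sum F b \<le> M * h1_sum F a"
proof -
  have "h1_sum F b \<le> L2_set (\<lambda>j. M * (sqrt (h1_weight j) * cmod (a j))) F"
    by (intro L2_set_mono) (auto simp: mult.left_commute[of M] assms less_imp_le intro!: mult_left_mono)
  then show ?thesis using assms by (simp add: L2_set_right_distrib)
qed

lemma h1_mem_dominated:
  assumes "(\<lambda>j. h1_weight j * (cmod (a j))\<^sup>2) summable_on UNIV" "\<And>j. cmod (b j) \<le> M * cmod (a j)"
  shows "(\<lambda>j. h1_weight j * (cmod (b j))\<^sup>2) summable_on UNIV"
proof -
  obtain C where C: "0 \<le> C" "\<And>F. finite F \<Longrightarrow> h1_sum F a \<le> C"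
    using h1_sum_bound[OF assms(1)] by blast
  have le: "cmod (b j) \<le> max M 0 * cmod (a j)" for j
    by (rule order_trans[OF assms(2)]) (simp add: mult_right_mono)
  have "h1_sum F b \<le> max M 0 * C" if "finite F" for F
    using h1_sum_cmult_le[OF that _ le] C(2)[OF that]
    by (meson max.cobounded2 mult_left_mono order_trans)
  then show ?thesis by (rule h1_memI)
qed

section \<open>Vector space structure, norm and completeness of the sequence space\<close>

instantiation h1 :: real_vector
begin

lift_definition zero_h1 :: h1 is "\<lambda>_. 0" by simp

lift_definition plus_h1 :: "h1 \<Rightarrow> h1 \<Rightarrow> h1" is "\<lambda>a b j. a j + b j"
proof -
  fix a b :: "int \<Rightarrow> complex"
  assume "(\<lambda>j. h1_weight j * (cmod (a j))\<^sup>2) summable_on UNIV"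
  then obtain C where C: "\<And>F. finite F \<Longrightarrow> h1_sum F a \<le> C" using h1_sum_bound by blast
  assume "(\<lambda>j. h1_weight j * (cmod (b j))\<^sup>2) summable_on UNIV"
  then obtain D where D: "\<And>F. finite F \<Longrightarrow> h1_sum F b \<le> D" using h1_sum_bound by blast
  show "(\<lambda>j. h1_weight j * (cmod (a j + b j))\<^sup>2) summable_on UNIV"
  proof (rule h1_memI)
    fix F :: "int set" assume "finite F"
    then show "h1_sum F (\<lambda>j. a j + b j) \<le> C + D"
      using C[of F] D[of F] h1_sum_triangle[of a b F] by linarith
  qed
qed

lift_definition uminus_h1 :: "h1 \<Rightarrow> h1" is "\<lambda>a j. - a j" by simp

lift_definition scaleR_h1 :: "real \<Rightarrow> h1 \<Rightarrow> h1" is "\<lambda>r a j. r *\<^sub>R a j"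
  by (rule h1_mem_dominated) auto

definition minus_h1 :: "h1 \<Rightarrow> h1 \<Rightarrow> h1" where "minus_h1 a b = a + - b"

instance
  by standard (auto intro!: h1_eqI simp: plus_h1.rep_eq uminus_h1.rep_eq scaleR_h1.rep_eq
    zero_h1.rep_eq minus_h1_def scaleR_add_left scaleR_add_right)

end

instantiation h1 :: real_normed_vector
begin

definition norm_h1 :: "h1 \<Rightarrow> real" where
  "norm_h1 a = 5 * sqrt (\<Sum>\<^sub>\<infinity>j. h1_weight j * (cmod (coef a j))\<^sup>2)"

definition sgn_h1 :: "h1 \<Rightarrow> h1" where "sgn_h1 a = a /\<^sub>R norm a"
definition dist_h1 :: "h1 \<Rightarrow> h1 \<Rightarrow> real" where "dist_h1 a b = norm (a - b)"
definition uniformity_h1 :: "(h1 \<times> h1) filter" where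
  "uniformity_h1 = (INF e\<in>{0<..}. principal {(x, y). dist x y < e})"
definition open_h1 :: "h1 set \<Rightarrow> bool" where
  "open_h1 U = (\<forall>x\<in>U. eventually (\<lambda>(x', y). x' = x \<longrightarrow> y \<in> U) uniformity)"

lemma h1_sum_le_norm: "finite F \<Longrightarrow> 5 * h1_sum F (coef a) \<le> norm a"
  unfolding norm_h1_def using h1_sum_le_infsum[of "coef a" F] coef[of a] by simp

lemma norm_h1_leI: "(\<And>F. finite F \<Longrightarrow> 5 * h1_sum F (coef a) \<le> C) \<Longrightarrow> norm a \<le> C"
  unfolding norm_h1_def using h1_bounded_summable(2)[of "coef a" "C / 5"] by (simp add: mult.commute)

instance
proof
  fix a b :: h1 and r :: real
  show "norm (a + b) \<le> norm a + norm b"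
  proof (rule norm_h1_leI)
    fix F :: "int set" assume "finite F"
    then show "5 * h1_sum F (coef (a + b)) \<le> norm a + norm b"
      using h1_sum_triangle[of "coef a" "coef b" F] h1_sum_le_norm[of F a] h1_sum_le_norm[of F b]
      by (simp add: plus_h1.rep_eq)
  qed
  show "norm (r *\<^sub>R a) = \<bar>r\<bar> * norm a"
  proof -
    have "(\<lambda>j. h1_weight j * (cmod (coef (r *\<^sub>R a) j))\<^sup>2)
        = (\<lambda>j. r\<^sup>2 * (h1_weight j * (cmod (coef a j))\<^sup>2))"
      by (simp add: scaleR_h1.rep_eq power_mult_distrib fun_eq_iff)
    then show ?thesis by (simp add: norm_h1_def infsum_cmult_right' real_sqrt_mult)
  qed
  show "norm a = 0 \<longleftrightarrow> a = 0"
  proof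
    assume "norm a = 0"
    then have "sqrt (h1_weight j) * cmod (coef a j) \<le> 0" for j
      using h1_sum_le_norm[of "{j}" a] by (simp add: L2_set_def real_sqrt_mult)
    then have "coef a j = 0" for j
      by (metis h1_weight_pos(1) linorder_not_less mult_pos_pos real_sqrt_gt_zero zero_less_norm_iff)
    then show "a = 0" by (auto intro!: h1_eqI simp: zero_h1.rep_eq)
  qed (simp add: norm_h1_def zero_h1.rep_eq)
  show "dist a b = norm (a - b)" by (rule dist_h1_def)
  show "sgn a = a /\<^sub>R norm a" by (rule sgn_h1_def)
  show "uniformity = (INF e\<in>{0<..}. principal {(x::h1, y). dist x y < e})" by (rule uniformity_h1_def)
  show "open U = (\<forall>x\<in>U. \<forall>\<^sub>F (x', y) in uniformity. x' = x \<longrightarrow> y \<in> U)" for U :: "h1 set"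
    by (rule open_h1_def)
qed

end

lemma coef_simps [simp]:
  "coef 0 j = 0" "coef (a + b) j = coef a j + coef b j" "coef (- a) j = - coef a j"
  "coef (a - b) j = coef a j - coef b j" "coef (r *\<^sub>R a) j = r *\<^sub>R coef a j"
  by (simp_all add: zero_h1.rep_eq plus_h1.rep_eq uminus_h1.rep_eq scaleR_h1.rep_eq
    diff_conv_add_uminus del: add_uminus_conv_diff)

lemma coef_sum [simp]: "coef (sum f A) j = (\<Sum>i\<in>A. coef (f i) j)"
  by (induction A rule: infinite_finite_induct) auto

lemma norm_h1_square:
  "(norm a)\<^sup>2 = 25 * (\<Sum>\<^sub>\<infinity>j. h1_weight j * (cmod (coef a j))\<^sup>2)"
  by (simp add: norm_h1_def power_mult_distrib infsum_nonneg)

lemma h1_summable: "(\<lambda>j. h1_weight j * (cmod (coef a j))\<^sup>2) summable_on UNIV"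
  using coef[of a] by simp

lemma cmod_coef_le: "5 * (sqrt (h1_weight j) * cmod (coef a j)) \<le> norm a"
  using h1_sum_le_norm[of "{j}" a] by simp

lemma cmod_coef_le_norm: "cmod (coef a j) \<le> norm a"
proof -
  have "cmod (coef a j) \<le> sqrt (h1_weight j) * cmod (coef a j)"
    using h1_weight_ge1[of j] by (simp add: mult_right_le_one_le mult_left_le_one_le mult_le_cancel_right1)
  also have "\<dots> \<le> 5 * (sqrt (h1_weight j) * cmod (coef a j))" by simp
  also note cmod_coef_le
  finally show ?thesis .
qed

lemma bounded_linear_coef: "bounded_linear (\<lambda>a. coef a j)"
  by (rule bounded_linear_intro[of _ 1]) (auto simp: cmod_coef_le_norm)

lemma norm_h1_mono:
  assumes "\<And>j. cmod (coef a j) \<le> M * cmod (coef b j)" "0 \<le> M"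
  shows "norm a \<le> M * norm b"
proof (rule norm_h1_leI)
  fix F :: "int set" assume F: "finite F"
  then have "h1_sum F (coef a) \<le> M * h1_sum F (coef b)"
    by (rule h1_sum_cmult_le) (use assms in auto)
  also have "5 * \<dots> \<le> M * norm b"
    using mult_left_mono[OF h1_sum_le_norm[OF F, of b] assms(2)] by (simp add: mult_ac)
  finally show "5 * h1_sum F (coef a) \<le> M * norm b" by simp
qed

text \<open>Each finite partial sum passes to the limit, so a norm bound survives coefficientwise
  convergence. Together with the Cauchy property this yields completeness.\<close>

lemma coef_limit_h1:
  fixes a :: "nat \<Rightarrow> h1"
  assumes "\<And>j. (\<lambda>n. coef (a n) j) \<longlonglongrightarrow> l j" "\<And>n. norm (a n) \<le> C"
  obtains b where "coef b = l" "norm b \<le> C"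
proof -
  have le: "5 * h1_sum F l \<le> C" if "finite F" for F
  proof (rule tendsto_upperbound)
    show "(\<lambda>n. 5 * h1_sum F (coef (a n))) \<longlonglongrightarrow> 5 * h1_sum F l"
      unfolding L2_set_def by (intro tendsto_intros assms)
    show "\<forall>\<^sub>F n in sequentially. 5 * h1_sum F (coef (a n)) \<le> C"
      using h1_sum_le_norm[OF that] assms(2) order_trans by (intro always_eventually) blast
  qed auto
  have "(\<lambda>j. h1_weight j * (cmod (l j))\<^sup>2) summable_on UNIV"
    by (rule h1_memI[of _ "C / 5"]) (use le in force)
  then have c: "coef (Abs_h1 l) = l" by (simp add: Abs_h1_inverse)
  then show ?thesis by (intro that[of "Abs_h1 l"] norm_h1_leI) (auto simp: le)
qed

instance h1 :: banach
proof
  fix a :: "nat \<Rightarrow> h1"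
  assume C: "Cauchy a"
  have "convergent (\<lambda>n. coef (a n) j)" for j
    using bounded_linear.Cauchy[OF bounded_linear_coef C] Cauchy_convergent_iff by blast
  then obtain l where l: "\<And>j. (\<lambda>n. coef (a n) j) \<longlonglongrightarrow> l j"
    unfolding convergent_def by metis
  \<comment> \<open>For fixed \<open>n\<close> the differences \<open>a n - a m\<close> have norm at
    most \<open>e\<close> and converge coefficientwise in \<open>m\<close>, so their limit has norm
    at most \<open>e\<close>. The witness \<open>b\<close> is chosen anew for each \<open>e\<close>,
    but its coefficients are always \<open>l\<close>.\<close>
  have near: "\<exists>b. coef b = l \<and> (\<exists>N. \<forall>n\<ge>N. norm (a n - b) \<le> e)" if "e > 0" for e
  proof -
    obtain N where N: "\<And>m n. m \<ge> N \<Longrightarrow> n \<ge> N \<Longrightarrow> norm (a m - a n) < e"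
      using C \<open>e > 0\<close> unfolding Cauchy_def dist_norm by blast
    have "\<exists>c. coef c = (\<lambda>j. coef (a n) j - l j) \<and> norm c \<le> e" if n: "n \<ge> N" for n
    proof -
      have "(\<lambda>m. coef (a n - a (m + N)) j) \<longlonglongrightarrow> coef (a n) j - l j" for j
        using LIMSEQ_ignore_initial_segment[OF l[of j], of N] by (auto intro!: tendsto_intros)
      moreover have "norm (a n - a (m + N)) \<le> e" for m using N[OF n, of "m + N"] by simp
      ultimately show ?thesis
        by (rule coef_limit_h1[of "\<lambda>m. a n - a (m + N)" "\<lambda>j. coef (a n) j - l j" e]) blast
    qed
    then obtain c where c: "\<And>n. n \<ge> N \<Longrightarrow> coef (c n) = (\<lambda>j. coef (a n) j - l j)"
      "\<And>n. n \<ge> N \<Longrightarrow> norm (c n) \<le> e" by metis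
    have b: "coef (a N - c N) = l" by (auto simp: c(1))
    have "a n - (a N - c N) = c n" if "n \<ge> N" for n
      by (rule h1_eqI) (simp add: c(1)[OF that] c(1)[of N])
    then show ?thesis using b c(2) by (metis)
  qed
  obtain b where b: "coef b = l" using near[of 1] by auto
  have "a \<longlonglongrightarrow> b"
  proof (rule LIMSEQ_I)
    fix e :: real assume "e > 0"
    then obtain b' N where b': "coef b' = l" and N: "\<And>n. n \<ge> N \<Longrightarrow> norm (a n - b') \<le> e / 2"
      using near[of "e / 2"] by auto
    have "b' = b" by (rule h1_eqI) (simp add: b b')
    then have "norm (a n - b) < e" if "n \<ge> N" for n
      using N[OF that] \<open>e > 0\<close> by simp
    then show "\<exists>N. \<forall>n\<ge>N. norm (a n - b) < e" by blast
  qed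
  then show "convergent a" by (rule convergentI)
qed

section \<open>Monomials and the density of trigonometric polynomials\<close>

lemma finite_support_h1_mem:
  assumes "finite {j. a j \<noteq> 0}"
  shows "(\<lambda>j. h1_weight j * (cmod (a j))\<^sup>2) summable_on UNIV"
proof -
  have "{j. h1_weight j * (cmod (a j))\<^sup>2 \<noteq> 0} \<subseteq> {j. a j \<noteq> 0}" by auto
  then show ?thesis
    by (intro finite_nonzero_values_imp_summable_on) (use assms finite_subset in auto)
qed

lift_definition mon :: "int \<Rightarrow> complex \<Rightarrow> h1" is "\<lambda>j c i. if i = j then c else 0"
  by (rule finite_support_h1_mem) simp

lemma coef_mon [simp]: "coef (mon j c) i = (if i = j then c else 0)"
  by (simp add: mon.rep_eq)

lemma mon_linear_simps:
  "mon j (c + d) = mon j c + mon j d" "mon j (- c) = - mon j c" "mon j (c - d) = mon j c - mon j d"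
  "mon j (r *\<^sub>R c) = r *\<^sub>R mon j c" "mon j 0 = 0"
  by (auto intro!: h1_eqI)

lemma norm_mon: "norm (mon j c) = 5 * sqrt (h1_weight j) * cmod c"
proof (rule antisym)
  show "norm (mon j c) \<le> 5 * sqrt (h1_weight j) * cmod c"
  proof (rule norm_h1_leI)
    fix F :: "int set" assume "finite F"
    then have "h1_sum F (coef (mon j c)) \<le> (\<Sum>i\<in>F. if i = j then sqrt (h1_weight j) * cmod c else 0)"
      by (intro order_trans[OF L2_set_le_sum_abs] sum_mono) auto
    also have "\<dots> \<le> sqrt (h1_weight j) * cmod c" using \<open>finite F\<close> by simp
    finally show "5 * h1_sum F (coef (mon j c)) \<le> 5 * sqrt (h1_weight j) * cmod c" by simp
  qed
  show "5 * sqrt (h1_weight j) * cmod c \<le> norm (mon j c)"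
    using cmod_coef_le[of j "mon j c"] by (simp add: mult.assoc)
qed

lemma bounded_linear_mon: "bounded_linear (mon j)"
  by (rule bounded_linear_intro[of _ "5 * sqrt (h1_weight j)"]) (auto simp: mon_linear_simps norm_mon)

definition trunc :: "nat \<Rightarrow> h1 \<Rightarrow> h1" where
  "trunc N a = (\<Sum>j=-int N..int N. mon j (coef a j))"

lemma coef_trunc [simp]: "coef (trunc N a) j = (if \<bar>j\<bar> \<le> int N then coef a j else 0)"
  by (auto simp: trunc_def)

lemma norm_trunc_le: "norm (trunc N a) \<le> norm a"
  using norm_h1_mono[of "trunc N a" 1 a] by auto

lemma trunc_tendsto: "(\<lambda>N. trunc N a) \<longlonglongrightarrow> a"
proof (rule LIMSEQ_I)
  fix e :: real assume "e > 0"
  define S where "S = (\<Sum>\<^sub>\<infinity>j. h1_weight j * (cmod (coef a j))\<^sup>2)"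
  define s where "s F = (\<Sum>j\<in>F. h1_weight j * (cmod (coef a j))\<^sup>2)" for F
  \<comment> \<open>With the factor 5 of the norm, a tail of at most \<open>(e / 10)^2\<close>
    leaves a distance of at most \<open>e / 2\<close>.\<close>
  define d where "d = (e / 10)\<^sup>2"
  have "d > 0" using \<open>e > 0\<close> by (simp add: d_def)
  have "(s \<longlongrightarrow> S) (finite_subsets_at_top UNIV)"
    unfolding s_def S_def by (rule infsum_tendsto[OF h1_summable])
  then have "\<forall>\<^sub>F F in finite_subsets_at_top UNIV. dist (s F) S < d"
    using \<open>d > 0\<close> by (rule tendstoD)
  then obtain F where F: "finite F" "\<And>G. finite G \<Longrightarrow> F \<subseteq> G \<Longrightarrow> dist (s G) S < d"
    unfolding eventually_finite_subsets_at_top by auto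
  obtain M where M: "F \<subseteq> {-int M..int M}" by (rule finite_int_subset_symmetric[OF F(1)])
  have "norm (trunc N a - a) < e" if "N \<ge> M" for N
  proof -
    define I where "I = {-int N..int N}"
    have I: "F \<subseteq> I" "finite I" using M that by (auto simp: I_def)
    have "norm (trunc N a - a) \<le> e / 2"
    proof (rule norm_h1_leI)
      fix H :: "int set" assume H: "finite H"
      have "s (I \<union> (H - I)) = s I + s (H - I)"
        unfolding s_def using I H by (intro sum.union_disjoint) auto
      moreover have "S \<ge> s (I \<union> (H - I))" unfolding S_def s_def
        by (rule finite_sum_le_infsum[OF h1_summable]) (use I H in auto)
      moreover have "dist (s I) S < d" by (rule F(2)[OF I(2,1)])
      ultimately have "s (H - I) \<le> d" by (simp add: dist_real_def)
      have "(h1_sum H (coef (trunc N a - a)))\<^sup>2 = (\<Sum>j\<in>H. if j \<in> I then 0 else h1_weight j * (cmod (coef a j))\<^sup>2)"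
        unfolding h1_sum_square by (intro sum.cong) (auto simp: I_def)
      also have "\<dots> = s (H - I)"
        unfolding s_def using H by (intro sum.mono_neutral_cong_right) auto
      also note \<open>s (H - I) \<le> d\<close>
      finally have "h1_sum H (coef (trunc N a - a)) \<le> e / 10"
        unfolding d_def by (rule power2_le_imp_le) (use \<open>e > 0\<close> in simp)
      then show "5 * h1_sum H (coef (trunc N a - a)) \<le> e / 2" by simp
    qed
    then show ?thesis using \<open>e > 0\<close> by simp
  qed
  then show "\<exists>M. \<forall>N\<ge>M. norm (trunc N a - a) < e" by blast
qed

text \<open>Trigonometric polynomials are dense. The maps are only real-linear, which admits
  conjugation; this is why the monomials carry an arbitrary complex coefficient.\<close>

lemma bounded_linear_h1_ext:
  assumes "bounded_linear f" "bounded_linear g" "\<And>j c. f (mon j c) = g (mon j c)"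
  shows "f a = g a"
proof (rule LIMSEQ_unique)
  interpret f: bounded_linear f by fact
  interpret g: bounded_linear g by fact
  show "(\<lambda>N. f (trunc N a)) \<longlonglongrightarrow> f a" by (intro f.tendsto trunc_tendsto)
  have "f (trunc N a) = g (trunc N a)" for N by (simp add: trunc_def f.sum g.sum assms(3))
  moreover have "(\<lambda>N. g (trunc N a)) \<longlonglongrightarrow> g a" by (intro g.tendsto trunc_tendsto)
  ultimately show "(\<lambda>N. f (trunc N a)) \<longlonglongrightarrow> g a" by simp
qed

section \<open>Convolution as a commutative product\<close>

lemma L2_set_sum_le:
  assumes "finite G"
  shows "L2_set (\<lambda>m. \<Sum>j\<in>G. f j m) F \<le> (\<Sum>j\<in>G. L2_set (f j) F)"
  using assms
proof (induction G rule: finite_induct)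
  case (insert j G)
  then show ?case
    using L2_set_triangle_ineq[of "f j" "\<lambda>m. \<Sum>j\<in>G. f j m" F] by simp
qed (simp add: L2_set_0')

text \<open>Young's inequality for l1 with l2: Minkowski over \<open>G\<close>, each summand being a
  multiple of a translate of \<open>g\<close>.\<close>

lemma L2_set_convolution_le:
  fixes g :: "int \<Rightarrow> real"
  assumes "finite F" "finite G" "\<And>H. finite H \<Longrightarrow> L2_set g H \<le> D"
  shows "L2_set (\<lambda>m. \<Sum>j\<in>G. cmod (a j) * g (m - j)) F \<le> (\<Sum>j\<in>G. cmod (a j)) * D"
proof -
  have "L2_set (\<lambda>m. cmod (a j) * g (m - j)) F \<le> cmod (a j) * D" for j
  proof -
    have "L2_set (\<lambda>m. g (m - j)) F = L2_set g ((\<lambda>m. m - j) ` F)"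
      by (simp add: L2_set_def sum.reindex inj_on_def)
    also have "\<dots> \<le> D" using assms by simp
    finally show ?thesis unfolding L2_set_right_distrib[OF norm_ge_zero, symmetric] by (simp add: mult_left_mono)
  qed
  then show ?thesis
    unfolding sum_distrib_right by (intro order_trans[OF L2_set_sum_le[OF assms(2)]] sum_mono)
qed

lemma sum_cmod_bound:
  assumes a: "\<And>F. finite F \<Longrightarrow> h1_sum F a \<le> C"
  shows "finite F \<Longrightarrow> (\<Sum>j\<in>F. cmod (a j)) \<le> sqrt 5 * C"
  using sum_cmod_le_h1_sum[of F a] a[of F] by (smt (verit) mult_left_mono real_sqrt_ge_zero)

lemma convolution_abs_summable:
  assumes a: "\<And>F. finite F \<Longrightarrow> h1_sum F a \<le> C" and b: "\<And>F. finite F \<Longrightarrow> h1_sum F b \<le> D"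
  shows "(\<lambda>j. norm (a j * b (m - j))) summable_on UNIV"
proof (rule nonneg_bdd_above_summable_on)
  have D: "0 \<le> D" using b[of "{}"] by simp
  have "cmod (b i) \<le> D" for i
  proof -
    have "1 * cmod (b i) \<le> sqrt (h1_weight i) * cmod (b i)"
      by (rule mult_right_mono) (auto simp: h1_weight_ge1)
    then show ?thesis using b[of "{i}"] by simp
  qed
  then have "(\<Sum>j\<in>F. norm (a j * b (m - j))) \<le> (\<Sum>j\<in>F. cmod (a j) * D)" for F
    unfolding norm_mult by (intro sum_mono mult_left_mono) auto
  moreover have "(\<Sum>j\<in>F. cmod (a j) * D) \<le> sqrt 5 * C * D" if "finite F" for F
    unfolding sum_distrib_right[symmetric] using sum_cmod_bound[OF a that] D by (rule mult_right_mono)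
  ultimately show "bdd_above (sum (\<lambda>j. norm (a j * b (m - j))) ` {F. F \<subseteq> UNIV \<and> finite F})"
    by (intro bdd_aboveI2[where M = "sqrt 5 * C * D"]) (use order_trans in blast)
qed simp

text \<open>
  The weight of \<open>m\<close> is at most the sum of the weights of \<open>m - j\<close> and \<open>j\<close>, so Minkowski's inequality
  applies with either factor taken in \<open>\<ell>\<^sub>1\<close>.
\<close>

lemma h1_sum_convolution_le:
  assumes a: "\<And>F. finite F \<Longrightarrow> h1_sum F a \<le> C" and b: "\<And>F. finite F \<Longrightarrow> h1_sum F b \<le> D"
    and F: "finite F"
  shows "h1_sum F (\<lambda>m. \<Sum>\<^sub>\<infinity>j. a j * b (m - j)) \<le> 2 * sqrt 5 * C * D"
proof (rule tendsto_upperbound)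
  have "(\<lambda>j. a j * b (m - j)) summable_on UNIV" for m
    by (rule abs_summable_summable[OF convolution_abs_summable[OF a b]])
  then show "((\<lambda>G. h1_sum F (\<lambda>m. \<Sum>j\<in>G. a j * b (m - j))) \<longlongrightarrow> h1_sum F (\<lambda>m. \<Sum>\<^sub>\<infinity>j. a j * b (m - j)))
      (finite_subsets_at_top UNIV)"
    unfolding L2_set_def
    by (intro tendsto_intros infsum_tendsto)
  have "h1_sum F (\<lambda>m. \<Sum>j\<in>G. a j * b (m - j)) \<le> 2 * sqrt 5 * C * D" if G: "finite G" for G
  proof -
    let ?w = "\<lambda>i. sqrt (h1_weight i)"
    \<comment> \<open>\<open>H\<close> collects all indices \<open>m - j\<close>. After the
      substitution \<open>i = m - j\<close> the sum can be enlarged to a range independent of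
      \<open>m\<close>, so the convolution bound applies with \<open>b\<close> as the summable
      factor.\<close>
    define H where "H = (\<Union>m\<in>F. (\<lambda>j. m - j) ` G)"
    have H: "finite H" using F G by (simp add: H_def)
    have "?w m * cmod (\<Sum>j\<in>G. a j * b (m - j))
        \<le> (\<Sum>j\<in>G. cmod (a j) * (?w (m - j) * cmod (b (m - j))))
         + (\<Sum>i\<in>H. cmod (b i) * (?w (m - i) * cmod (a (m - i))))" if m: "m \<in> F" for m
    proof -
      have "?w m * cmod (\<Sum>j\<in>G. a j * b (m - j)) \<le> (\<Sum>j\<in>G. ?w m * (cmod (a j) * cmod (b (m - j))))"
        unfolding sum_distrib_left[symmetric]
        by (intro mult_left_mono sum_norm_le) (auto simp: norm_mult)
      also have "\<dots> \<le> (\<Sum>j\<in>G. (?w (m - j) + ?w j) * (cmod (a j) * cmod (b (m - j))))"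
        by (intro sum_mono mult_right_mono sqrt_h1_weight_le) simp
      also have "\<dots> = (\<Sum>j\<in>G. cmod (a j) * (?w (m - j) * cmod (b (m - j))))
          + (\<Sum>j\<in>G. cmod (b (m - j)) * (?w j * cmod (a j)))"
        by (simp add: sum.distrib algebra_simps)
      also have "(\<Sum>j\<in>G. cmod (b (m - j)) * (?w j * cmod (a j)))
          = (\<Sum>i\<in>(\<lambda>j. m - j) ` G. cmod (b i) * (?w (m - i) * cmod (a (m - i))))"
        by (subst sum.reindex) (auto simp: inj_on_def)
      also have "\<dots> \<le> (\<Sum>i\<in>H. cmod (b i) * (?w (m - i) * cmod (a (m - i))))"
        using m H by (intro sum_mono2) (auto simp: H_def)
      finally show ?thesis by simp
    qed
    then have "h1_sum F (\<lambda>m. \<Sum>j\<in>G. a j * b (m - j))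
        \<le> L2_set (\<lambda>m. (\<Sum>j\<in>G. cmod (a j) * (?w (m - j) * cmod (b (m - j))))
             + (\<Sum>i\<in>H. cmod (b i) * (?w (m - i) * cmod (a (m - i))))) F"
      by (intro L2_set_mono) auto
    also have "\<dots> \<le> (\<Sum>j\<in>G. cmod (a j)) * D + (\<Sum>i\<in>H. cmod (b i)) * C"
      by (intro order_trans[OF L2_set_triangle_ineq] add_mono
            L2_set_convolution_le[where g = "\<lambda>i. ?w i * cmod (b i)"]
            L2_set_convolution_le[where g = "\<lambda>i. ?w i * cmod (a i)"] F G H a b)
    also have "\<dots> \<le> (sqrt 5 * C) * D + (sqrt 5 * D) * C"
      using a[of "{}"] b[of "{}"]
      by (intro add_mono mult_right_mono sum_cmod_bound[OF a G] sum_cmod_bound[OF b H]) auto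
    finally show ?thesis by (simp add: mult_ac)
  qed
  then show "\<forall>\<^sub>F G in finite_subsets_at_top UNIV. h1_sum F (\<lambda>m. \<Sum>j\<in>G. a j * b (m - j)) \<le> 2 * sqrt 5 * C * D"
    by (auto intro: eventually_finite_subsets_at_top_weakI)
qed simp

lift_definition convolution :: "h1 \<Rightarrow> h1 \<Rightarrow> h1" is "\<lambda>a b m. \<Sum>\<^sub>\<infinity>j. a j * b (m - j)"
proof -
  fix a b :: "int \<Rightarrow> complex"
  assume "(\<lambda>j. h1_weight j * (cmod (a j))\<^sup>2) summable_on UNIV"
  then obtain C where C: "\<And>F. finite F \<Longrightarrow> h1_sum F a \<le> C" using h1_sum_bound by blast
  assume "(\<lambda>j. h1_weight j * (cmod (b j))\<^sup>2) summable_on UNIV"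
  then obtain D where D: "\<And>F. finite F \<Longrightarrow> h1_sum F b \<le> D" using h1_sum_bound by blast
  show "(\<lambda>m. h1_weight m * (cmod (\<Sum>\<^sub>\<infinity>j. a j * b (m - j)))\<^sup>2) summable_on UNIV"
    by (rule h1_memI[OF h1_sum_convolution_le[OF C D]])
qed

lemma h1_sum_coef_le: "finite F \<Longrightarrow> h1_sum F (coef a) \<le> norm a / 5"
  using h1_sum_le_norm[of F a] by simp

lemma convolution_summable: "(\<lambda>j. coef a j * coef b (m - j)) summable_on UNIV"
  by (rule abs_summable_summable[OF convolution_abs_summable[OF h1_sum_coef_le h1_sum_coef_le]])

lemma norm_convolution_le: "norm (convolution a b) \<le> norm a * norm b"
proof (rule norm_h1_leI)
  fix F :: "int set" assume "finite F"
  then have "h1_sum F (coef (convolution a b)) \<le> 2 * sqrt 5 * (norm a / 5) * (norm b / 5)"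
    unfolding convolution.rep_eq by (intro h1_sum_convolution_le h1_sum_coef_le)
  also have "5 * \<dots> = (2 * sqrt 5 / 5) * (norm a * norm b)" by (simp add: field_simps)
  \<comment> \<open>The two factors contribute 1/25 and the outer norm 5, so
    \<open>2 * sqrt 5 / 5\<close> remains, which is below 1.\<close>
  also have "sqrt 5 \<le> 5 / (2::real)" by (rule real_le_lsqrt) (auto simp: power2_eq_square)
  then have "(2 * sqrt 5 / 5) * (norm a * norm b) \<le> 1 * (norm a * norm b)"
    by (intro mult_right_mono) auto
  finally show "5 * h1_sum F (coef (convolution a b)) \<le> norm a * norm b" by simp
qed

lemma bounded_bilinear_convolution: "bounded_bilinear convolution"
proof
  note s = convolution_summable
  show "convolution (a + a') b = convolution a b + convolution a' b" for a a' b
    by (rule h1_eqI) (simp add: convolution.rep_eq distrib_right infsum_add s)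
  show "convolution a (b + b') = convolution a b + convolution a b'" for a b b'
    by (rule h1_eqI) (simp add: convolution.rep_eq distrib_left infsum_add s)
  show "convolution (r *\<^sub>R a) b = r *\<^sub>R convolution a b" for r a b
    by (rule h1_eqI) (simp add: convolution.rep_eq infsum_scaleR_right)
  show "convolution a (r *\<^sub>R b) = r *\<^sub>R convolution a b" for r a b
    by (rule h1_eqI) (simp add: convolution.rep_eq infsum_scaleR_right)
  show "\<exists>K. \<forall>a b. norm (convolution a b) \<le> norm a * norm b * K"
    by (rule exI[of _ 1]) (simp add: norm_convolution_le)
qed

interpretation conv: bounded_bilinear convolution
  by (rule bounded_bilinear_convolution)

lemma convolution_mon: "convolution (mon i c) (mon j d) = mon (i + j) (c * d)"
proof (rule h1_eqI)
  fix m
  have "(\<Sum>\<^sub>\<infinity>l. coef (mon i c) l * coef (mon j d) (m - l)) = (\<Sum>\<^sub>\<infinity>l\<in>{i}. coef (mon i c) l * coef (mon j d) (m - l))"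
    by (rule infsum_cong_neutral) auto
  then show "coef (convolution (mon i c) (mon j d)) m = coef (mon (i + j) (c * d)) m"
    by (auto simp: convolution.rep_eq)
qed

text \<open>By density it is enough to compare monomials, one argument at a time; associativity is
  obtained likewise in three stages.\<close>

lemma convolution_commute: "convolution a b = convolution b a"
proof (rule bounded_linear_h1_ext[of "\<lambda>a. convolution a b"])
  show "convolution (mon j c) b = convolution b (mon j c)" for j c
    by (rule bounded_linear_h1_ext[of "\<lambda>b. convolution (mon j c) b"])
       (auto intro: conv.bounded_linear_left conv.bounded_linear_right simp: convolution_mon ac_simps)
qed (auto intro: conv.bounded_linear_left conv.bounded_linear_right)

lemma convolution_assoc: "convolution (convolution a b) c = convolution a (convolution b c)"
proof -
  note bl = conv.bounded_linear_left conv.bounded_linear_right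
    bounded_linear_compose[OF conv.bounded_linear_left conv.bounded_linear_left]
    bounded_linear_compose[OF conv.bounded_linear_left conv.bounded_linear_right]
    bounded_linear_compose[OF conv.bounded_linear_right conv.bounded_linear_left]
    bounded_linear_compose[OF conv.bounded_linear_right conv.bounded_linear_right]
  have 1: "convolution (convolution (mon i x) (mon j y)) c = convolution (mon i x) (convolution (mon j y) c)" for i j x y
    by (rule bounded_linear_h1_ext[of "\<lambda>c. convolution (convolution (mon i x) (mon j y)) c"])
       (rule bl | simp add: convolution_mon ac_simps)+
  have 2: "convolution (convolution (mon i x) b) c = convolution (mon i x) (convolution b c)" for i x
    by (rule bounded_linear_h1_ext[of "\<lambda>b. convolution (convolution (mon i x) b) c"]) (rule bl | rule 1)+
  show ?thesis
    by (rule bounded_linear_h1_ext[of "\<lambda>a. convolution (convolution a b) c"]) (rule bl | rule 2)+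
qed

instantiation h1 :: "{comm_ring_1, real_normed_algebra}"
begin

definition times_h1 :: "h1 \<Rightarrow> h1 \<Rightarrow> h1" where "times_h1 = convolution"
definition one_h1 :: h1 where "one_h1 = mon 0 1"

instance
proof
  fix a b c :: h1 and r :: real
  show "a * b * c = a * (b * c)" by (simp add: times_h1_def convolution_assoc)
  show "a * b = b * a" by (simp add: times_h1_def convolution_commute[of a])
  show "1 * a = a"
    unfolding times_h1_def one_h1_def
    by (rule bounded_linear_h1_ext[of "\<lambda>a. convolution (mon 0 1) a"])
       (auto intro: conv.bounded_linear_right bounded_linear_ident simp: convolution_mon)
  show "(a + b) * c = a * c + b * c" by (simp add: times_h1_def conv.add_left)
  show "a * (b + c) = a * b + a * c" by (simp add: times_h1_def conv.add_right)
  show "(r *\<^sub>R a) * b = r *\<^sub>R (a * b)" by (simp add: times_h1_def conv.scaleR_left)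
  show "a * (r *\<^sub>R b) = r *\<^sub>R (a * b)" by (simp add: times_h1_def conv.scaleR_right)
  show "norm (a * b) \<le> norm a * norm b" by (simp add: times_h1_def norm_convolution_le)
  have "coef (1::h1) 0 \<noteq> coef (0::h1) 0" by (simp add: one_h1_def)
  then show "(0::h1) \<noteq> 1" by metis
qed

end

lemma mon_mult [simp]: "mon i c * mon j d = mon (i + j) (c * d)"
  by (simp add: times_h1_def convolution_mon)

lemma coef_mult: "coef (a * b) m = (\<Sum>\<^sub>\<infinity>j. coef a j * coef b (m - j))"
  by (simp add: times_h1_def convolution.rep_eq)

lemma coef_mon_mult [simp]: "coef (mon i c * a) m = c * coef a (m - i)"
  by (rule bounded_linear_h1_ext[of "\<lambda>a. coef (mon i c * a) m"])
     (auto intro!: bounded_linear_compose[OF bounded_linear_coef] bounded_linear_mult_right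
        bounded_linear_const_mult bounded_linear_coef)

section \<open>Evaluation, conjugation and Fourier multipliers\<close>

definition ev :: "h1 \<Rightarrow> real \<Rightarrow> complex" where
  "ev a x = (\<Sum>\<^sub>\<infinity>j. coef a j * cis (of_int j * x))"

lemma sum_cmod_coef_le:
  assumes "finite F"
  shows "(\<Sum>j\<in>F. cmod (coef a j)) \<le> norm a"
proof -
  have "sqrt 5 \<le> (5::real)" by (rule real_le_lsqrt) auto
  then have "sqrt 5 * h1_sum F (coef a) \<le> 5 * h1_sum F (coef a)"
    by (intro mult_right_mono) auto
  then show ?thesis
    using sum_cmod_le_h1_sum[OF assms, of "coef a"] h1_sum_le_norm[OF assms, of a] by linarith
qed

lemma coef_abs_summable: "(\<lambda>j. cmod (coef a j)) summable_on UNIV"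
  by (rule nonneg_bdd_above_summable_on) (auto intro!: bdd_aboveI2 sum_cmod_coef_le)

lemma ev_abs_summable: "(\<lambda>j. norm (coef a j * cis (of_int j * x))) summable_on UNIV"
  using coef_abs_summable by (simp add: norm_mult)

lemma cmod_ev_le: "cmod (ev a x) \<le> norm a"
proof -
  have "cmod (ev a x) \<le> (\<Sum>\<^sub>\<infinity>j. norm (coef a j * cis (of_int j * x)))"
    unfolding ev_def by (rule norm_infsum_bound[OF ev_abs_summable])
  also have "\<dots> \<le> norm a"
    by (rule infsum_le_finite_sums[OF ev_abs_summable]) (simp add: norm_mult sum_cmod_coef_le)
  finally show ?thesis .
qed

lemma bounded_linear_ev: "bounded_linear (\<lambda>a. ev a x)"
proof (rule bounded_linear_intro[of _ 1])
  note s = abs_summable_summable[OF ev_abs_summable]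
  show "ev (a + b) x = ev a x + ev b x" for a b
    by (simp add: ev_def distrib_right infsum_add s)
  show "ev (r *\<^sub>R a) x = r *\<^sub>R ev a x" for r a
    by (simp add: ev_def infsum_scaleR_right)
qed (simp add: cmod_ev_le)

lemma ev_linear [simp]:
  "ev (a + b) x = ev a x + ev b x" "ev (a - b) x = ev a x - ev b x" "ev (- a) x = - ev a x"
  "ev 0 x = 0" "ev (r *\<^sub>R a) x = r *\<^sub>R ev a x" "ev (sum f A) x = (\<Sum>i\<in>A. ev (f i) x)"
proof -
  interpret bounded_linear "\<lambda>a. ev a x" by (rule bounded_linear_ev)
  show "ev (a + b) x = ev a x + ev b x" "ev (a - b) x = ev a x - ev b x" "ev (- a) x = - ev a x"
    "ev 0 x = 0" "ev (r *\<^sub>R a) x = r *\<^sub>R ev a x" "ev (sum f A) x = (\<Sum>i\<in>A. ev (f i) x)"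
    by (simp_all add: add diff neg zero scaleR sum)
qed

lemma ev_mon [simp]: "ev (mon j c) x = c * cis (of_int j * x)"
proof -
  have "ev (mon j c) x = (\<Sum>\<^sub>\<infinity>i\<in>{j}. coef (mon j c) i * cis (of_int i * x))"
    unfolding ev_def by (rule infsum_cong_neutral) auto
  then show ?thesis by simp
qed

lemma ev_mult [simp]: "ev (a * b) x = ev a x * ev b x"
proof (rule bounded_linear_h1_ext[of "\<lambda>a. ev (a * b) x"])
  show "ev (mon i c * b) x = ev (mon i c) x * ev b x" for i c
    by (rule bounded_linear_h1_ext[of "\<lambda>b. ev (mon i c * b) x"])
       (auto intro!: bounded_linear_compose[OF bounded_linear_ev] bounded_linear_mult_right
          bounded_linear_const_mult bounded_linear_ev simp del: ev_linear simp: cis_mult distrib_right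
          simp flip: cis_mult)
qed (auto intro!: bounded_linear_compose[OF bounded_linear_ev] bounded_linear_mult_left
          bounded_linear_mult_const bounded_linear_ev)

lemma ev_trunc: "ev (trunc N a) x = (\<Sum>j=-int N..int N. coef a j * cis (of_int j * x))"
  by (simp add: trunc_def)

lemma continuous_on_ev [continuous_intros]:
  assumes "continuous_on A f"
  shows "continuous_on A (\<lambda>x. ev a (f x))"
proof -
  have "continuous_on UNIV (ev a)"
  proof (rule uniform_limit_theorem)
    show "\<forall>\<^sub>F N in sequentially. continuous_on UNIV (ev (trunc N a))"
      unfolding ev_trunc[abs_def] by (intro always_eventually allI continuous_intros)
    show "uniform_limit UNIV (\<lambda>N. ev (trunc N a)) (ev a) sequentially"
    proof (rule uniform_limitI)
      fix e :: real assume "e > 0"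
      then have "\<forall>\<^sub>F N in sequentially. dist (trunc N a) a < e"
        by (rule tendstoD[OF trunc_tendsto])
      then show "\<forall>\<^sub>F N in sequentially. \<forall>x\<in>UNIV. dist (ev (trunc N a) x) (ev a x) < e"
      proof eventually_elim
        case (elim N)
        then show ?case
          using cmod_ev_le[of "trunc N a - a"] order_le_less_trans
          by (auto simp: dist_norm)
      qed
    qed
  qed simp
  then show ?thesis by (rule continuous_on_compose2[OF _ assms]) simp
qed

lemma borel_measurable_ev [measurable]: "ev a \<in> borel_measurable borel"
  by (rule borel_measurable_continuous_onI) (intro continuous_intros)

lemma ev_periodic: "ev a (x + 2 * pi * of_int n) = ev a x"
proof -
  have "cis (of_int j * (x + 2 * pi * of_int n)) = cis (of_int j * x)" for j
    using cis_multiple_2pi[of "of_int (j * n)"] by (simp add: cis_mult[symmetric] distrib_left mult_ac)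
  then show ?thesis by (simp add: ev_def)
qed

text \<open>Both sides are bounded linear in \<open>a\<close>, so orthogonality of the exponentials
  suffices. This ties the sequence space to the Fourier coefficients of functions of every
  period.\<close>

lemma fourier_coeff_ev:
  assumes "T > 0"
  shows "fourier_coeff T (\<lambda>x. ev a (2 * pi / T * x)) j = coef a j"
proof -
  let ?c = "\<lambda>a. fourier_coeff T (\<lambda>x. ev a (2 * pi / T * x)) j"
  let ?g = "\<lambda>a x. cis (- (2 * pi * of_int j * x / T)) * ev a (2 * pi / T * x)"
  have i: "set_integrable lborel {0..T} (?g a)" for a
    by (intro borel_integrable_atLeastAtMost' continuous_intros) (use assms in auto)
  have "bounded_linear ?c"
  proof (rule bounded_linear_intro[of _ 1])
    show "?c (a + b) = ?c a + ?c b" for a b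
      unfolding fourier_coeff_def ev_linear distrib_left set_integral_add(2)[OF i i] by (rule add_divide_distrib)
    show "?c (r *\<^sub>R a) = r *\<^sub>R ?c a" for r a
      unfolding ev_linear scaleR_conv_of_real by (rule fourier_coeff_cmult)
    show "cmod (?c a) \<le> norm a * 1" for a
    proof -
      have c: "set_integrable lborel {0..T} (\<lambda>x. norm a)"
        by (rule borel_integrable_atLeastAtMost') simp
      have "cmod (LINT x:{0..T}|lborel. ?g a x) \<le> (LINT x:{0..T}|lborel. norm a)"
        unfolding set_lebesgue_integral_def using assms
        by (intro order_trans[OF integral_norm_bound] integral_mono
              integrable_norm i[unfolded set_integrable_def] c[unfolded set_integrable_def])
           (auto simp: norm_mult cmod_ev_le indicator_def)
      also have "\<dots> = T * norm a" using assms by (simp add: set_lebesgue_integral_def)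
      finally show ?thesis using assms by (simp add: fourier_coeff_def norm_divide field_simps)
    qed
  qed
  moreover have "?c (mon m c) = coef (mon m c) j" for m c
    using fourier_coeff_cis[OF assms, of m j]
    by (simp add: fourier_coeff_cmult mult_ac)
  ultimately show ?thesis by (rule bounded_linear_h1_ext[OF _ bounded_linear_coef])
qed

lemma ev_inject:
  assumes "\<And>x. ev a x = ev b x"
  shows "a = b"
  using fourier_coeff_ev[of "2 * pi" a] fourier_coeff_ev[of "2 * pi" b] assms by (intro h1_eqI) simp

lemma h1_weight_minus [simp]: "h1_weight (- j) = h1_weight j"
  by (simp add: h1_weight_def)

text \<open>Conjugation of the function \<open>ev a\<close>; on coefficients it also reflects the
  index.\<close>

lift_definition cj :: "h1 \<Rightarrow> h1" is "\<lambda>a j. cnj (a (- j))"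
proof -
  fix a :: "int \<Rightarrow> complex"
  assume "(\<lambda>j. h1_weight j * (cmod (a j))\<^sup>2) summable_on UNIV"
  then have "((\<lambda>j. h1_weight j * (cmod (a j))\<^sup>2) \<circ> uminus) summable_on UNIV"
    by (subst summable_on_reindex[symmetric]) (auto simp: surj_def intro: exI[of _ "- _"])
  then show "(\<lambda>j. h1_weight j * (cmod (cnj (a (- j))))\<^sup>2) summable_on UNIV"
    by (simp add: o_def)
qed

lemma coef_cj [simp]: "coef (cj a) j = cnj (coef a (- j))"
  by (simp add: cj.rep_eq)

lemma norm_cj [simp]: "norm (cj a) = norm a"
proof -
  have "(\<Sum>\<^sub>\<infinity>j. h1_weight j * (cmod (coef a (- j)))\<^sup>2)
      = infsum (\<lambda>j. h1_weight j * (cmod (coef a j))\<^sup>2) (range uminus)"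
    by (subst infsum_reindex) (auto simp: o_def)
  also have "range (uminus :: int \<Rightarrow> int) = UNIV" by (auto simp: surj_def intro: exI[of _ "- _"])
  finally show ?thesis by (simp add: norm_h1_def)
qed

lemma bounded_linear_cj: "bounded_linear cj"
  by (rule bounded_linear_intro[of _ 1]) (auto intro!: h1_eqI simp: scaleR_conv_of_real)

lemma ev_cj [simp]: "ev (cj a) x = cnj (ev a x)"
proof (rule bounded_linear_h1_ext[of "\<lambda>a. ev (cj a) x"])
  have "cj (mon j c) = mon (- j) (cnj c)" for j c by (auto intro!: h1_eqI)
  then show "ev (cj (mon j c)) x = cnj (ev (mon j c) x)" for j c by (simp add: cis_cnj)
qed (intro bounded_linear_compose[OF bounded_linear_ev bounded_linear_cj]
       bounded_linear_compose[OF bounded_linear_cnj bounded_linear_ev])+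

lemma cj_simps [simp]:
  "cj (a * b) = cj a * cj b" "cj (cj a) = a" "cj (a + b) = cj a + cj b" "cj (a - b) = cj a - cj b"
  "cj (- a) = - cj a" "cj (mon j c) = mon (- j) (cnj c)" "cj (r *\<^sub>R a) = r *\<^sub>R cj a" "cj 0 = 0"
  by (rule ev_inject; simp add: scaleR_conv_of_real cis_cnj)+

text \<open>
  The real inner product of \<open>L\<^sub>2\<close>; written as a Fourier coefficient of a product, its adjunction
  rules become identities of commutative algebra.
\<close>

lemma Re_mult_cnj_self: "Re (z * cnj z) = (cmod z)\<^sup>2"
  unfolding cmod_power2 by (simp add: power2_eq_square)

definition ip :: "h1 \<Rightarrow> h1 \<Rightarrow> real" where
  "ip a b = Re (coef (a * cj b) 0)"

lemma ip_le: "\<bar>ip a b\<bar> \<le> norm a * norm b"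
  unfolding ip_def using abs_Re_le_cmod[of "coef (a * cj b) 0"] cmod_coef_le_norm[of "a * cj b" 0]
    norm_mult_ineq[of a "cj b"] by simp

lemma bounded_bilinear_ip: "bounded_bilinear ip"
  by standard (auto simp: ip_def algebra_simps intro!: exI[of _ 1] ip_le[unfolded ip_def])

interpretation ip: bounded_bilinear ip
  by (rule bounded_bilinear_ip)

lemma coef_cj_0: "coef (cj a) 0 = cnj (coef a 0)"
  by simp

lemma ip_commute: "ip a b = ip b a"
  using coef_cj_0[of "a * cj b"] by (simp add: ip_def mult.commute)

lemma ip_mult_left: "ip (c * a) b = ip a (cj c * b)"
  by (simp add: ip_def mult_ac)

lemma coef_mult_cj_0: "coef (a * cj b) 0 = (\<Sum>\<^sub>\<infinity>j. coef a j * cnj (coef b j))"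
  by (simp add: coef_mult)

lemma coef_mult_cj_summable: "(\<lambda>j. coef a j * cnj (coef b j)) summable_on UNIV"
  using convolution_summable[of a "cj b" 0] by simp

lemma ip_has_sum: "((\<lambda>j. Re (coef a j * cnj (coef b j))) has_sum ip a b) UNIV"
  unfolding ip_def coef_mult_cj_0
  by (intro has_sum_Re has_sum_infsum coef_mult_cj_summable)

lemma ip_self_has_sum: "((\<lambda>j. (cmod (coef a j))\<^sup>2) has_sum ip a a) UNIV"
  using ip_has_sum[of a a] by (simp only: Re_mult_cnj_self)

lemma ip_self_nonneg: "0 \<le> ip a a"
  by (rule has_sum_nonneg[OF ip_self_has_sum]) simp

text \<open>The L2 inner product of the derivatives for period \<open>2 * pi\<close>, normalised as
  a mean. It is given as a series because the derivative of an element of \<open>h1\<close> need not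
  lie in \<open>h1\<close>.\<close>

definition dip :: "h1 \<Rightarrow> h1 \<Rightarrow> real" where
  "dip a b = (\<Sum>\<^sub>\<infinity>j. (of_int j)\<^sup>2 * Re (coef a j * cnj (coef b j)))"

lemma sum_dip_le:
  assumes "finite F"
  shows "(\<Sum>j\<in>F. \<bar>(of_int j)\<^sup>2 * Re (coef a j * cnj (coef b j))\<bar>) \<le> norm a * norm b"
proof -
  have "(\<Sum>j\<in>F. \<bar>(of_int j)\<^sup>2 * Re (coef a j * cnj (coef b j))\<bar>)
      \<le> (\<Sum>j\<in>F. \<bar>sqrt (h1_weight j) * cmod (coef a j)\<bar> * \<bar>sqrt (h1_weight j) * cmod (coef b j)\<bar>)"
  proof (rule sum_mono)
    fix j
    have "\<bar>(of_int j)\<^sup>2 * Re (coef a j * cnj (coef b j))\<bar> \<le> h1_weight j * cmod (coef a j * cnj (coef b j))"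
      unfolding abs_mult by (intro mult_mono abs_Re_le_cmod) (auto simp: h1_weight_def)
    also have "\<dots> = (sqrt (h1_weight j))\<^sup>2 * (cmod (coef a j) * cmod (coef b j))"
      by (simp add: norm_mult)
    also have "\<dots> = \<bar>sqrt (h1_weight j) * cmod (coef a j)\<bar> * \<bar>sqrt (h1_weight j) * cmod (coef b j)\<bar>"
      by (simp add: abs_mult power2_eq_square del: real_sqrt_mult_self)
    finally show "\<bar>(of_int j)\<^sup>2 * Re (coef a j * cnj (coef b j))\<bar>
      \<le> \<bar>sqrt (h1_weight j) * cmod (coef a j)\<bar> * \<bar>sqrt (h1_weight j) * cmod (coef b j)\<bar>" .
  qed
  also have "\<dots> \<le> h1_sum F (coef a) * h1_sum F (coef b)" by (rule L2_set_mult_ineq)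
  also have "\<dots> \<le> norm a * norm b"
  proof (intro mult_mono)
    have le: "h1_sum F (coef c) \<le> norm c" for c
      using h1_sum_coef_le[OF assms, of c] norm_ge_zero[of c] by linarith
    show "h1_sum F (coef a) \<le> norm a" "h1_sum F (coef b) \<le> norm b" by (rule le)+
  qed auto
  finally show ?thesis .
qed

lemma dip_abs_summable: "(\<lambda>j. norm ((of_int j)\<^sup>2 * Re (coef a j * cnj (coef b j)))) summable_on UNIV"
  unfolding real_norm_def
  by (rule nonneg_bdd_above_summable_on) (auto intro!: bdd_aboveI2 sum_dip_le simp del: complex_cnj_mult times_complex.sel)

lemma dip_has_sum: "((\<lambda>j. (of_int j)\<^sup>2 * Re (coef a j * cnj (coef b j))) has_sum dip a b) UNIV"
  unfolding dip_def by (rule has_sum_infsum[OF abs_summable_summable[OF dip_abs_summable]])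

lemma dip_le: "\<bar>dip a b\<bar> \<le> norm a * norm b"
proof -
  have "norm (dip a b) \<le> (\<Sum>\<^sub>\<infinity>j. norm ((of_int j)\<^sup>2 * Re (coef a j * cnj (coef b j))))"
    unfolding dip_def by (rule norm_infsum_bound[OF dip_abs_summable])
  also have "\<dots> \<le> norm a * norm b"
    by (rule infsum_le_finite_sums[OF dip_abs_summable]) (simp only: real_norm_def sum_dip_le)
  finally show ?thesis by simp
qed

lemma dip_eqI: "((\<lambda>j. (of_int j)\<^sup>2 * Re (coef a j * cnj (coef b j))) has_sum s) UNIV \<Longrightarrow> dip a b = s"
  by (rule has_sum_unique[OF dip_has_sum])

lemma bounded_bilinear_dip: "bounded_bilinear dip"
proof
  show "dip (a + a') b = dip a b + dip a' b" for a a' b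
    by (rule dip_eqI, rule has_sum_cong[THEN iffD1, OF _ has_sum_add[OF dip_has_sum[of a b] dip_has_sum[of a' b]]])
       (simp add: algebra_simps)
  show "dip a (b + b') = dip a b + dip a b'" for a b b'
    by (rule dip_eqI, rule has_sum_cong[THEN iffD1, OF _ has_sum_add[OF dip_has_sum[of a b] dip_has_sum[of a b']]])
       (simp add: algebra_simps)
  show "dip (r *\<^sub>R a) b = r *\<^sub>R dip a b" for r a b
    unfolding dip_def infsum_scaleR_right[symmetric] by (rule infsum_cong) (simp add: algebra_simps)
  show "dip a (r *\<^sub>R b) = r *\<^sub>R dip a b" for r a b
    unfolding dip_def infsum_scaleR_right[symmetric] by (rule infsum_cong) (simp add: algebra_simps)
  show "\<exists>K. \<forall>a b. norm (dip a b) \<le> norm a * norm b * K"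
    by (rule exI[of _ 1]) (simp add: dip_le)
qed

interpretation dip: bounded_bilinear dip
  by (rule bounded_bilinear_dip)

lemma dip_self_has_sum: "((\<lambda>j. (of_int j)\<^sup>2 * (cmod (coef a j))\<^sup>2) has_sum dip a a) UNIV"
  using dip_has_sum[of a a] by (simp only: Re_mult_cnj_self)

lemma dip_self_nonneg: "0 \<le> dip a a"
  by (rule has_sum_nonneg[OF dip_self_has_sum]) simp

lemma norm_h1_eq_ip: "(norm a)\<^sup>2 = 25 * (ip a a + dip a a)"
proof -
  have "((\<lambda>j. h1_weight j * (cmod (coef a j))\<^sup>2) has_sum (ip a a + dip a a)) UNIV"
    using has_sum_add[OF ip_self_has_sum[of a] dip_self_has_sum[of a]]
    by (simp add: h1_weight_def algebra_simps)
  then show ?thesis by (simp add: norm_h1_square infsumI)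
qed

lemma dip_cst_mult: "dip (mon 0 c * a) b = dip a (mon 0 (cnj c) * b)"
  by (simp add: dip_def mult_ac(1))
     (simp add: algebra_simps)

text \<open>The lifted map must preserve \<open>h1\<close> for every symbol, so the result is set to
  0 for symbols not bounded by 1.\<close>

lift_definition fmult :: "(int \<Rightarrow> real) \<Rightarrow> h1 \<Rightarrow> h1" is
  "\<lambda>m a j. if \<forall>i. \<bar>m i\<bar> \<le> 1 then of_real (m j) * a j else 0"
proof -
  fix m :: "int \<Rightarrow> real" and a :: "int \<Rightarrow> complex"
  assume "(\<lambda>j. h1_weight j * (cmod (a j))\<^sup>2) summable_on UNIV"
  then show "(\<lambda>j. h1_weight j * (cmod (if \<forall>i. \<bar>m i\<bar> \<le> 1 then of_real (m j) * a j else 0))\<^sup>2) summable_on UNIV"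
    by (rule h1_mem_dominated[where M = 1]) (auto simp: norm_mult intro!: mult_left_le_one_le)
qed

context
  fixes m :: "int \<Rightarrow> real"
  assumes m: "\<And>j. \<bar>m j\<bar> \<le> 1"
begin

lemma coef_fmult: "coef (fmult m a) j = of_real (m j) * coef a j"
  using m by (simp add: fmult.rep_eq)

lemma norm_fmult_le: "norm (fmult m a) \<le> norm a"
proof -
  have "cmod (coef (fmult m a) j) \<le> 1 * cmod (coef a j)" for j
    using m[of j] by (simp add: coef_fmult norm_mult mult_left_le_one_le)
  from norm_h1_mono[OF this] show ?thesis by simp
qed

lemma bounded_linear_fmult: "bounded_linear (fmult m)"
  by (rule bounded_linear_intro[of _ 1])
     (auto intro!: h1_eqI simp: coef_fmult norm_fmult_le algebra_simps)

lemma ip_fmult: "ip (fmult m a) b = ip a (fmult m b)"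
proof -
  have "((\<lambda>j. Re (coef (fmult m a) j * cnj (coef b j))) has_sum ip a (fmult m b)) UNIV"
    using ip_has_sum[of a "fmult m b"] by (simp add: coef_fmult algebra_simps)
  then show ?thesis using ip_has_sum has_sum_unique by blast
qed

lemma ip_fmult_self_has_sum: "((\<lambda>j. m j * (cmod (coef a j))\<^sup>2) has_sum ip (fmult m a) a) UNIV"
proof -
  have "Re (coef (fmult m a) j * cnj (coef a j)) = m j * (cmod (coef a j))\<^sup>2" for j
    using Re_mult_cnj_self[of "coef a j"] by (simp add: coef_fmult mult.assoc flip: distrib_left)
  then show ?thesis using ip_has_sum[of "fmult m a" a] by simp
qed

lemma cj_fmult:
  assumes "\<And>j. m (- j) = m j"
  shows "cj (fmult m a) = fmult m (cj a)"
  by (rule h1_eqI) (simp add: coef_fmult assms)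

end

section \<open>Conservation of mass and energy\<close>

lemma cj_one [simp]: "cj 1 = 1"
  by (simp add: one_h1_def)

lemma norm_cst_mult: "norm (mon 0 c * a) = cmod c * norm a"
proof -
  have "(\<Sum>\<^sub>\<infinity>j. h1_weight j * (cmod (coef (mon 0 c * a) j))\<^sup>2)
      = (\<Sum>\<^sub>\<infinity>j. (cmod c)\<^sup>2 * (h1_weight j * (cmod (coef a j))\<^sup>2))"
    by (intro infsum_cong) (simp add: norm_mult power_mult_distrib)
  then show ?thesis by (simp add: norm_h1_def infsum_cmult_right' real_sqrt_mult)
qed

lemma cst_cnj_cst_mult:
  assumes "cmod u = 1"
  shows "mon 0 (cnj u) * (mon 0 u * x) = x"
proof -
  have "cnj u * u = 1" using assms by (metis complex_norm_square mult.commute of_real_1 power_one)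
  then show ?thesis by (simp add: mult.assoc[symmetric] flip: one_h1_def)
qed

text \<open>\<open>g\<close> and \<open>a * cj a\<close> represent real functions, so the mean of
  their product is real, and multiplication by i leaves no real part. This cancellation underlies
  conservation of mass and, with \<open>g = 1\<close>, of energy.\<close>

lemma ip_i_self:
  assumes "cj g = g"
  shows "ip (mon 0 \<i> * a) (g * a) = 0"
proof -
  have "coef (g * (a * cj a)) 0 = cnj (coef (g * (a * cj a)) 0)"
    using coef_cj_0[of "g * (a * cj a)"] assms by (simp add: mult_ac del: coef_cj)
  then have "Im (coef (g * (a * cj a)) 0) = 0"
    by (metis Reals_cnj_iff complex_is_Real_iff)
  moreover have "mon 0 \<i> * a * cj (g * a) = mon 0 \<i> * (g * (a * cj a))"
    using assms by (simp add: mult_ac)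
  ultimately show ?thesis by (simp add: ip_def)
qed

lemma ip_i_skew: "ip (mon 0 \<i> * a) b = - ip a (mon 0 \<i> * b)"
proof -
  have "mon 0 (- \<i>) * b = - (mon 0 \<i> * b)" by (rule h1_eqI) simp
  then show ?thesis by (simp add: ip_mult_left ip.minus_right)
qed

text \<open>Minus the second derivative of \<open>trunc N a\<close>; the factor \<open>lam^2\<close>
  of the rescaling is kept outside.\<close>

definition trunc_laplace :: "nat \<Rightarrow> h1 \<Rightarrow> h1" where
  "trunc_laplace N a = (\<Sum>j=-int N..int N. mon j ((of_int j)\<^sup>2 * coef a j))"

lemma coef_trunc_laplace [simp]:
  "coef (trunc_laplace N a) j = (if \<bar>j\<bar> \<le> int N then (of_int j)\<^sup>2 * coef a j else 0)"
  by (auto simp: trunc_laplace_def)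

text \<open>Integration by parts, legitimate because \<open>b\<close> is cut to finitely many
  modes.\<close>

lemma dip_trunc: "dip a (trunc N b) = ip a (trunc_laplace N b)"
  by (rule dip_eqI, rule has_sum_cong[THEN iffD1, OF _ ip_has_sum])
     (auto simp: Re_mult_cnj_self algebra_simps simp flip: of_int_power)

lemma dip_commute: "dip a b = dip b a"
  by (simp add: dip_def algebra_simps)

lemma ip_i_trunc_laplace: "ip (mon 0 \<i> * trunc_laplace N a) (trunc N a) = 0"
proof -
  have z: "Re (coef (mon 0 \<i> * trunc_laplace N a) j * cnj (coef (trunc N a) j)) = 0" for j
    by (simp add: algebra_simps flip: of_int_power)
  have "((\<lambda>j::int. 0::real) has_sum ip (mon 0 \<i> * trunc_laplace N a) (trunc N a)) UNIV"
    using ip_has_sum[of "mon 0 \<i> * trunc_laplace N a" "trunc N a"] unfolding z .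
  then show ?thesis by (rule has_sum_unique) (simp add: has_sum_0)
qed

text \<open>Time integration comes before the limit: the derivatives \<open>e J\<close> are
  uniformly bounded and tend to 0 pointwise, so dominated convergence removes the error.\<close>

lemma limit_of_almost_conserved:
  fixes h e :: "nat \<Rightarrow> real \<Rightarrow> real"
  assumes "0 \<le> \<tau>"
    and h: "\<And>J t. t \<in> {0..\<tau>} \<Longrightarrow> (h J has_vector_derivative e J t) (at t within {0..\<tau>})"
    and bound: "\<And>J t. t \<in> {0..\<tau>} \<Longrightarrow> \<bar>e J t\<bar> \<le> M"
    and lim: "\<And>t. t \<in> {0..\<tau>} \<Longrightarrow> (\<lambda>J. e J t) \<longlonglongrightarrow> 0"
    and H: "\<And>t. (\<lambda>J. h J t) \<longlonglongrightarrow> H t"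
  shows "H \<tau> = H 0"
proof -
  have i: "(e J has_integral (h J \<tau> - h J 0)) {0..\<tau>}" for J
    by (rule fundamental_theorem_of_calculus) (use assms in auto)
  have "(\<lambda>J. integral {0..\<tau>} (e J)) \<longlonglongrightarrow> integral {0..\<tau>} (\<lambda>t. 0)"
    by (rule dominated_convergence(2)[where h = "\<lambda>t. M"]) (use i bound lim in auto)
  then have "(\<lambda>J. h J \<tau> - h J 0) \<longlonglongrightarrow> 0"
    by (simp add: integral_unique[OF i])
  moreover have "(\<lambda>J. h J \<tau> - h J 0) \<longlonglongrightarrow> H \<tau> - H 0" by (intro tendsto_intros H)
  ultimately show ?thesis using LIMSEQ_unique by fastforce
qed

text \<open>The equation rescaled to the circle of length \<open>2 * pi\<close>: \<open>lam\<close>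
  is the smallest positive wave number, \<open>m\<close> the Fourier symbol of the nonlocal kernel,
  \<open>V\<close> the coefficient sequence of the potential. Nonnegativity of \<open>m\<close>
  makes the interaction energy nonnegative.\<close>

locale nonlocal_gp =
  fixes lam :: real and m :: "int \<Rightarrow> real" and V :: h1
  assumes lam_pos: "0 < lam"
    and m_nonneg: "0 \<le> m j" and m_le1: "m j \<le> 1" and m_even: "m (- j) = m j"
    and V_real: "cj V = V"
begin

lemma m_abs: "\<bar>m j\<bar> \<le> 1"
  using m_nonneg[of j] m_le1[of j] by simp

lemmas bounded_linear_R = bounded_linear_fmult[of m, OF m_abs]
  and ip_R = ip_fmult[of m, OF m_abs]
  and norm_R_le = norm_fmult_le[of m, OF m_abs]
  and coef_R = coef_fmult[of m, OF m_abs]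
  and cj_R = cj_fmult[of m, OF m_abs m_even]

sublocale R: bounded_linear "fmult m"
  by (rule bounded_linear_R)

definition nonlin :: "h1 \<Rightarrow> h1" where
  "nonlin a = (V + fmult m (a * cj a)) * a"

definition energy :: "h1 \<Rightarrow> real" where
  "energy a = lam\<^sup>2 / 2 * dip a a + ip (V * a) a + ip (fmult m (a * cj a)) (a * cj a) / 2"

text \<open>Only a coefficient function, since the Laplacian of an element of \<open>h1\<close> need
  not lie in \<open>h1\<close>. For the same reason \<open>evolves\<close> asks for derivatives one
  coefficient at a time.\<close>

definition flow :: "h1 \<Rightarrow> int \<Rightarrow> complex" where
  "flow a j = - \<i> * (of_real (lam\<^sup>2 / 2 * (of_int j)\<^sup>2) * coef a j + coef (nonlin a) j)"

definition evolves :: "real set \<Rightarrow> (real \<Rightarrow> h1) \<Rightarrow> bool" where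
  "evolves I a \<longleftrightarrow> continuous_on I a \<and>
     (\<forall>t\<in>I. \<forall>j. ((\<lambda>s. coef (a s) j) has_vector_derivative flow (a t) j) (at t within I))"

lemma tendsto_nonlin [tendsto_intros]:
  assumes "(a \<longlongrightarrow> l) F"
  shows "((\<lambda>x. nonlin (a x)) \<longlongrightarrow> nonlin l) F"
  unfolding nonlin_def
  by (intro tendsto_intros R.tendsto bounded_linear.tendsto[OF bounded_linear_cj] assms)

lemma tendsto_energy [tendsto_intros]:
  assumes "(a \<longlongrightarrow> l) F"
  shows "((\<lambda>x. energy (a x)) \<longlongrightarrow> energy l) F"
  unfolding energy_def
  by (intro tendsto_intros R.tendsto bounded_linear.tendsto[OF bounded_linear_cj] ip.tendsto dip.tendsto assms) simp

lemma norm_nonlin_le: "norm (nonlin a) \<le> (norm V + (norm a)\<^sup>2) * norm a"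
proof -
  have "norm (fmult m (a * cj a)) \<le> (norm a)\<^sup>2"
    using norm_R_le[of "a * cj a"] norm_mult_ineq[of a "cj a"] by (simp add: power2_eq_square)
  then have "norm (V + fmult m (a * cj a)) \<le> norm V + (norm a)\<^sup>2"
    using norm_triangle_ineq[of V "fmult m (a * cj a)"] by linarith
  then show ?thesis
    unfolding nonlin_def by (intro order_trans[OF norm_mult_ineq] mult_right_mono) auto
qed

lemma density_potential_real: "cj (V + fmult m (a * cj a)) = V + fmult m (a * cj a)"
  by (simp add: V_real cj_R mult.commute)

lemma ip_nonlin_i_self: "ip (mon 0 \<i> * a) (nonlin a) = 0"
  unfolding nonlin_def by (rule ip_i_self[OF density_potential_real])

text \<open>Finitely many modes form a differentiable curve in \<open>h1\<close>, although
  \<open>a\<close> itself need not be one.\<close>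

lemma trunc_deriv:
  assumes "evolves I a" "t \<in> I"
  shows "((\<lambda>s. trunc N (a s)) has_vector_derivative
     - (mon 0 \<i> * ((lam\<^sup>2 / 2) *\<^sub>R trunc_laplace N (a t) + trunc N (nonlin (a t))))) (at t within I)"
proof -
  have "((\<lambda>s. trunc N (a s)) has_vector_derivative (\<Sum>j=-int N..int N. mon j (flow (a t) j))) (at t within I)"
    unfolding trunc_def
    by (intro has_vector_derivative_sum bounded_linear.has_vector_derivative[OF bounded_linear_mon])
       (use assms in \<open>auto simp: evolves_def\<close>)
  also have "(\<Sum>j=-int N..int N. mon j (flow (a t) j))
     = - (mon 0 \<i> * ((lam\<^sup>2 / 2) *\<^sub>R trunc_laplace N (a t) + trunc N (nonlin (a t))))"
    by (rule h1_eqI) (auto simp: flow_def scaleR_conv_of_real algebra_simps)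
  finally show ?thesis .
qed

text \<open>The chain rule for a quartic functional: reality of \<open>V\<close> and symmetry of the
  multiplier merge paired terms into the gradient \<open>2 * nonlin\<close>.\<close>

lemma energy_deriv:
  assumes p: "(p has_vector_derivative p') (at t within I)"
  shows "((\<lambda>s. energy (p s)) has_vector_derivative (lam\<^sup>2 * dip p' (p t) + 2 * ip (nonlin (p t)) p')) (at t within I)"
proof -
  note cd = bounded_linear.has_vector_derivative[OF bounded_linear_cj p]
  note pp = has_vector_derivative_mult[OF p cd]
  define r where "r = p t * cj (p t)"
  define r' where "r' = p t * cj p' + p' * cj (p t)"
  have "((\<lambda>s. energy (p s)) has_vector_derivative
     (lam\<^sup>2 / 2 * (dip (p t) p' + dip p' (p t)) + (ip (V * p t) p' + ip (V * p') (p t))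
      + (ip (fmult m r) r' + ip (fmult m r') r) / 2)) (at t within I)"
    unfolding energy_def r_def r'_def
    by (intro has_vector_derivative_add has_vector_derivative_divide has_vector_derivative_mult_right
        dip.has_vector_derivative ip.has_vector_derivative R.has_vector_derivative pp p
        bounded_linear.has_vector_derivative[OF bounded_linear_mult_right p])
  moreover have "ip (V * p') (p t) = ip (V * p t) p'"
    by (simp only: ip_mult_left[of V p'] V_real ip_commute[of p'])
  moreover have "ip (fmult m r') r = ip (fmult m r) r'"
    by (simp only: ip_R[of r'] ip_commute[of r'])
  moreover have "ip (fmult m r) r' = 2 * ip (fmult m r * p t) p'"
  proof -
    have "cj (fmult m r) = fmult m r" by (simp add: cj_R r_def mult.commute)
    then have "ip (fmult m r) (p t * cj p') = ip (fmult m r * p t) p'"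
      using coef_cj_0[of "fmult m r * (p t * cj p')"]
      by (simp add: ip_def mult_ac del: coef_cj)
    moreover have "ip (fmult m r) (p' * cj (p t)) = ip (fmult m r * p t) p'"
      by (simp add: ip_def mult_ac)
    ultimately show ?thesis by (simp add: r'_def ip.add_right)
  qed
  moreover have "nonlin (p t) = V * p t + fmult m r * p t" by (simp add: nonlin_def r_def algebra_simps)
  ultimately show ?thesis
    by (simp add: dip_commute[of "p t" p'] ip.add_left algebra_simps)
qed

theorem energy_mass_conserved:
  assumes "0 \<le> \<tau>" and a: "evolves {0..\<tau>} a"
  shows "energy (a \<tau>) = energy (a 0)" and "ip (a \<tau>) (a \<tau>) = ip (a 0) (a 0)"
proof -
  let ?i = "mon 0 \<i>"
  have "compact (a ` {0..\<tau>})"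
    using a by (intro compact_continuous_image) (auto simp: evolves_def)
  then obtain K where K: "\<And>t. t \<in> {0..\<tau>} \<Longrightarrow> norm (a t) \<le> K" and "0 \<le> K"
    using compact_imp_bounded bounded_pos by (metis image_eqI less_imp_le)
  define C where "C = (norm V + K\<^sup>2) * K"
  have C: "norm (nonlin b) \<le> C" if "norm b \<le> K" for b
    unfolding C_def by (rule order_trans[OF norm_nonlin_le])
      (use that \<open>0 \<le> K\<close> in \<open>intro mult_mono add_mono power_mono\<close>, auto)
  have "0 \<le> C" using \<open>0 \<le> K\<close> by (simp add: C_def)
  have K': "norm (trunc J (a t)) \<le> K" if "t \<in> {0..\<tau>}" for J t
    using norm_trunc_le[of J "a t"] K[OF that] by linarith
  have F: "norm (trunc J (nonlin (a t))) \<le> C" "norm (nonlin (trunc J (a t))) \<le> C" if "t \<in> {0..\<tau>}" for J t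
    using norm_trunc_le[of J "nonlin (a t)"] C[OF K[OF that]] C[OF K'[OF that]] by auto
  have i_le: "norm (?i * x) = norm x" for x by (simp add: norm_cst_mult)
  let ?p = "\<lambda>J t. trunc J (a t)"
  let ?F = "\<lambda>J t. trunc J (nonlin (a t))"
  \<comment> \<open>Differentiating the truncated energy produces \<open>trunc_laplace\<close>,
    which has no bound uniform in \<open>J\<close>. It is paired only with the difference between
    truncating after and before \<open>nonlin\<close>; written with \<open>dip\<close>, this pairing
    is bounded by \<open>h1\<close> norms uniformly in \<open>J\<close> and tends to 0.\<close>
  let ?e = "\<lambda>J t. - lam\<^sup>2 * dip (?p J t) (?i * (?F J t - nonlin (?p J t))) - 2 * ip (nonlin (?p J t)) (?i * ?F J t)"
  show "ip (a \<tau>) (a \<tau>) = ip (a 0) (a 0)"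
  proof (rule limit_of_almost_conserved[where h = "\<lambda>J t. ip (?p J t) (?p J t)"
        and e = "\<lambda>J t. - 2 * ip (?i * ?F J t) (?p J t)" and M = "2 * (C * K)"])
    fix J t assume t: "t \<in> {0..\<tau>}"
    define p' where "p' = - (?i * ((lam\<^sup>2 / 2) *\<^sub>R trunc_laplace J (a t) + ?F J t))"
    have "((\<lambda>t. ip (?p J t) (?p J t)) has_vector_derivative
        (ip (?p J t) p' + ip p' (?p J t))) (at t within {0..\<tau>})"
      unfolding p'_def by (intro ip.has_vector_derivative trunc_deriv[OF a t])
    moreover have "ip p' (?p J t) = - ip (?i * ?F J t) (?p J t)"
      unfolding p'_def distrib_left mult_scaleR_right
      by (simp add: ip.add_left ip.diff_left ip.minus_left ip.scaleR_left ip_i_trunc_laplace)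
    ultimately show "((\<lambda>t. ip (?p J t) (?p J t)) has_vector_derivative
        - 2 * ip (?i * ?F J t) (?p J t)) (at t within {0..\<tau>})"
      by (simp add: ip_commute[of "?p J t" p'])
    have "\<bar>ip (?i * ?F J t) (?p J t)\<bar> \<le> C * K"
      by (rule order_trans[OF ip_le], unfold i_le) (intro mult_mono F K' t \<open>0 \<le> C\<close> norm_ge_zero)
    then show "\<bar>- 2 * ip (?i * ?F J t) (?p J t)\<bar> \<le> 2 * (C * K)" by simp
  next
    fix t
    have "(\<lambda>J. - 2 * ip (?i * ?F J t) (?p J t))
        \<longlonglongrightarrow> - 2 * ip (?i * nonlin (a t)) (a t)"
      by (intro tendsto_intros ip.tendsto trunc_tendsto)
    moreover have "ip (?i * nonlin (a t)) (a t) = 0"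
      using ip_nonlin_i_self[of "a t"] ip_i_skew[of "nonlin (a t)" "a t"] by (simp add: ip_commute)
    ultimately show "(\<lambda>J. - 2 * ip (?i * ?F J t) (?p J t)) \<longlonglongrightarrow> 0" by simp
    show "(\<lambda>J. ip (?p J t) (?p J t)) \<longlonglongrightarrow> ip (a t) (a t)"
      by (intro ip.tendsto trunc_tendsto)
  qed fact
  show "energy (a \<tau>) = energy (a 0)"
  proof (rule limit_of_almost_conserved[where h = "\<lambda>J t. energy (?p J t)"
        and e = ?e
        and M = "lam\<^sup>2 * (K * (2 * C)) + 2 * (C * C)"])
    fix J t assume t: "t \<in> {0..\<tau>}"
    define p where "p = trunc J (a t)"
    define F where "F = trunc J (nonlin (a t))"
    define l where "l = trunc_laplace J (a t)"
    define p' where "p' = - (?i * ((lam\<^sup>2 / 2) *\<^sub>R l + F))"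
    have "((\<lambda>t. energy (?p J t)) has_vector_derivative
        (lam\<^sup>2 * dip p' p + 2 * ip (nonlin p) p')) (at t within {0..\<tau>})"
      unfolding p'_def p_def F_def l_def by (rule energy_deriv[OF trunc_deriv[OF a t]])
    moreover have "lam\<^sup>2 * dip p' p + 2 * ip (nonlin p) p'
        = - lam\<^sup>2 * dip p (?i * (F - nonlin p)) - 2 * ip (nonlin p) (?i * F)"
    proof -
      have d: "dip x p = ip x l" for x by (simp add: p_def l_def dip_trunc)
      have 1: "ip (?i * l) l = 0" using ip_i_self[of 1 l] by simp
      have 2: "ip (nonlin p) (?i * l) = - ip l (?i * nonlin p)"
        using ip_i_skew[of "nonlin p" l] by (simp add: ip_commute)
      show ?thesis
        unfolding dip_commute[of p] d p'_def
        by (simp add: distrib_left right_diff_distrib ip.add_left ip.add_right ip.diff_left ip.minus_left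
            ip.minus_right ip.diff_right ip.scaleR_left ip.scaleR_right 1 2)
           (simp add: algebra_simps ip_commute)
    qed
    ultimately show "((\<lambda>t. energy (?p J t)) has_vector_derivative
        ?e J t) (at t within {0..\<tau>})"
      by (simp add: p_def F_def)
    have "norm (F - nonlin p) \<le> 2 * C"
      using norm_triangle_ineq4[of F "nonlin p"] F[OF t, of J] by (simp add: F_def p_def)
    then have "\<bar>dip p (?i * (F - nonlin p))\<bar> \<le> K * (2 * C)"
      by (intro order_trans[OF dip_le], unfold i_le p_def)
         (intro mult_mono K' t \<open>0 \<le> K\<close> norm_ge_zero)
    moreover have "\<bar>ip (nonlin p) (?i * F)\<bar> \<le> C * C"
      by (rule order_trans[OF ip_le], unfold i_le p_def F_def) (intro mult_mono F t \<open>0 \<le> C\<close> norm_ge_zero)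
    ultimately have "lam\<^sup>2 * \<bar>dip p (?i * (F - nonlin p))\<bar> + 2 * \<bar>ip (nonlin p) (?i * F)\<bar>
        \<le> lam\<^sup>2 * (K * (2 * C)) + 2 * (C * C)"
      by (intro add_mono mult_left_mono) auto
    moreover have "\<bar>- lam\<^sup>2 * x - 2 * y\<bar> \<le> lam\<^sup>2 * \<bar>x\<bar> + 2 * \<bar>y\<bar>" for x y
      using abs_triangle_ineq4[of "- lam\<^sup>2 * x" "2 * y"] by (simp add: abs_mult)
    ultimately show "\<bar>?e J t\<bar>
        \<le> lam\<^sup>2 * (K * (2 * C)) + 2 * (C * C)"
      unfolding F_def p_def using order_trans by blast
  next
    fix t
    have "(\<lambda>J. ?e J t)
        \<longlonglongrightarrow> - lam\<^sup>2 * dip (a t) (?i * (nonlin (a t) - nonlin (a t))) - 2 * ip (nonlin (a t)) (?i * nonlin (a t))"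
      by (intro tendsto_intros ip.tendsto dip.tendsto trunc_tendsto)
    moreover have "ip (nonlin (a t)) (?i * nonlin (a t)) = 0"
      using ip_i_self[of 1 "nonlin (a t)"] by (simp add: ip_commute)
    ultimately show "(\<lambda>J. ?e J t) \<longlonglongrightarrow> 0"
      by (simp add: dip.zero_right)
    show "(\<lambda>J. energy (?p J t)) \<longlonglongrightarrow> energy (a t)"
      by (intro tendsto_intros trunc_tendsto)
  qed fact
qed

end

section \<open>Global existence\<close>

text \<open>With phases of the form \<open>c j * t\<close> this is the free Schroedinger
  group.\<close>

lift_definition phase :: "(int \<Rightarrow> real) \<Rightarrow> h1 \<Rightarrow> h1" is "\<lambda>\<theta> a j. cis (\<theta> j) * a j"
  by (rule h1_mem_dominated[where M = 1]) (auto simp: norm_mult)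

lemma coef_phase [simp]: "coef (phase \<theta> a) j = cis (\<theta> j) * coef a j"
  by (simp add: phase.rep_eq)

lemma norm_phase [simp]: "norm (phase \<theta> a) = norm a"
  by (simp add: norm_h1_def norm_mult)

lemma phase_diff: "phase \<theta> (a - b) = phase \<theta> a - phase \<theta> b"
  by (rule h1_eqI) (simp add: algebra_simps)

lemma phase_phase: "phase \<theta> (phase \<eta> a) = phase (\<lambda>j. \<theta> j + \<eta> j) a"
  by (rule h1_eqI) (simp flip: cis_mult)

lemma phase_0 [simp]: "phase (\<lambda>_. 0) a = a"
  by (rule h1_eqI) simp

text \<open>The \<open>c j\<close> may be unbounded, so continuity in \<open>t\<close> holds for a
  fixed argument only. It is inherited from trigonometric polynomials because every phase map is an
  isometry.\<close>

lemma continuous_on_phase_const: "continuous_on UNIV (\<lambda>t. phase (\<lambda>j. c j * t) a)"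
proof (rule uniform_limit_theorem)
  have "phase (\<lambda>j. c j * t) (trunc N a) = (\<Sum>j=-int N..int N. mon j (cis (c j * t) * coef a j))" for t N
    by (rule h1_eqI) auto
  then show "\<forall>\<^sub>F N in sequentially. continuous_on UNIV (\<lambda>t. phase (\<lambda>j. c j * t) (trunc N a))"
    by (simp only:) (intro always_eventually allI continuous_intros bounded_linear.continuous_on[OF bounded_linear_mon])
  show "uniform_limit UNIV (\<lambda>N t. phase (\<lambda>j. c j * t) (trunc N a)) (\<lambda>t. phase (\<lambda>j. c j * t) a) sequentially"
  proof (rule uniform_limitI)
    fix e :: real assume "e > 0"
    then have "\<forall>\<^sub>F N in sequentially. dist (trunc N a) a < e" by (rule tendstoD[OF trunc_tendsto])
    then show "\<forall>\<^sub>F N in sequentially. \<forall>t\<in>UNIV. dist (phase (\<lambda>j. c j * t) (trunc N a)) (phase (\<lambda>j. c j * t) a) < e"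
      by eventually_elim (simp add: dist_norm flip: phase_diff)
  qed
qed simp

text \<open>Splitting off \<open>b s - b t\<close>, which the isometry keeps small, reduces the
  claim to a fixed argument.\<close>

lemma continuous_on_phase:
  assumes "continuous_on S b"
  shows "continuous_on S (\<lambda>t. phase (\<lambda>j. c j * t) (b t))"
  unfolding continuous_on_def
proof
  fix t assume t: "t \<in> S"
  have "((\<lambda>s. phase (\<lambda>j. c j * s) (b s - b t) + phase (\<lambda>j. c j * s) (b t)) \<longlongrightarrow> 0 + phase (\<lambda>j. c j * t) (b t)) (at t within S)"
  proof (rule tendsto_add)
    have "((\<lambda>s. b s - b t) \<longlongrightarrow> b t - b t) (at t within S)"
      using assms t by (intro tendsto_intros) (auto simp: continuous_on_def)
    then have "((\<lambda>s. norm (b s - b t)) \<longlongrightarrow> 0) (at t within S)"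
      using tendsto_norm by fastforce
    then show "((\<lambda>s. phase (\<lambda>j. c j * s) (b s - b t)) \<longlongrightarrow> 0) (at t within S)"
      using tendsto_norm_zero_iff[of "\<lambda>s. phase (\<lambda>j. c j * s) (b s - b t)"] by simp
    show "((\<lambda>s. phase (\<lambda>j. c j * s) (b t)) \<longlongrightarrow> phase (\<lambda>j. c j * t) (b t)) (at t within S)"
      using continuous_on_phase_const[of c "b t"] t
      by (meson UNIV_I continuous_on_def tendsto_within_subset top_greatest)
  qed
  then show "((\<lambda>s. phase (\<lambda>j. c j * s) (b s)) \<longlongrightarrow> phase (\<lambda>j. c j * t) (b t)) (at t within S)"
    by (simp add: phase_diff)
qed

text \<open>
  Picard iteration on \<open>[0,\<infinity>)\<close> in one step: in the weighted norm \<open>sup \<parallel>e\<^bsup>-2Lt\<^esup> b(t)\<parallel>\<close> the integral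
  operator contracts by \<open>1/2\<close>.
\<close>

lemma global_ode_solution:
  fixes F :: "real \<Rightarrow> 'a::banach \<Rightarrow> 'a"
  assumes cont: "\<And>b. continuous_on {0..} b \<Longrightarrow> continuous_on {0..} (\<lambda>t. F t (b t))"
    and lip: "\<And>t x y. norm (F t x - F t y) \<le> L * norm (x - y)" and L: "L > 0"
    and bound: "\<And>t x. norm (F t x) \<le> K"
  obtains b where "continuous_on {0..} b" "b 0 = x0"
    "\<And>t. t \<ge> 0 \<Longrightarrow> (b has_vector_derivative F t (b t)) (at t within {0..})"
proof -
  \<comment> \<open>The unknown \<open>y\<close> is \<open>exp (- (2 * L * t))\<close> times the
    solution, so the sup norm of bounded continuous functions is the weighted norm; \<open>G\<close>
    undoes the weight before applying \<open>F\<close>.\<close>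
  define G where "G y s = F s (exp (2 * L * s) *\<^sub>R apply_bcontfun y s)" for y s
  define P where "P y t = exp (- (2 * L * t)) *\<^sub>R (x0 + integral {0..t} (G y))" for y t
  have contG: "continuous_on {0..} (G y)" for y
    unfolding G_def by (intro cont continuous_intros) auto
  have intG: "G y integrable_on {0..t}" for y t
    by (rule integrable_continuous_interval, rule continuous_on_subset[OF contG]) auto
  have contI: "continuous_on {0..} (\<lambda>t. integral {0..t} (G y))" for y
  proof -
    have "continuous (at t within {0..}) (\<lambda>t. integral {0..t} (G y))" if "t \<ge> 0" for t
    proof -
      have "continuous_on {0..t + 1} (\<lambda>t. integral {0..t} (G y))"
        by (rule indefinite_integral_continuous_1[OF intG])
      then have "continuous (at t within {0..t + 1}) (\<lambda>t. integral {0..t} (G y))"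
        using that by (simp add: continuous_on_eq_continuous_within)
      moreover have "at t within {0..t + 1} = at t within {0..}"
        by (rule at_within_nhd[of t "{..<t + 1}"]) auto
      ultimately show ?thesis by simp
    qed
    then show ?thesis by (simp add: continuous_on_eq_continuous_within)
  qed
  have K: "0 \<le> K" using bound[of 0 0] norm_ge_zero order_trans by blast
  have normI: "norm (integral {0..t} (G y)) \<le> K * t" if "t \<ge> 0" for t y
    using integral_bound[of 0 t "G y" K] that continuous_on_subset[OF contG] bound by (auto simp: G_def)
  \<comment> \<open>Bounded continuous functions live on the whole line, hence the constant
    extension through \<open>max 0 t\<close>. As \<open>F\<close> is bounded, the integral grows at
    most linearly, and the weight keeps \<open>P y\<close> bounded.\<close>
  have "(\<lambda>t. P y (max 0 t)) \<in> bcontfun" for y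
  proof (rule bcontfun_normI)
    show "continuous_on UNIV (\<lambda>t. P y (max 0 t))"
    proof (rule continuous_on_compose2[of "{0..}" "P y"])
      show "continuous_on {0..} (P y)" unfolding P_def by (intro continuous_intros contI)
    qed (auto intro!: continuous_intros)
    fix t :: real
    define s where "s = max 0 t"
    have s: "s \<ge> 0" by (simp add: s_def)
    have "norm (P y s) \<le> exp (- (2 * L * s)) * (norm x0 + K * s)"
      unfolding P_def norm_scaleR abs_exp_cancel
      by (intro mult_left_mono order_trans[OF norm_triangle_ineq] add_left_mono normI s) auto
    also have "\<dots> = exp (- (2 * L * s)) * norm x0 + K / (2 * L) * (exp (- (2 * L * s)) * (2 * L * s))"
      using L by (simp add: field_simps)
    also have "\<dots> \<le> 1 * norm x0 + K / (2 * L) * 1"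
    proof (intro add_mono mult_mono mult_right_mono mult_left_mono)
      show "exp (- (2 * L * s)) \<le> 1" using L s by simp
      have "2 * L * s \<le> exp (2 * L * s)" using exp_ge_add_one_self[of "2 * L * s"] by linarith
      then show "exp (- (2 * L * s)) * (2 * L * s) \<le> 1" by (simp add: exp_minus field_simps)
    qed (use K L s in auto)
    finally show "norm (P y (max 0 t)) \<le> norm x0 + K / (2 * L)" by (simp add: s_def)
  qed
  then have app: "apply_bcontfun (Bcontfun (\<lambda>t. P y (max 0 t))) t = P y (max 0 t)" for y t
    by (simp add: Bcontfun_inverse)
  have "\<exists>!y. Bcontfun (\<lambda>t. P y (max 0 t)) = y"
  proof (rule banach_fix_type)
    show "\<forall>y z. dist (Bcontfun (\<lambda>t. P y (max 0 t))) (Bcontfun (\<lambda>t. P z (max 0 t))) \<le> 1/2 * dist y z"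
    proof (intro allI dist_bound)
      fix y z and t :: real
      define s where "s = max 0 t"
      have s: "s \<ge> 0" by (simp add: s_def)
      have "norm (integral {0..s} (G y) - integral {0..s} (G z)) = norm (integral {0..s} (\<lambda>u. G y u - G z u))"
        by (simp add: integral_diff intG)
      also have "\<dots> \<le> integral {0..s} (\<lambda>u. L * dist y z * exp (2 * L * u))"
      proof (rule integral_norm_bound_integral)
        show "(\<lambda>u. L * dist y z * exp (2 * L * u)) integrable_on {0..s}"
          by (intro integrable_continuous_interval continuous_intros)
        fix u
        have "norm (G y u - G z u) \<le> L * norm (exp (2 * L * u) *\<^sub>R (apply_bcontfun y u - apply_bcontfun z u))"
          unfolding G_def scaleR_diff_right by (rule lip)
        also have "\<dots> \<le> L * (exp (2 * L * u) * dist y z)"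
          using L dist_bounded[of y u z] by (simp add: dist_norm)
        finally show "norm (G y u - G z u) \<le> L * dist y z * exp (2 * L * u)" by (simp add: mult_ac)
      qed (intro integrable_diff intG)
      \<comment> \<open>Integrating \<open>L * exp (2 * L * u)\<close> gives at most half of
        \<open>exp (2 * L * s)\<close>, which is the contraction factor.\<close>
      also have "\<dots> = dist y z / 2 * exp (2 * L * s) - dist y z / 2 * exp (2 * L * 0)"
      proof (rule integral_unique, rule fundamental_theorem_of_calculus[OF s])
        fix u
        have "((\<lambda>u. dist y z / 2 * exp (2 * L * u)) has_real_derivative L * dist y z * exp (2 * L * u)) (at u within {0..s})"
          by (auto intro!: derivative_eq_intros)
        then show "((\<lambda>u. dist y z / 2 * exp (2 * L * u)) has_vector_derivative L * dist y z * exp (2 * L * u)) (at u within {0..s})"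
          by (simp add: has_real_derivative_iff_has_vector_derivative)
      qed
      also have "\<dots> \<le> dist y z / 2 * exp (2 * L * s)" by simp
      finally have d: "norm (integral {0..s} (G y) - integral {0..s} (G z)) \<le> dist y z / 2 * exp (2 * L * s)" .
      have "dist (P y s) (P z s) = exp (- (2 * L * s)) * norm (integral {0..s} (G y) - integral {0..s} (G z))"
        unfolding P_def dist_norm scaleR_diff_right[symmetric] by simp
      also have "\<dots> \<le> exp (- (2 * L * s)) * (dist y z / 2 * exp (2 * L * s))"
        using d by (rule mult_left_mono) simp
      also have "\<dots> = 1/2 * dist y z" by (simp add: exp_minus)
      finally show "dist (apply_bcontfun (Bcontfun (\<lambda>t. P y (max 0 t))) t) (apply_bcontfun (Bcontfun (\<lambda>t. P z (max 0 t))) t)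
          \<le> 1/2 * dist y z"
        unfolding app by (simp add: s_def)
    qed
  qed auto
  then obtain y where y: "Bcontfun (\<lambda>t. P y (max 0 t)) = y" by blast
  define b where "b t = x0 + integral {0..t} (G y)" for t
  have yP: "apply_bcontfun y t = exp (- (2 * L * t)) *\<^sub>R b t" if "t \<ge> 0" for t
    using app[of y t] that unfolding y by (simp add: P_def b_def)
  have Gb: "G y t = F t (b t)" if "t \<ge> 0" for t
    unfolding G_def yP[OF that] by (simp add: exp_minus)
  show ?thesis
  proof (rule that[of b])
    show "continuous_on {0..} b" unfolding b_def by (intro continuous_intros contI)
    show "b 0 = x0" by (simp add: b_def)
    show "(b has_vector_derivative F t (b t)) (at t within {0..})" if "t \<ge> 0" for t
    proof -
      have "((\<lambda>t. integral {0..t} (G y)) has_vector_derivative G y t) (at t within {0..t + 1})"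
        by (rule integral_has_vector_derivative, rule continuous_on_subset[OF contG]) (use that in auto)
      moreover have "at t within {0..t + 1} = at t within {0..}"
        by (rule at_within_nhd[of t "{..<t + 1}"]) auto
      ultimately have "((\<lambda>t. x0 + integral {0..t} (G y)) has_vector_derivative 0 + G y t) (at t within {0..})"
        by (intro has_vector_derivative_add has_vector_derivative_const) simp
      then show ?thesis by (simp add: b_def[abs_def] Gb[OF that, unfolded b_def])
    qed
  qed
qed


definition radial :: "real \<Rightarrow> 'a::real_normed_vector \<Rightarrow> 'a" where
  "radial M x = (M / max M (norm x)) *\<^sub>R x"

lemma radial_id: "M > 0 \<Longrightarrow> norm x \<le> M \<Longrightarrow> radial M x = x"
  by (simp add: radial_def max_def)

lemma norm_radial_le:
  assumes "M > 0"
  shows "norm (radial M x) \<le> M"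
proof -
  have "M * norm x \<le> M * max M (norm x)" using assms by (intro mult_left_mono) auto
  then show ?thesis using assms by (simp add: radial_def field_simps max_def split: if_splits)
qed

text \<open>The constant 2 works in every normed space: with the scaling factor fixed, moving
  \<open>x\<close> costs at most \<open>norm (x - y)\<close>, and the change of the factor
  contributes at most the difference of the norms.\<close>

lemma radial_lipschitz:
  assumes "M > 0"
  shows "norm (radial M x - radial M y) \<le> 2 * norm (x - y)"
proof -
  define p q where "p = max M (norm x)" and "q = max M (norm y)"
  have pq: "p > 0" "q > 0" "M \<le> p" "norm y \<le> q" using assms by (auto simp: p_def q_def)
  have "radial M x - radial M y = (M / p) *\<^sub>R (x - y) + (M / p - M / q) *\<^sub>R y"
    by (simp add: radial_def p_def q_def algebra_simps)
  then have "norm (radial M x - radial M y) \<le> \<bar>M / p\<bar> * norm (x - y) + \<bar>M / p - M / q\<bar> * norm y"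
    by (metis norm_scaleR norm_triangle_ineq)
  also have "\<bar>M / p\<bar> * norm (x - y) \<le> 1 * norm (x - y)"
    using pq assms by (intro mult_right_mono) auto
  also have "\<bar>M / p - M / q\<bar> * norm y \<le> norm (x - y)"
  proof -
    have "\<bar>M / p - M / q\<bar> = (M / p) * (\<bar>q - p\<bar> / q)"
      using pq assms by (simp add: abs_mult abs_divide field_simps flip: abs_mult) (simp add: abs_mult_pos' mult.commute right_diff_distrib)
    also have "\<dots> \<le> 1 * (\<bar>q - p\<bar> / q)"
      using pq assms by (intro mult_right_mono) auto
    finally have "\<bar>M / p - M / q\<bar> * norm y \<le> (\<bar>q - p\<bar> / q) * norm y"
      by (intro mult_right_mono) auto
    also have "\<dots> \<le> (\<bar>q - p\<bar> / q) * q"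
      using pq by (intro mult_left_mono) auto
    also have "\<dots> = \<bar>q - p\<bar>" using pq by simp
    also have "\<dots> \<le> \<bar>norm y - norm x\<bar>" by (auto simp: p_def q_def)
    also have "\<dots> \<le> norm (x - y)" using norm_triangle_ineq3[of y x] by (simp add: norm_minus_commute)
    finally show ?thesis .
  qed
  finally show ?thesis by simp
qed

text \<open>After scaling, the monomial has a coefficient of modulus one and acts as an L2 isometry;
  nonnegativity of \<open>ip\<close> on \<open>a + x\<close> and \<open>a - x\<close> then does the
  work of Cauchy-Schwarz.\<close>

lemma ip_mon_mult_self_le: "\<bar>ip (mon l c * a) a\<bar> \<le> cmod c * ip a a"
proof -
  define u where "u = sgn c"
  define x where "x = mon l u * a"
  have c: "mon l c = cmod c *\<^sub>R mon l u"
    by (cases "c = 0") (auto intro!: h1_eqI simp: u_def sgn_div_norm)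
  show ?thesis
  proof (cases "c = 0")
    case False
    then have "cmod u = 1" by (simp add: u_def norm_sgn)
    then have "cnj u * u = 1" by (metis complex_norm_square mult.commute of_real_1 power_one)
    then have "mon (-l) (cnj u) * (mon l u * a) = a"
      by (simp flip: mult.assoc one_h1_def)
    then have xx: "ip x x = ip a a" by (simp add: x_def ip_mult_left ip_commute)
    have "0 \<le> ip (a + x) (a + x)" "0 \<le> ip (a - x) (a - x)" by (rule ip_self_nonneg)+
    then have "\<bar>ip x a\<bar> \<le> ip a a"
      by (simp add: ip.add_left ip.add_right ip.diff_left ip.diff_right xx ip_commute[of a x])
    then show ?thesis unfolding c by (simp add: ip.scaleR_left abs_mult mult_left_mono flip: x_def)
  qed (simp add: mon_linear_simps ip.zero_left)
qed

text \<open>The right side contains the mass but no derivative of \<open>a\<close>, which is what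
  lets mass and energy together bound the derivative. \<open>v\<close> is expanded into monomials
  with absolutely summable coefficients.\<close>

lemma ip_mult_self_le: "\<bar>ip (v * a) a\<bar> \<le> norm v * ip a a"
proof (rule tendsto_upperbound)
  show "(\<lambda>N. \<bar>ip (trunc N v * a) a\<bar>) \<longlonglongrightarrow> \<bar>ip (v * a) a\<bar>"
    by (intro tendsto_intros ip.tendsto trunc_tendsto)
  have "\<bar>ip (trunc N v * a) a\<bar> \<le> norm v * ip a a" for N
  proof -
    have "\<bar>ip (trunc N v * a) a\<bar> = \<bar>\<Sum>j=-int N..int N. ip (mon j (coef v j) * a) a\<bar>"
      by (simp add: trunc_def sum_distrib_right ip.sum_left)
    also have "\<dots> \<le> (\<Sum>j=-int N..int N. cmod (coef v j) * ip a a)"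
      by (intro order_trans[OF sum_abs] sum_mono ip_mon_mult_self_le)
    also have "\<dots> \<le> norm v * ip a a"
      unfolding sum_distrib_right[symmetric]
      by (intro mult_right_mono sum_cmod_coef_le ip_self_nonneg) simp
    finally show ?thesis .
  qed
  then show "\<forall>\<^sub>F N in sequentially. \<bar>ip (trunc N v * a) a\<bar> \<le> norm v * ip a a" by simp
qed simp

context nonlocal_gp
begin

lemma nonlin_lipschitz:
  assumes "norm a \<le> M" "norm b \<le> M"
  shows "norm (nonlin a - nonlin b) \<le> (norm V + 3 * M\<^sup>2) * norm (a - b)"
proof -
  have M: "0 \<le> M" using assms(1) norm_ge_zero order_trans by blast
  have "norm (a * cj a - b * cj b) \<le> (M + M) * norm (a - b)"
  proof -
    have "a * cj a - b * cj b = a * cj (a - b) + cj b * (a - b)" by (simp add: algebra_simps)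
    also have "norm \<dots> \<le> norm a * norm (cj (a - b)) + norm (cj b) * norm (a - b)"
      by (intro order_trans[OF norm_triangle_ineq] add_mono norm_mult_ineq)
    also have "\<dots> = norm a * norm (a - b) + norm b * norm (a - b)" by (simp only: norm_cj)
    also have "\<dots> \<le> (M + M) * norm (a - b)"
      unfolding distrib_right by (intro add_mono mult_right_mono assms) auto
    finally show ?thesis .
  qed
  then have d: "norm (fmult m (a * cj a - b * cj b)) \<le> (M + M) * norm (a - b)"
    using norm_R_le order_trans by blast
  have r: "norm (fmult m (b * cj b)) \<le> M * M"
    using norm_R_le[of "b * cj b"] norm_mult_ineq[of b "cj b"] mult_mono[OF assms(2,2)] M by simp
  have "nonlin a - nonlin b = V * (a - b) + fmult m (a * cj a - b * cj b) * a + fmult m (b * cj b) * (a - b)"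
    by (simp add: nonlin_def R.diff algebra_simps)
  also have "norm \<dots> \<le> norm V * norm (a - b) + ((M + M) * norm (a - b)) * M + (M * M) * norm (a - b)"
    using M by (intro norm_triangle_le add_mono order_trans[OF norm_mult_ineq] mult_mono d r assms order_refl) auto
  finally show ?thesis by (simp add: algebra_simps power2_eq_square)
qed

lemma norm_h1_le_energy:
  "(norm a)\<^sup>2 \<le> 25 * (ip a a + 2 / lam\<^sup>2 * (energy a + norm V * ip a a))"
proof -
  have "0 \<le> ip (fmult m (a * cj a)) (a * cj a)"
    by (rule has_sum_nonneg[OF ip_fmult_self_has_sum[OF m_abs]]) (simp add: m_nonneg)
  then have "lam\<^sup>2 / 2 * dip a a \<le> energy a + norm V * ip a a"
    using ip_mult_self_le[of V a] by (simp add: energy_def)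
  then have "dip a a \<le> 2 / lam\<^sup>2 * (energy a + norm V * ip a a)"
    using lam_pos by (simp add: field_simps)
  then show ?thesis unfolding norm_h1_eq_ip by (intro mult_left_mono add_left_mono) simp_all
qed

text \<open>
  In the interaction picture \<open>b(t) = U(-t) a(t)\<close> the equation is an ordinary differential equation
  with locally Lipschitz right-hand side.  The cutoff outside a large ball makes it globally
  Lipschitz, and conservation of mass and energy keeps the solution from ever reaching the cutoff.
\<close>

theorem global_solution:
  obtains a where "evolves {0..} a" "a 0 = a0"
proof -
  define bnd where "bnd x = 25 * (ip x x + 2 / lam\<^sup>2 * (energy x + norm V * ip x x))" for x
  \<comment> \<open>The added 1 puts every state with the initial mass and energy strictly inside
    the cutoff ball.\<close>
  define M where "M = 1 + sqrt (bnd a0)"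
  have bnd: "(norm x)\<^sup>2 \<le> bnd x" for x unfolding bnd_def by (rule norm_h1_le_energy)
  have bnd0: "0 \<le> bnd a0" using bnd[of a0] zero_le_power2 order_trans by blast
  have M: "M > 0" using real_sqrt_ge_zero[OF bnd0] unfolding M_def by linarith
  have bM: "norm x < M" if "bnd x = bnd a0" for x
    using real_le_rsqrt[OF bnd[of x]] that by (simp add: M_def)
  define c where "c j = - (lam\<^sup>2 / 2 * (of_int j)\<^sup>2)" for j :: int
  define U where "U t = phase (\<lambda>j. c j * t)" for t
  define F where "F t b = - (mon 0 \<i> * U (- t) (nonlin (radial M (U t b))))" for t b
  define L where "L = (norm V + 3 * M\<^sup>2) * 2"
  have Un: "norm (U t x) = norm x" for t x by (simp add: U_def)
  have UU: "U t (U (- t) x) = x" for t x by (simp add: U_def phase_phase)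
  have radial_M: "norm (radial M x) \<le> M" for x :: h1 by (rule norm_radial_le[OF M])
  obtain b where b: "continuous_on {0..} b" "b 0 = a0"
    and b': "\<And>t. t \<ge> 0 \<Longrightarrow> (b has_vector_derivative F t (b t)) (at t within {0..})"
  proof (rule global_ode_solution[of F L "(norm V + M\<^sup>2) * M" a0])
    show "continuous_on {0..} (\<lambda>t. F t (b t))" if "continuous_on {0..} b" for b
    proof -
      have "continuous_on {0..} (\<lambda>t. radial M (U t (b t)))"
        unfolding radial_def U_def using M
        by (intro continuous_intros continuous_on_phase that) (auto simp: max_def)
      then have "continuous_on {0..} (\<lambda>t. nonlin (radial M (U t (b t))))"
        by (auto simp: continuous_on_def intro: tendsto_nonlin)
      from continuous_on_phase[OF this, of "\<lambda>j. - c j"] show ?thesis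
        unfolding F_def U_def by (intro continuous_intros) simp
    qed
    show "norm (F t x - F t y) \<le> L * norm (x - y)" for t x y
    proof -
      have "F t x - F t y = mon 0 \<i> * U (- t) (nonlin (radial M (U t y)) - nonlin (radial M (U t x)))"
        by (simp add: F_def U_def phase_diff algebra_simps)
      then have "norm (F t x - F t y) = norm (nonlin (radial M (U t y)) - nonlin (radial M (U t x)))"
        by (simp add: norm_cst_mult Un)
      also have "\<dots> \<le> (norm V + 3 * M\<^sup>2) * norm (radial M (U t y) - radial M (U t x))"
        by (rule nonlin_lipschitz[OF radial_M radial_M])
      also have "\<dots> \<le> (norm V + 3 * M\<^sup>2) * (2 * norm (U t y - U t x))"
        by (intro mult_left_mono radial_lipschitz M) auto
      also have "norm (U t y - U t x) = norm (x - y)"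
        using Un[of t "y - x"] by (simp add: U_def phase_diff norm_minus_commute)
      finally show ?thesis by (simp only: L_def mult.assoc)
    qed
    show "0 < L" unfolding L_def using M by (intro mult_pos_pos add_nonneg_pos) auto
    show "norm (F t x) \<le> (norm V + M\<^sup>2) * M" for t x
    proof -
      have "norm (F t x) = norm (nonlin (radial M (U t x)))"
        by (simp add: F_def norm_cst_mult Un)
      also have "\<dots> \<le> (norm V + (norm (radial M (U t x)))\<^sup>2) * norm (radial M (U t x))"
        by (rule norm_nonlin_le)
      also have "\<dots> \<le> (norm V + M\<^sup>2) * M"
        using M radial_M by (intro mult_mono add_mono power_mono) auto
      finally show ?thesis .
    qed
  qed blast
  define a where "a t = U t (b t)" for t
  have a0: "a 0 = a0" by (simp add: a_def U_def b(2))
  have conta: "continuous_on {0..} a" unfolding a_def U_def by (rule continuous_on_phase[OF b(1)])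
  have deriv: "((\<lambda>s. coef (a s) j) has_vector_derivative flow (a t) j) (at t within {0..})"
    if t: "t \<ge> 0" and n: "norm (a t) \<le> M" for t j
  proof -
    have "((\<lambda>s. cis (c j * s)) has_vector_derivative (\<i> * of_real (c j)) * cis (c j * t)) (at t within {0..})"
    proof -
      have "((\<lambda>z. exp (\<i> * of_real (c j) * z)) has_field_derivative
          (\<i> * of_real (c j)) * exp (\<i> * of_real (c j) * of_real t)) (at (of_real t))"
        by (auto intro!: derivative_eq_intros)
      from has_vector_derivative_real_field[OF this]
      show ?thesis by (simp add: cis_conv_exp mult.assoc)
    qed
    from has_vector_derivative_mult[OF this bounded_linear.has_vector_derivative[OF bounded_linear_coef b'[OF t], of j]]
    have "((\<lambda>s. coef (a s) j) has_vector_derivative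
        (cis (c j * t) * coef (F t (b t)) j + (\<i> * of_real (c j)) * cis (c j * t) * coef (b t) j)) (at t within {0..})"
      by (simp add: a_def U_def)
    moreover have "cis (c j * t) * coef (F t (b t)) j = - \<i> * coef (nonlin (a t)) j"
    proof -
      have "cis (c j * t) * coef (F t (b t)) j = coef (U t (F t (b t))) j" by (simp add: U_def)
      also have "U t (F t (b t)) = - (mon 0 \<i> * nonlin (a t))"
      proof -
        have "U t (- (mon 0 \<i> * x)) = - (mon 0 \<i> * U t x)" for x
          by (rule h1_eqI) (simp add: U_def)
        then show ?thesis
          using radial_id[OF M, of "a t"] n by (simp add: F_def UU flip: a_def)
      qed
      finally show ?thesis by simp
    qed
    ultimately show ?thesis by (simp add: flow_def a_def U_def c_def algebra_simps)
  qed
  have "norm (a t) < M" if "t \<ge> 0" for t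
  proof (rule ccontr)
    assume "\<not> norm (a t) < M"
    \<comment> \<open>The infimum of \<open>S\<close> is the first time at which the cutoff radius
      is reached. Up to and including it the modified equation agrees with the true one, so mass and
      energy still have their initial values there, and these force the norm below
      \<open>M\<close>.\<close>
    define S where "S = {s \<in> {0..t}. M \<le> norm (a s)}"
    have "continuous_on {0..t} (\<lambda>s. norm (a s))"
      by (intro continuous_intros continuous_on_subset[OF conta]) auto
    then have "closed S"
      unfolding S_def by (intro continuous_on_closed_Collect_le continuous_on_const) auto
    moreover have "bounded S" by (rule bounded_subset[of "{0..t}"]) (auto simp: S_def)
    ultimately have "compact S" by (simp add: compact_eq_bounded_closed)
    moreover have "S \<noteq> {}" using that \<open>\<not> norm (a t) < M\<close> by (auto simp: S_def intro!: exI[of _ t])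
    ultimately obtain \<tau> where \<tau>: "\<tau> \<in> S" "\<And>s. s \<in> S \<Longrightarrow> \<tau> \<le> s"
      using compact_attains_inf[of S] by blast
    have "norm (a s) < M" if "s \<in> {0..<\<tau>}" for s
      using that \<tau>(2)[of s] \<tau>(1) by (force simp: S_def)
    have "\<tau> > 0"
      using \<tau>(1) bM[of "a 0"] a0 by (cases "\<tau> = 0") (auto simp: S_def)
    have "norm (a \<tau>) \<le> M"
    proof (rule tendsto_upperbound)
      show "((\<lambda>s. norm (a s)) \<longlongrightarrow> norm (a \<tau>)) (at \<tau> within {0..<\<tau>})"
      proof (rule tendsto_norm, rule tendsto_within_subset[of _ _ _ "{0..}"])
        show "(a \<longlongrightarrow> a \<tau>) (at \<tau> within {0..})"
          using conta \<open>\<tau> > 0\<close> by (simp add: continuous_on_def)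
      qed auto
      show "\<forall>\<^sub>F s in at \<tau> within {0..<\<tau>}. norm (a s) \<le> M"
        using \<open>\<And>s. s \<in> {0..<\<tau>} \<Longrightarrow> norm (a s) < M\<close>
        by (simp add: eventually_at_filter less_imp_le)
      show "at \<tau> within {0..<\<tau>} \<noteq> bot"
        using \<open>\<tau> > 0\<close> by (simp add: at_within_eq_bot_iff)
    qed
    then have le: "norm (a s) \<le> M" if "s \<in> {0..\<tau>}" for s
      using that \<open>\<And>s. s \<in> {0..<\<tau>} \<Longrightarrow> norm (a s) < M\<close>[of s] by (cases "s = \<tau>") auto
    have "evolves {0..\<tau>} a"
      unfolding evolves_def
    proof (intro conjI ballI allI)
      show "continuous_on {0..\<tau>} a" by (rule continuous_on_subset[OF conta]) auto
      fix s j assume "s \<in> {0..\<tau>}"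
      then show "((\<lambda>s. coef (a s) j) has_vector_derivative flow (a s) j) (at s within {0..\<tau>})"
        by (intro has_vector_derivative_within_subset[OF deriv] le) auto
    qed
    with \<open>\<tau> > 0\<close> have "bnd (a \<tau>) = bnd a0"
      unfolding bnd_def using energy_mass_conserved[of \<tau> a] a0 by simp
    then show False using bM[of "a \<tau>"] \<tau>(1) by (simp add: S_def)
  qed
  then have "evolves {0..} a" unfolding evolves_def using conta deriv by (auto simp: less_imp_le)
  then show ?thesis using a0 that by blast
qed

end

section \<open>Uniqueness of Fourier coefficients\<close>

text \<open>Real and imaginary part of \<open>cis y\<close> are combinations of two monomials, and
  \<open>ev\<close> is multiplicative. This turns Stone-Weierstrass on the unit circle into
  approximation by functions \<open>ev a\<close>.\<close>

lemma trig_of_real_polynomial_function: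
  assumes "real_polynomial_function p"
  shows "\<exists>a. \<forall>y. complex_of_real (p (cis y)) = ev a y"
  using assms
proof induction
  case (linear f)
  interpret bounded_linear f by fact
  have f: "f z = Re z * f 1 + Im z * f \<i>" for z
  proof -
    have "z = Re z *\<^sub>R 1 + Im z *\<^sub>R \<i>" by (simp add: complex_eq_iff)
    then show ?thesis by (metis add scaleR real_scaleR_def)
  qed
  let ?a = "mon 1 (of_real (f 1) / 2 - \<i> * of_real (f \<i>) / 2) + mon (- 1) (of_real (f 1) / 2 + \<i> * of_real (f \<i>) / 2)"
  have "complex_of_real (f (cis y)) = ev ?a y" for y
    by (subst f) (simp add: complex_eq_iff field_simps)
  then show ?case by blast
next
  case (const c)
  have "complex_of_real c = ev (mon 0 (of_real c)) y" for y by simp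
  then show ?case by blast
next
  case (add f g)
  then show ?case by (metis ev_linear(1) of_real_add)
next
  case (mult f g)
  then show ?case by (metis ev_mult of_real_mult)
qed

lemma set_integrable_mult_bounded:
  fixes f g :: "real \<Rightarrow> complex"
  assumes "set_integrable lborel A f" "g \<in> borel_measurable borel" "\<And>x. cmod (g x) \<le> C"
  shows "set_integrable lborel A (\<lambda>x. f x * g x)"
proof -
  have i: "integrable lborel (\<lambda>x. indicator A x *\<^sub>R f x)"
    using assms(1) by (simp add: set_integrable_def)
  have "integrable lborel (\<lambda>x. (indicator A x *\<^sub>R f x) * g x)"
  proof (rule Bochner_Integration.integrable_bound[OF integrable_mult_right[OF integrable_norm[OF i], of C]])
    show "(\<lambda>x. (indicator A x *\<^sub>R f x) * g x) \<in> borel_measurable lborel"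
      using i assms(2) by (intro borel_measurable_times) auto
    show "AE x in lborel. norm ((indicator A x *\<^sub>R f x) * g x) \<le> norm (C * norm (indicator A x *\<^sub>R f x))"
    proof (rule AE_I2)
      fix x
      have "norm ((indicator A x *\<^sub>R f x) * g x) \<le> norm (indicator A x *\<^sub>R f x) * C"
        unfolding norm_mult by (intro mult_left_mono assms) simp
      also have "\<dots> \<le> norm (C * norm (indicator A x *\<^sub>R f x))" by (simp add: mult.commute)
      finally show "norm ((indicator A x *\<^sub>R f x) * g x) \<le> norm (C * norm (indicator A x *\<^sub>R f x))" .
    qed
  qed
  then show ?thesis by (simp add: set_integrable_def)
qed

lemma set_integral_mult_bound:
  fixes f g :: "real \<Rightarrow> complex"
  assumes f: "set_integrable lborel A f" and g: "g \<in> borel_measurable borel" "\<And>x. cmod (g x) \<le> C"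
  shows "cmod (LINT x:A|lborel. f x * g x) \<le> C * (LINT x:A|lborel. cmod (f x))"
proof -
  have "cmod (LINT x:A|lborel. f x * g x) \<le> (LINT x|lborel. norm (indicator A x *\<^sub>R (f x * g x)))"
    unfolding set_lebesgue_integral_def by (rule integral_norm_bound)
  also have "\<dots> \<le> (LINT x|lborel. C * norm (indicator A x *\<^sub>R f x))"
  proof (rule integral_mono)
    show "integrable lborel (\<lambda>x. norm (indicator A x *\<^sub>R (f x * g x)))"
      using set_integrable_mult_bounded[OF assms] unfolding set_integrable_def by (rule integrable_norm)
    show "integrable lborel (\<lambda>x. C * norm (indicator A x *\<^sub>R f x))"
      using f unfolding set_integrable_def by (intro integrable_mult_right integrable_norm)
    show "norm (indicator A x *\<^sub>R (f x * g x)) \<le> C * norm (indicator A x *\<^sub>R f x)" for x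
      using mult_left_mono[OF g(2)[of x], of "cmod (f x)"]
      by (auto simp: indicator_def norm_mult mult.commute)
  qed
  also have "\<dots> = C * (LINT x:A|lborel. cmod (f x))"
    unfolding set_lebesgue_integral_def by simp
  finally show ?thesis .
qed

context
  fixes T :: real and f :: "real \<Rightarrow> complex"
  assumes T: "T > 0" and f: "set_integrable lborel {0..T} f" and f0: "\<And>j. fourier_coeff T f j = 0"
begin

lemma integral_mult_ev_eq_0: "(LINT x:{0..T}|lborel. f x * ev a (2 * pi * x / T)) = 0"
proof -
  let ?I = "\<lambda>a. LINT x:{0..T}|lborel. f x * ev a (2 * pi * x / T)"
  have m: "(\<lambda>x. ev a (2 * pi * x / T)) \<in> borel_measurable borel" for a by measurable
  note i = set_integrable_mult_bounded[OF f m cmod_ev_le]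
  have "bounded_linear ?I"
  proof (rule bounded_linear_intro)
    show "?I (a + b) = ?I a + ?I b" for a b
      unfolding ev_linear distrib_left by (rule set_integral_add(2)[OF i i])
    show "?I (r *\<^sub>R a) = r *\<^sub>R ?I a" for r a
      unfolding ev_linear mult_scaleR_right by simp
    show "norm (?I a) \<le> norm a * (LINT x:{0..T}|lborel. cmod (f x))" for a
      by (rule set_integral_mult_bound[OF f m cmod_ev_le])
  qed
  moreover have "?I (mon j c) = 0" for j c
  proof -
    have "?I (mon j c) = (LINT x:{0..T}|lborel. c * (cis (- (2 * pi * of_int (- j) * x / T)) * f x))"
      by (simp add: mult_ac)
    also have "\<dots> = c * (of_real T * fourier_coeff T f (- j))"
      using T by (simp add: fourier_coeff_def)
    finally show ?thesis by (simp add: f0)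
  qed
  ultimately show ?thesis by (rule bounded_linear_h1_ext[OF _ bounded_linear_zero])
qed

text \<open>Vanishing coefficients annihilate every \<open>ev a\<close> by density;
  Stone-Weierstrass extends this to continuous functions on the unit circle.\<close>

lemma integral_mult_continuous_eq_0:
  fixes G :: "complex \<Rightarrow> real"
  assumes G: "continuous_on (sphere 0 1) G"
  shows "(LINT x:{0..T}|lborel. f x * of_real (G (cis (2 * pi * x / T)))) = 0"
proof -
  define I where "I = (LINT x:{0..T}|lborel. cmod (f x))"
  have I: "I \<ge> 0" unfolding I_def set_lebesgue_integral_def by (rule Bochner_Integration.integral_nonneg) simp
  have cG: "continuous_on UNIV (\<lambda>x. complex_of_real (G (cis (2 * pi * x / T))))"
    by (intro continuous_on_of_real continuous_on_compose2[OF G] continuous_intros) (use T in auto)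
  then have mG: "(\<lambda>x. complex_of_real (G (cis (2 * pi * x / T)))) \<in> borel_measurable borel"
    by (rule borel_measurable_continuous_onI)
  have "cmod (LINT x:{0..T}|lborel. f x * of_real (G (cis (2 * pi * x / T)))) \<le> e * I" if "e > 0" for e
  proof -
    obtain p where p: "real_polynomial_function p" "\<And>z. z \<in> sphere 0 1 \<Longrightarrow> \<bar>G z - p z\<bar> < e"
      using Stone_Weierstrass_real_polynomial_function[OF compact_sphere G \<open>e > 0\<close>] by blast
    obtain a where a: "\<And>y. complex_of_real (p (cis y)) = ev a y"
      using trig_of_real_polynomial_function[OF p(1)] by blast
    define h where "h x = complex_of_real (G (cis (2 * pi * x / T))) - ev a (2 * pi * x / T)" for x
    have h: "cmod (h x) \<le> e" for x
      using p(2)[of "cis (2 * pi * x / T)"] by (simp add: h_def flip: a of_real_diff)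
    have mh: "h \<in> borel_measurable borel" unfolding h_def[abs_def] using mG by measurable
    have ma: "(\<lambda>x. ev a (2 * pi * x / T)) \<in> borel_measurable borel" by measurable
    have "(LINT x:{0..T}|lborel. f x * of_real (G (cis (2 * pi * x / T))))
        = (LINT x:{0..T}|lborel. f x * h x + f x * ev a (2 * pi * x / T))"
      by (simp add: h_def algebra_simps)
    also have "\<dots> = (LINT x:{0..T}|lborel. f x * h x)"
      by (subst set_integral_add(2)[OF set_integrable_mult_bounded[OF f mh h]
            set_integrable_mult_bounded[OF f ma cmod_ev_le]])
         (simp add: integral_mult_ev_eq_0)
    also have "cmod \<dots> \<le> e * I" unfolding I_def by (rule set_integral_mult_bound[OF f mh h])
    finally show ?thesis .
  qed
  note le = this
  have "cmod (LINT x:{0..T}|lborel. f x * of_real (G (cis (2 * pi * x / T)))) \<le> 0 + e" if "e > 0" for e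
    using le[of "e / (I + 1)"] that I
    by (smt (verit) divide_pos_pos mult_left_mono nonzero_eq_divide_eq)
  then have "cmod (LINT x:{0..T}|lborel. f x * of_real (G (cis (2 * pi * x / T)))) \<le> 0"
    by (rule field_le_epsilon)
  then show ?thesis by simp
qed

text \<open>Only the two endpoints of the period are identified, which is why \<open>y\<close> is
  kept in the interior.\<close>

lemma cis_inj_on_period:
  assumes "x \<in> {0..T}" "y \<in> {0<..<T}" "cis (2 * pi * x / T) = cis (2 * pi * y / T)"
  shows "x = y"
proof -
  have "cis (2 * pi * (x - y) / T) = 1"
    using assms(3) by (simp add: diff_divide_distrib right_diff_distrib flip: cis_divide)
  then have "cos (2 * pi * (x - y) / T) = 1" by (metis Re_complex_of_real cis.sel(1) of_real_1)
  then obtain n :: int where n: "2 * pi * (x - y) / T = of_int n * 2 * pi"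
    using cos_one_2pi_int by blast
  have "pi * (2 * ((x - y) / T - of_int n)) = 0" using n by (simp add: algebra_simps)
  then have "(x - y) / T - of_int n = 0" by (metis mult_eq_0_iff pi_neq_zero zero_neq_numeral)
  then have "(x - y) / T = of_int n" by simp
  then have xy: "x - y = of_int n * T" using T by (simp add: field_simps)
  have "\<bar>x - y\<bar> < T" using assms by auto
  then have "\<bar>real_of_int n\<bar> * T < 1 * T" using T by (simp add: xy abs_mult)
  then have "\<bar>real_of_int n\<bar> < 1" using T by (simp only: mult_less_cancel_right)
  then have "\<bar>n\<bar> < 1" by (metis of_int_abs of_int_less_1_iff)
  then show ?thesis using xy by simp
qed

lemma integral_closed_eq_0:
  assumes C: "closed C" "C \<subseteq> {0<..<T}"
  shows "(LINT x:C|lborel. f x) = 0"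
proof (cases "C = {}")
  case True
  then show ?thesis by (simp add: set_lebesgue_integral_def)
next
  case False
  define e where "e x = cis (2 * pi * x / T)" for x
  define K where "K = e ` C"
  have "bounded C" by (rule bounded_subset[OF _ C(2)]) simp
  then have "compact C" using C(1) by (simp add: compact_eq_bounded_closed)
  then have "compact K"
    unfolding K_def e_def by (intro compact_continuous_image continuous_intros) (use T in auto)
  then have K: "closed K" "K \<noteq> {}" using False by (auto simp: K_def compact_imp_closed)
  \<comment> \<open>Lipschitz functions decreasing to the indicator of the closed set
    \<open>K\<close>; dominated convergence carries the vanishing integrals over to
    \<open>C\<close>.\<close>
  define G where "G n z = max 0 (1 - real n * infdist z K)" for n z
  have G01: "\<bar>G n z\<bar> \<le> 1" for n z using infdist_nonneg[of z K] by (auto simp: G_def)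
  have Glim: "(\<lambda>n. G n z) \<longlonglongrightarrow> indicator K z" for z
  proof (cases "z \<in> K")
    case True
    then show ?thesis by (simp add: G_def)
  next
    case False
    then have d: "infdist z K > 0"
      using in_closed_iff_infdist_zero[OF K, of z] infdist_nonneg[of z K] by linarith
    obtain N where N: "1 < real N * infdist z K" using reals_Archimedean3[OF d] by blast
    have "G n z = 0" if "n \<ge> N" for n
    proof -
      have "real N * infdist z K \<le> real n * infdist z K" using that d by (intro mult_right_mono) auto
      then show ?thesis using N by (simp add: G_def)
    qed
    then have "\<forall>\<^sub>F n in sequentially. G n z = 0" by (auto simp: eventually_sequentially)
    then show ?thesis using False by (simp add: tendsto_eventually)
  qed
  have Gc: "continuous_on (sphere 0 1) (G n)" for n
    unfolding G_def by (intro continuous_intros)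
  have i: "integrable lborel (\<lambda>x. indicator {0..T} x *\<^sub>R f x)"
    using f by (simp add: set_integrable_def)
  have Cx: "indicator {0..T} x *\<^sub>R (f x * of_real (indicator K (e x))) = indicator C x *\<^sub>R f x" for x
  proof (cases "x \<in> {0..T}")
    case True
    have "e x \<in> K \<longleftrightarrow> x \<in> C"
      using cis_inj_on_period[OF True] C(2) unfolding K_def e_def by blast
    then show ?thesis using True by (simp add: indicator_def)
  qed (use C(2) in \<open>auto simp: indicator_def\<close>)
  have me: "e \<in> borel_measurable borel"
    unfolding e_def by (rule borel_measurable_continuous_onI) (intro continuous_intros, use T in auto)
  have mG: "(\<lambda>x. complex_of_real (G n (e x))) \<in> borel_measurable borel" for n
  proof -
    have "continuous_on UNIV (G n)" unfolding G_def by (intro continuous_intros)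
    then have "G n \<in> borel_measurable borel" by (rule borel_measurable_continuous_onI)
    then show ?thesis using me by measurable
  qed
  let ?g = "\<lambda>n x. indicator {0..T} x *\<^sub>R (f x * of_real (G n (e x)))"
  let ?h = "\<lambda>x. indicator {0..T} x *\<^sub>R (f x * of_real (indicator K (e x)))"
  have "(\<lambda>n. LINT x|lborel. ?g n x)
      \<longlonglongrightarrow> (LINT x|lborel. ?h x)"
  proof (rule integral_dominated_convergence[where w = "\<lambda>x. norm (indicator {0..T} x *\<^sub>R f x)"])
    have "(\<lambda>x. (indicator {0..T} x *\<^sub>R f x) * of_real (G n (e x))) \<in> borel_measurable lborel" for n
      by (intro borel_measurable_times borel_measurable_integrable[OF i]) (use mG[of n] in auto)
    then show "(\<lambda>x. ?g n x) \<in> borel_measurable lborel" for n by simp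
    have "(\<lambda>x. indicator C x *\<^sub>R (indicator {0..T} x *\<^sub>R f x)) \<in> borel_measurable lborel"
      by (intro borel_measurable_scaleR borel_measurable_integrable[OF i]) (use C(1) in auto)
    also have "(\<lambda>x. indicator C x *\<^sub>R (indicator {0..T} x *\<^sub>R f x)) = (\<lambda>x. indicator C x *\<^sub>R f x)"
      using C(2) by (auto simp: indicator_def fun_eq_iff)
    finally show "(\<lambda>x. ?h x) \<in> borel_measurable lborel"
      by (simp add: Cx)
    show "integrable lborel (\<lambda>x. norm (indicator {0..T} x *\<^sub>R f x))" by (rule integrable_norm[OF i])
    show "AE x in lborel. (\<lambda>n. ?g n x)
        \<longlonglongrightarrow> ?h x"
      by (intro AE_I2 tendsto_intros Glim)
    show "AE x in lborel. norm (?g n x) \<le> norm (indicator {0..T} x *\<^sub>R f x)" for n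
      using G01 by (auto simp: norm_mult indicator_def intro!: mult_right_le_one_le)
  qed
  moreover have "(LINT x|lborel. ?g n x) = 0" for n
    using integral_mult_continuous_eq_0[OF Gc] by (simp add: set_lebesgue_integral_def e_def)
  ultimately have "(\<lambda>n. 0) \<longlonglongrightarrow> (LINT x|lborel. indicator C x *\<^sub>R f x)"
    by (simp only: Cx)
  then show ?thesis
    unfolding set_lebesgue_integral_def by (simp add: LIMSEQ_const_iff)
qed

end

text \<open>Inner regularity: a closed subset of the set where \<open>g\<close> is positive must be
  null, since \<open>g\<close> integrates to 0 over it, and what such subsets leave out can be made
  arbitrarily small.\<close>

lemma AE_nonpos_of_integral_closed:
  fixes g :: "real \<Rightarrow> real"
  assumes g: "set_integrable lborel {0..T} g" "g \<in> borel_measurable borel"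
    and C: "\<And>C. closed C \<Longrightarrow> C \<subseteq> {0<..<T} \<Longrightarrow> (LINT x:C|lborel. g x) = 0"
  shows "AE x in lborel. x \<in> {0<..<T} \<longrightarrow> g x \<le> 0"
proof -
  define A where "A = {x \<in> {0<..<T}. g x > 0}"
  have A: "A \<in> sets borel" unfolding A_def using g(2) by measurable
  have "emeasure lborel A \<le> 0 + ennreal e" if "e > 0" for e
  proof -
    obtain S where S: "closed S" "S \<subseteq> A" "A - S \<in> lmeasurable" "emeasure lebesgue (A - S) < ennreal e"
      using sets_lebesgue_inner_closed[of A e] A \<open>e > 0\<close> by auto
    have sub: "S \<subseteq> {0<..<T}" using S(2) by (auto simp: A_def)
    have "set_integrable lborel S g"
      by (rule set_integrable_subset[OF g(1)]) (use sub S(1) in auto)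
    moreover have "AE x in lborel. 0 \<le> indicator S x *\<^sub>R g x"
      by (intro AE_I2) (use S(2) in \<open>auto simp: A_def indicator_def\<close>)
    ultimately have "AE x in lborel. indicator S x *\<^sub>R g x = 0"
      using integral_nonneg_eq_0_iff_AE[of lborel "\<lambda>x. indicator S x *\<^sub>R g x"] C[OF S(1) sub]
      by (simp add: set_integrable_def set_lebesgue_integral_def)
    then have "AE x in lborel. x \<notin> S"
      by eventually_elim (use S(2) in \<open>auto simp: A_def indicator_def\<close>)
    then have "emeasure lborel S = 0"
      using S(1) AE_iff_null_sets[of S lborel] by (auto simp: null_setsD1)
    moreover have "emeasure lborel (A - S) < ennreal e"
      using S A by (simp add: emeasure_completion)
    moreover have "emeasure lborel A = emeasure lborel S + emeasure lborel (A - S)"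
      using S A by (subst plus_emeasure) (auto simp: Un_absorb1)
    ultimately show ?thesis by simp
  qed
  then have "emeasure lborel A \<le> 0" by (rule ennreal_le_epsilon)
  then have "AE x in lborel. x \<notin> A"
    using A by (intro AE_not_in) (auto simp: null_sets_def)
  then show ?thesis by eventually_elim (auto simp: A_def)
qed

text \<open>To be applied to the difference of a Sobolev function and the sum of its Fourier series.
  The argument by sign concerns real functions, so real and imaginary part and their negatives are
  treated separately.\<close>

theorem fourier_coeff_eq_0_imp_AE:
  assumes T: "T > 0" and f: "set_integrable lborel {0..T} f" "f \<in> borel_measurable borel"
    and f0: "\<And>j. fourier_coeff T f j = 0"
  shows "AE x in lborel. x \<in> {0<..<T} \<longrightarrow> f x = 0"
proof -
  have *: "AE x in lborel. x \<in> {0<..<T} \<longrightarrow> L (f x) \<le> 0" if L: "bounded_linear L" for L :: "complex \<Rightarrow> real"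
  proof (rule AE_nonpos_of_integral_closed)
    have i: "integrable lborel (\<lambda>x. indicator {0..T} x *\<^sub>R f x)" using f(1) by (simp add: set_integrable_def)
    have sc: "L (indicator A x *\<^sub>R f x) = indicator A x *\<^sub>R L (f x)" for A x
      using L by (simp add: linear_simps)
    show "set_integrable lborel {0..T} (\<lambda>x. L (f x))"
      using integrable_bounded_linear[OF L i] by (simp add: set_integrable_def sc)
    show "(\<lambda>x. L (f x)) \<in> borel_measurable borel"
      using f(2) by (rule measurable_compose)
        (intro borel_measurable_continuous_onI bounded_linear.continuous_on[OF L] continuous_on_id)
    fix C assume C: "closed C" "C \<subseteq> {0<..<T}"
    have "integrable lborel (\<lambda>x. indicator C x *\<^sub>R f x)"
      using set_integrable_subset[OF f(1), of C] C by (force simp: set_integrable_def)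
    from integral_bounded_linear[OF L this] show "(LINT x:C|lborel. L (f x)) = 0"
      using integral_closed_eq_0[OF T f(1) f0 C] L by (simp add: set_lebesgue_integral_def sc linear_simps)
  qed
  show ?thesis
    using *[OF bounded_linear_Re] *[OF bounded_linear_minus[OF bounded_linear_Re]]
      *[OF bounded_linear_Im] *[OF bounded_linear_minus[OF bounded_linear_Im]]
    by eventually_elim (auto simp: complex_eq_iff)
qed

text \<open>Translates of the open period cover everything except the countable set of multiples of
  \<open>T\<close>.\<close>

lemma AE_periodic:
  fixes P :: "real \<Rightarrow> bool"
  assumes T: "T > 0" and P: "AE x in lborel. x \<in> {0<..<T} \<longrightarrow> P x" "{x. P x} \<in> sets borel"
    and per: "\<And>x. P (x + T) \<longleftrightarrow> P x"
  shows "AE x in lborel. P x"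
proof -
  have nat: "P (x + real n * T) \<longleftrightarrow> P x" for x n
  proof (induction n)
    case (Suc n)
    have "x + real (Suc n) * T = (x + real n * T) + T" by (simp add: algebra_simps)
    then show ?case using Suc per by (simp only:)
  qed simp
  have shift: "P (x + of_int n * T) \<longleftrightarrow> P x" for x n
  proof (cases "n \<ge> 0")
    case True
    then show ?thesis using nat[of x "nat n"] by simp
  next
    case False
    then show ?thesis using nat[of "x + of_int n * T" "nat (- n)"] by simp
  qed
  have "AE x in lborel. of_int n * T + x \<in> {0<..<T} \<longrightarrow> P (of_int n * T + x)" for n :: int
  proof -
    have "AE x in distr lborel borel ((+) (of_int n * T)). x \<in> {0<..<T} \<longrightarrow> P x"
      unfolding lborel_distr_plus by (rule P(1))
    moreover have "{x. x \<in> {0<..<T} \<longrightarrow> P x} = - {0<..<T} \<union> {x. P x}" by auto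
    then have "{x \<in> space borel. x \<in> {0<..<T} \<longrightarrow> P x} \<in> sets borel" using P(2) by simp
    ultimately show ?thesis
      by (subst (asm) AE_distr_iff) simp_all
  qed
  then have "AE x in lborel. \<forall>n::int. of_int n * T + x \<in> {0<..<T} \<longrightarrow> P (of_int n * T + x)"
    by (simp add: AE_all_countable)
  moreover have "AE x in lborel. x \<notin> range (\<lambda>n::int. of_int n * T)"
    by (intro AE_not_in countable_imp_null_set_lborel) auto
  ultimately show ?thesis
  proof eventually_elim
    case (elim x)
    define n where "n = \<lfloor>x / T\<rfloor>"
    have "of_int n \<le> x / T" "x / T < of_int n + 1"
      using floor_correct[of "x / T"] unfolding n_def by simp_all
    then have "of_int n * T \<le> x" "x < of_int n * T + T"
      using T by (simp_all add: pos_le_divide_eq pos_divide_less_eq distrib_right)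
    moreover have "x \<noteq> of_int n * T" using elim(2) by auto
    ultimately have "of_int (- n) * T + x \<in> {0<..<T}" by auto
    then have "P (of_int (- n) * T + x)" using elim(1) by blast
    then show ?case using shift[of x "- n"] by (simp add: add.commute)
  qed
qed

section \<open>Functions on the circle\<close>

lemma sobolev_weight_1: "sobolev_weight T 1 j = 1 + (2 * pi / T)\<^sup>2 * (of_int j)\<^sup>2"
proof -
  have "1 + 4 * pi\<^sup>2 * (of_int j)\<^sup>2 / T\<^sup>2 > 0" by (intro add_pos_nonneg) auto
  then show ?thesis by (simp add: sobolev_weight_def power_mult_distrib power_divide)
qed

definition fourier_h1 :: "real \<Rightarrow> (real \<Rightarrow> complex) \<Rightarrow> h1" where
  "fourier_h1 T u = Abs_h1 (fourier_coeff T u)"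

lemma coef_fourier_h1:
  assumes "T > 0" "u \<in> sobolev_space 1 T"
  shows "coef (fourier_h1 T u) = fourier_coeff T u"
proof -
  define l where "l = 2 * pi / T"
  have l: "l > 0" using assms(1) by (simp add: l_def)
  define C where "C = max 1 (1 / l\<^sup>2)"
  have C: "1 \<le> C" "1 \<le> C * l\<^sup>2" using l by (auto simp: C_def max_def field_simps)
  have "h1_weight j \<le> C * sobolev_weight T 1 j" for j
  proof -
    have "1 * (of_int j)\<^sup>2 \<le> C * l\<^sup>2 * (of_int j)\<^sup>2" by (rule mult_right_mono[OF C(2)]) simp
    then show ?thesis using C(1) by (simp add: sobolev_weight_1 h1_weight_def distrib_left flip: l_def)
  qed
  then have le: "h1_weight j * (cmod (fourier_coeff T u j))\<^sup>2 \<le> C * (sobolev_weight T 1 j * (cmod (fourier_coeff T u j))\<^sup>2)" for j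
    unfolding mult.assoc[symmetric] by (rule mult_right_mono) simp
  have "(\<lambda>j. C * (sobolev_weight T 1 j * (cmod (fourier_coeff T u j))\<^sup>2)) summable_on UNIV"
    using assms(2) by (intro summable_on_cmult_right) (simp add: sobolev_space_def)
  then have "(\<lambda>j. h1_weight j * (cmod (fourier_coeff T u j))\<^sup>2) summable_on UNIV"
    by (rule summable_on_comparison_test) (use le in auto)
  then show ?thesis by (simp add: fourier_h1_def Abs_h1_inverse)
qed

lemma sobolev_norm_eq:
  assumes "\<And>j. fourier_coeff T f j = coef b j"
  shows "sobolev_norm 1 T f = sqrt (ip b b + (2 * pi / T)\<^sup>2 * dip b b)"
proof -
  have "((\<lambda>j. sobolev_weight T 1 j * (cmod (coef b j))\<^sup>2) has_sum (ip b b + (2 * pi / T)\<^sup>2 * dip b b)) UNIV"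
    using has_sum_add[OF ip_self_has_sum[of b] has_sum_cmult_right[OF dip_self_has_sum[of b], of "(2 * pi / T)\<^sup>2"]]
    unfolding sobolev_weight_1 by (simp add: algebra_simps)
  then show ?thesis unfolding sobolev_norm_def assms by (simp only: infsumI)
qed

text \<open>Changing the period only reweights the derivative, so the norms are equivalent with
  constants that depend on \<open>l\<close>.\<close>

lemma norm_le_sobolev:
  assumes "l > 0"
  shows "norm b \<le> 5 * max 1 (1 / l) * sqrt (ip b b + l\<^sup>2 * dip b b)"
proof -
  define M where "M = max 1 (1 / l)"
  have M: "1 \<le> M" "1 \<le> M * l" using assms by (auto simp: M_def max_def field_simps)
  have nn: "0 \<le> ip b b" "0 \<le> dip b b" by (rule ip_self_nonneg dip_self_nonneg)+
  have "1\<^sup>2 * ip b b \<le> M\<^sup>2 * ip b b" "1\<^sup>2 * dip b b \<le> (M * l)\<^sup>2 * dip b b"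
    using M nn by (intro mult_right_mono power_mono; simp)+
  then have "(norm b)\<^sup>2 \<le> (5 * M)\<^sup>2 * (ip b b + l\<^sup>2 * dip b b)"
    by (simp add: norm_h1_eq_ip power_mult_distrib algebra_simps)
  from real_le_rsqrt[OF this] show ?thesis
    unfolding M_def[symmetric] using M by (simp add: real_sqrt_mult)
qed

lemma sobolev_le_norm:
  assumes "l > 0"
  shows "sqrt (ip b b + l\<^sup>2 * dip b b) \<le> max 1 l * norm b"
proof -
  define M where "M = max 1 l"
  have M: "1 \<le> M" "l \<le> M" by (auto simp: M_def)
  have nn: "0 \<le> ip b b" "0 \<le> dip b b" by (rule ip_self_nonneg dip_self_nonneg)+
  have "1\<^sup>2 * ip b b \<le> M\<^sup>2 * ip b b" "l\<^sup>2 * dip b b \<le> M\<^sup>2 * dip b b"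
    using M assms nn by (intro mult_right_mono power_mono; simp)+
  then have "ip b b + l\<^sup>2 * dip b b \<le> M\<^sup>2 * (ip b b + dip b b)" by (simp add: algebra_simps)
  also have "\<dots> \<le> M\<^sup>2 * (25 * (ip b b + dip b b))" using nn by (intro mult_left_mono) auto
  also have "\<dots> = (M * norm b)\<^sup>2" by (simp add: norm_h1_eq_ip power_mult_distrib)
  finally show ?thesis unfolding M_def[symmetric] using M by (intro real_le_lsqrt) auto
qed

lemma L2_circle_set_integrable:
  assumes "u \<in> L2_circle T"
  shows "set_integrable lborel {0..T} u"
proof -
  have m: "u \<in> borel_measurable borel" and i: "set_integrable lborel {0..T} (\<lambda>x. (cmod (u x))\<^sup>2)"
    using assms by (auto simp: L2_circle_def)
  have "set_integrable lborel {0..T} (\<lambda>x. 1 :: real)"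
    by (rule borel_integrable_atLeastAtMost') simp
  then have "integrable lborel (\<lambda>x. indicator {0..T} x *\<^sub>R 1 + indicator {0..T} x *\<^sub>R (cmod (u x))\<^sup>2)"
    using i unfolding set_integrable_def by (rule Bochner_Integration.integrable_add)
  then show ?thesis
    unfolding set_integrable_def
  proof (rule Bochner_Integration.integrable_bound)
    show "(\<lambda>x. indicator {0..T} x *\<^sub>R u x) \<in> borel_measurable lborel" using m by measurable
    have "r \<le> 1 + r\<^sup>2" for r :: real
      using sum_squares_bound[of 1 r] by (simp add: power2_eq_square) (smt (verit) zero_le_square)
    then show "AE x in lborel. norm (indicator {0..T} x *\<^sub>R u x)
        \<le> norm (indicator {0..T} x *\<^sub>R 1 + indicator {0..T} x *\<^sub>R (cmod (u x))\<^sup>2)"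
      by (intro AE_I2) (simp add: indicator_def)
  qed
qed

lemma fourier_coeff_diff:
  assumes "set_integrable lborel {0..T} f" "set_integrable lborel {0..T} g"
  shows "fourier_coeff T (\<lambda>x. f x - g x) j = fourier_coeff T f j - fourier_coeff T g j"
proof -
  have m: "(\<lambda>x. cis (- (2 * pi * of_int j * x / T))) \<in> borel_measurable borel"
    by (cases "T = 0") (auto intro!: borel_measurable_continuous_onI continuous_intros)
  have i: "set_integrable lborel {0..T} (\<lambda>x. cis (- (2 * pi * of_int j * x / T)) * h x)"
    if "set_integrable lborel {0..T} h" for h
    using set_integrable_mult_bounded[OF that m, of 1] by (simp add: mult.commute)
  show ?thesis
    unfolding fourier_coeff_def right_diff_distrib set_integral_diff(2)[OF i[OF assms(1)] i[OF assms(2)]]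
    by (rule diff_divide_distrib)
qed

lemma fourier_coeff_cong_AE:
  assumes "AE x in lborel. f x = g x" "f \<in> borel_measurable borel" "g \<in> borel_measurable borel"
  shows "fourier_coeff T f j = fourier_coeff T g j"
proof -
  have m: "(\<lambda>x. cis (- (2 * pi * of_int j * x / T))) \<in> borel_measurable borel"
    by (cases "T = 0") (auto intro!: borel_measurable_continuous_onI continuous_intros)
  have "(LINT x:{0..T}|lborel. cis (- (2 * pi * of_int j * x / T)) * f x)
      = (LINT x:{0..T}|lborel. cis (- (2 * pi * of_int j * x / T)) * g x)"
    unfolding set_lebesgue_integral_def
  proof (rule integral_cong_AE)
    show "AE x in lborel. indicat_real {0..T} x *\<^sub>R (cis (- (2 * pi * of_int j * x / T)) * f x)
        = indicat_real {0..T} x *\<^sub>R (cis (- (2 * pi * of_int j * x / T)) * g x)"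
      using assms(1) by eventually_elim simp
  qed (use m assms(2,3) in measurable)
  then show ?thesis by (simp add: fourier_coeff_def)
qed

context
  fixes T l :: real
  assumes T: "T > 0" and l: "l = 2 * pi / T"
begin

lemma ev_scaled_periodic: "ev a (l * (x + T)) = ev a (l * x)"
  using ev_periodic[of a "l * x" 1] T by (simp add: l distrib_left)

lemma fourier_coeff_ev_scaled: "fourier_coeff T (\<lambda>x. ev a (l * x)) j = coef a j"
  unfolding l by (rule fourier_coeff_ev[OF T])

lemma ev_scaled_mem: "(\<lambda>x. ev a (l * x)) \<in> sobolev_space 1 T"
proof -
  have "(\<lambda>j. sobolev_weight T 1 j * (cmod (coef a j))\<^sup>2) summable_on UNIV"
  proof -
    have "((\<lambda>j. sobolev_weight T 1 j * (cmod (coef a j))\<^sup>2) has_sum (ip a a + l\<^sup>2 * dip a a)) UNIV"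
      using has_sum_add[OF ip_self_has_sum[of a] has_sum_cmult_right[OF dip_self_has_sum[of a], of "l\<^sup>2"]]
      unfolding sobolev_weight_1 l by (simp add: algebra_simps)
    then show ?thesis by (rule has_sum_imp_summable)
  qed
  moreover have "set_integrable lborel {0..T} (\<lambda>x. (cmod (ev a (l * x)))\<^sup>2)"
    by (intro borel_integrable_atLeastAtMost' continuous_intros)
  ultimately show ?thesis
    by (simp add: sobolev_space_def L2_circle_def fourier_coeff_ev_scaled ev_scaled_periodic)
qed

lemma fourier_h1_ev_scaled: "fourier_h1 T (\<lambda>x. ev a (l * x)) = a"
  by (rule h1_eqI) (simp add: coef_fourier_h1[OF T ev_scaled_mem] fourier_coeff_ev_scaled)

text \<open>Replacing a Sobolev function by its continuous representative allows its products to be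
  computed in the algebra \<open>h1\<close>.\<close>

lemma sobolev_AE_ev:
  assumes u: "u \<in> sobolev_space 1 T"
  shows "AE x in lborel. u x = ev (fourier_h1 T u) (l * x)"
proof -
  let ?w = "\<lambda>x. ev (fourier_h1 T u) (l * x)"
  have m: "u \<in> borel_measurable borel" "u \<in> L2_circle T"
    using u by (auto simp: sobolev_space_def L2_circle_def)
  have w: "set_integrable lborel {0..T} ?w"
    by (intro borel_integrable_atLeastAtMost' continuous_intros)
  have "AE x in lborel. x \<in> {0<..<T} \<longrightarrow> u x - ?w x = 0"
  proof (rule fourier_coeff_eq_0_imp_AE[OF T])
    show "set_integrable lborel {0..T} (\<lambda>x. u x - ?w x)"
      by (rule set_integral_diff(1)[OF L2_circle_set_integrable[OF m(2)] w])
    show "(\<lambda>x. u x - ?w x) \<in> borel_measurable borel" using m(1) by measurable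
    show "fourier_coeff T (\<lambda>x. u x - ?w x) j = 0" for j
      by (simp add: fourier_coeff_diff[OF L2_circle_set_integrable[OF m(2)] w]
          fourier_coeff_ev_scaled coef_fourier_h1[OF T u])
  qed
  then have "AE x in lborel. x \<in> {0<..<T} \<longrightarrow> u x = ?w x" by simp
  then show ?thesis
  proof (rule AE_periodic[OF T])
    show "{x. u x = ?w x} \<in> sets borel" using m(1) by measurable
    show "u (x + T) = ?w (x + T) \<longleftrightarrow> u x = ?w x" for x
      using u by (simp add: ev_scaled_periodic sobolev_space_def L2_circle_def)
  qed
qed

lemma fourier_h1_sobolev_diff:
  assumes u: "u \<in> sobolev_space 1 T" and v: "v \<in> sobolev_space 1 T"
  shows "fourier_coeff T (\<lambda>x. u x - v x) j = coef (fourier_h1 T u - fourier_h1 T v) j"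
  using u v by (simp add: coef_fourier_h1[OF T] fourier_coeff_diff L2_circle_set_integrable sobolev_space_def)

lemma sobolev_norm_diff:
  assumes u: "u \<in> sobolev_space 1 T" and v: "v \<in> sobolev_space 1 T"
  shows "norm (fourier_h1 T u - fourier_h1 T v) \<le> 5 * max 1 (1 / l) * sobolev_norm 1 T (\<lambda>x. u x - v x)"
    and "sobolev_norm 1 T (\<lambda>x. u x - v x) \<le> max 1 l * norm (fourier_h1 T u - fourier_h1 T v)"
  unfolding sobolev_norm_eq[OF fourier_h1_sobolev_diff[OF u v]] l[symmetric]
  using T by (intro norm_le_sobolev sobolev_le_norm; simp add: l)+

end

section \<open>The nonlocal equation on the circle of length \<open>2 * pi * n / k\<close>\<close>

locale gp_circle =
  fixes \<epsilon> k V0 :: real and \<zeta> :: "real \<Rightarrow> real" and n :: nat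
  assumes \<epsilon>: "\<epsilon> > 0" and k: "k > 0" and \<zeta>: "admissible_zeta \<zeta>" and n: "n \<ge> 1"
begin

definition T :: real where "T = 2 * pi * real n / k"
definition lam :: real where "lam = k / real n"
text \<open>The Fourier transform of the rescaled kernel at the wave number \<open>lam * j\<close>;
  evenness of the profile leaves only the cosine.\<close>

definition m :: "int \<Rightarrow> real" where "m j = (LINT v|lborel. \<zeta> v * cos (lam * of_int j * \<epsilon> * v))"
text \<open>The squared sine has the wave numbers 0 and plus or minus 2 k; since
  \<open>lam * n = k\<close>, they sit at the indices 0 and plus or minus 2 n.\<close>

definition V :: h1 where
  "V = mon 0 (of_real (V0 / 2)) - mon (2 * int n) (of_real (V0 / 4)) - mon (- 2 * int n) (of_real (V0 / 4))"

lemma T_pos: "T > 0" and lam_pos: "lam > 0" and lam_T: "lam = 2 * pi / T" and lam_n: "lam * real n = k"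
  using k n by (auto simp: T_def lam_def)

lemma zeta_integrable: "integrable lborel \<zeta>" and zeta_nonneg: "0 \<le> \<zeta> x"
  using \<zeta> by (auto simp: admissible_zeta_def)

sublocale nonlocal_gp lam m V
proof
  fix j
  show "0 < lam" by (rule lam_pos)
  show "0 \<le> m j"
    using admissible_zeta_cos_sin(3)[OF \<zeta>, of "lam * of_int j * \<epsilon>"] by (simp add: m_def)
  have "m j \<le> (LINT v|lborel. \<zeta> v)"
    unfolding m_def
    by (intro integral_mono admissible_zeta_cos_sin[OF \<zeta>]) (simp add: mult_left_le zeta_nonneg)
  then show "m j \<le> 1" using admissible_zeta_cos_sin(6)[OF \<zeta>] by simp
  show "m (- j) = m j" by (simp add: m_def)
  show "cj V = V" by (simp add: V_def)
qed

lemma ev_V: "ev V (lam * x) = of_real (gp_potential V0 k x)"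
proof -
  have e: "real_of_int (2 * int n) * (lam * x) = 2 * (k * x)"
    "real_of_int (- 2 * int n) * (lam * x) = - (2 * (k * x))"
  proof -
    have "real_of_int (2 * int n) * (lam * x) = 2 * ((lam * real n) * x)"
      "real_of_int (- 2 * int n) * (lam * x) = - (2 * ((lam * real n) * x))" by simp_all
    then show "real_of_int (2 * int n) * (lam * x) = 2 * (k * x)"
      "real_of_int (- 2 * int n) * (lam * x) = - (2 * (k * x))" unfolding lam_n .
  qed
  have "ev V (lam * x) = of_real (V0 / 2 - V0 / 2 * cos (2 * (k * x)))"
    unfolding V_def ev_linear ev_mon e by (simp add: complex_eq_iff)
  also have "V0 / 2 - V0 / 2 * cos (2 * (k * x)) = gp_potential V0 k x"
    unfolding gp_potential_def cos_double_sin[of "k * x"] by (simp add: algebra_simps)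
  finally show ?thesis .
qed

text \<open>The kernel lives on the whole line but acts on periodic functions as a multiplier. By
  density monomials suffice, and for them the sine integral vanishes.\<close>

lemma convolution_zeta:
  "(LINT v|lborel. of_real (\<zeta> v) * ev b (lam * (x - \<epsilon> * v))) = ev (fmult m b) (lam * x)"
proof -
  let ?f = "\<lambda>b v. of_real (\<zeta> v) * ev b (lam * (x - \<epsilon> * v))"
  let ?I = "\<lambda>b. LINT v|lborel. ?f b v"
  have mz: "\<zeta> \<in> borel_measurable borel"
    using borel_measurable_integrable[OF zeta_integrable] by simp
  have i: "integrable lborel (?f b)" for b
  proof (rule Bochner_Integration.integrable_bound[OF integrable_mult_right[OF zeta_integrable, of "norm b"]])
    show "?f b \<in> borel_measurable lborel" using mz by measurable
    show "AE v in lborel. norm (?f b v) \<le> norm (norm b * \<zeta> v)"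
      using mult_right_mono[OF cmod_ev_le zeta_nonneg]
      by (intro AE_I2) (simp add: norm_mult zeta_nonneg mult.commute)
  qed
  have "bounded_linear ?I"
  proof (rule bounded_linear_intro[of _ 1])
    show "?I (a + b) = ?I a + ?I b" for a b
      unfolding ev_linear distrib_left by (rule Bochner_Integration.integral_add[OF i i])
    show "?I (r *\<^sub>R b) = r *\<^sub>R ?I b" for r b
      unfolding ev_linear mult_scaleR_right by simp
    show "norm (?I b) \<le> norm b * 1" for b
    proof -
      have "norm (?I b) \<le> (LINT v|lborel. norm b * \<zeta> v)"
        by (rule order_trans[OF integral_norm_bound],
            intro integral_mono integrable_norm i integrable_mult_right zeta_integrable)
           (use mult_right_mono[OF cmod_ev_le zeta_nonneg] in \<open>simp add: norm_mult zeta_nonneg mult.commute\<close>)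
      then show ?thesis using admissible_zeta_cos_sin(6)[OF \<zeta>] by simp
    qed
  qed
  moreover have "bounded_linear (\<lambda>b. ev (fmult m b) (lam * x))"
    by (rule bounded_linear_compose[OF bounded_linear_ev bounded_linear_R])
  moreover have "?I (mon j c) = ev (fmult m (mon j c)) (lam * x)" for j c
  proof -
    define q where "q = lam * of_int j * \<epsilon>"
    have cs: "integrable lborel (\<lambda>v. complex_of_real (\<zeta> v * cos (q * v)))"
      "integrable lborel (\<lambda>v. complex_of_real (\<zeta> v * sin (q * v)))"
      using admissible_zeta_cos_sin(1,2)[OF \<zeta>] by (auto simp del: of_real_mult)
    have e: "?f (mon j c) v = (c * cis (of_int j * (lam * x))) * (complex_of_real (\<zeta> v * cos (q * v)) - \<i> * complex_of_real (\<zeta> v * sin (q * v)))" for v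
    proof -
      have "of_int j * (lam * (x - \<epsilon> * v)) = of_int j * (lam * x) + - (q * v)"
        by (simp add: q_def algebra_simps)
      then have "cis (of_int j * (lam * (x - \<epsilon> * v))) = cis (of_int j * (lam * x)) * cis (- (q * v))"
        by (simp only: cis_mult)
      moreover have "of_real (\<zeta> v) * cis (- (q * v)) = complex_of_real (\<zeta> v * cos (q * v)) - \<i> * complex_of_real (\<zeta> v * sin (q * v))"
        by (simp add: complex_eq_iff)
      moreover have "of_real (\<zeta> v) * (c * (A * B)) = (c * A) * (of_real (\<zeta> v) * B)" for A B
        by (simp only: mult_ac)
      ultimately show ?thesis by (simp only: ev_mon)
    qed
    have "?I (mon j c) = (c * cis (of_int j * (lam * x))) * (of_real (LINT v|lborel. \<zeta> v * cos (q * v)) - \<i> * of_real (LINT v|lborel. \<zeta> v * sin (q * v)))"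
      by (simp only: e integral_mult_right_zero integral_complex_of_real
          Bochner_Integration.integral_diff[OF cs(1) integrable_mult_right[OF cs(2)]])
    also have "\<dots> = ev (mon j (of_real (m j) * c)) (lam * x)"
      using admissible_zeta_cos_sin(4)[OF \<zeta>, of q] by (simp add: m_def q_def)
    also have "mon j (of_real (m j) * c) = fmult m (mon j c)"
      by (rule h1_eqI) (simp add: coef_R)
    finally show ?thesis .
  qed
  ultimately show ?thesis by (rule bounded_linear_h1_ext)
qed

lemma R_kernel_density:
  assumes u: "u \<in> sobolev_space 1 T"
  defines "a \<equiv> fourier_h1 T u"
  shows "complex_of_real (LINT y|lborel. R_kernel \<zeta> \<epsilon> (x - y) * (cmod (u y))\<^sup>2) = ev (fmult m (a * cj a)) (lam * x)"
proof -
  have mz: "\<zeta> \<in> borel_measurable borel"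
    using borel_measurable_integrable[OF zeta_integrable] by simp
  have mu: "u \<in> borel_measurable borel" using u by (simp add: sobolev_space_def L2_circle_def)
  have "(LINT y|lborel. R_kernel \<zeta> \<epsilon> (x - y) * (cmod (u y))\<^sup>2)
      = (LINT y|lborel. R_kernel \<zeta> \<epsilon> (x - y) * (cmod (ev a (lam * y)))\<^sup>2)"
  proof (rule integral_cong_AE)
    show "AE y in lborel. R_kernel \<zeta> \<epsilon> (x - y) * (cmod (u y))\<^sup>2 = R_kernel \<zeta> \<epsilon> (x - y) * (cmod (ev a (lam * y)))\<^sup>2"
      using sobolev_AE_ev[OF T_pos lam_T u] by eventually_elim (simp add: a_def)
  qed (use mz mu in \<open>auto simp: R_kernel_def\<close>)
  also have "\<dots> = (LINT v|lborel. \<zeta> v * (cmod (ev a (lam * (x - \<epsilon> * v))))\<^sup>2)"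
    by (rule R_kernel_integral[OF \<epsilon>])
  also have "complex_of_real \<dots> = (LINT v|lborel. of_real (\<zeta> v * (cmod (ev a (lam * (x - \<epsilon> * v))))\<^sup>2))"
    by (rule integral_complex_of_real[symmetric])
  also have "\<dots> = (LINT v|lborel. of_real (\<zeta> v) * ev (a * cj a) (lam * (x - \<epsilon> * v)))"
    by (simp add: complex_norm_square[symmetric] del: of_real_power)
  also note convolution_zeta
  finally show ?thesis .
qed

lemma fourier_coeff_gp_lower_order:
  assumes u: "u \<in> sobolev_space 1 T"
  shows "fourier_coeff T (gp_lower_order 1 \<epsilon> \<zeta> (gp_potential V0 k) u) j = coef (nonlin (fourier_h1 T u)) j"
proof -
  define a where "a = fourier_h1 T u"
  have g: "gp_lower_order 1 \<epsilon> \<zeta> (gp_potential V0 k) u x = u x * ev (V + fmult m (a * cj a)) (lam * x)" for x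
    unfolding gp_lower_order_def R_kernel_density[OF u] ev_V[symmetric]
    by (simp add: a_def algebra_simps)
  have mu: "u \<in> borel_measurable borel" using u by (simp add: sobolev_space_def L2_circle_def)
  have "fourier_coeff T (gp_lower_order 1 \<epsilon> \<zeta> (gp_potential V0 k) u) j
      = fourier_coeff T (\<lambda>x. ev (nonlin a) (lam * x)) j"
  proof (rule fourier_coeff_cong_AE)
    show "AE x in lborel. gp_lower_order 1 \<epsilon> \<zeta> (gp_potential V0 k) u x = ev (nonlin a) (lam * x)"
      using sobolev_AE_ev[OF T_pos lam_T u]
      by eventually_elim (simp add: g a_def nonlin_def mult.commute)
    show "gp_lower_order 1 \<epsilon> \<zeta> (gp_potential V0 k) u \<in> borel_measurable borel"
      unfolding g[abs_def] using mu by measurable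
    show "(\<lambda>x. ev (nonlin a) (lam * x)) \<in> borel_measurable borel" by measurable
  qed
  then show ?thesis by (simp add: fourier_coeff_ev_scaled[OF T_pos lam_T] a_def)
qed

lemma laplace_symbol:
  "- (1/2) * (2 * of_real pi * \<i> * of_int j / of_real T)\<^sup>2 = complex_of_real (lam\<^sup>2 / 2 * (of_int j)\<^sup>2)"
  using T_pos by (simp add: lam_T power_mult_distrib power_divide field_simps)

lemma i_mult_eq_iff: "\<i> * D = X \<longleftrightarrow> D = - \<i> * X" for D X :: complex
  by (metis (no_types, opaque_lifting) add.inverse_inverse complex_i_mult_minus minus_mult_left)

text \<open>Dividing the equation for each coefficient by i gives \<open>flow\<close>, and the norm
  for period \<open>T\<close> dominates that of \<open>h1\<close>. Hence the conservation laws apply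
  to every solution and not only to the one constructed.\<close>

lemma gp_solution_evolves:
  assumes "gp_solution T 1 \<epsilon> \<zeta> (gp_potential V0 k) \<psi>0 \<psi>"
  shows "evolves {0..} (\<lambda>t. fourier_h1 T (\<psi> t))"
proof -
  have mem: "\<psi> t \<in> sobolev_space 1 T" if "t \<ge> 0" for t
    using assms that by (simp add: gp_solution_def)
  have "continuous_on {0..} (\<lambda>t. fourier_h1 T (\<psi> t))"
    unfolding continuous_on_def
  proof
    fix t :: real assume t: "t \<in> {0..}"
    have "((\<lambda>s. 5 * max 1 (1 / lam) * sobolev_norm 1 T (\<lambda>x. \<psi> s x - \<psi> t x)) \<longlongrightarrow> 5 * max 1 (1 / lam) * 0) (at t within {0..})"
      using assms t by (intro tendsto_mult_left) (simp add: gp_solution_def)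
    then have "((\<lambda>s. norm (fourier_h1 T (\<psi> s) - fourier_h1 T (\<psi> t))) \<longlongrightarrow> 0) (at t within {0..})"
      unfolding mult_zero_right
    proof (rule Lim_null_comparison[rotated])
      show "\<forall>\<^sub>F s in at t within {0..}. norm (norm (fourier_h1 T (\<psi> s) - fourier_h1 T (\<psi> t)))
          \<le> 5 * max 1 (1 / lam) * sobolev_norm 1 T (\<lambda>x. \<psi> s x - \<psi> t x)"
        using sobolev_norm_diff(1)[OF T_pos lam_T mem mem] t by (auto simp: eventually_at_filter)
    qed
    then show "((\<lambda>s. fourier_h1 T (\<psi> s)) \<longlongrightarrow> fourier_h1 T (\<psi> t)) (at t within {0..})"
      by (simp add: LIM_zero_iff tendsto_norm_zero_iff)
  qed
  moreover have "((\<lambda>s. coef (fourier_h1 T (\<psi> s)) j) has_vector_derivative flow (fourier_h1 T (\<psi> t)) j)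
      (at t within {0..})" if t: "t \<ge> 0" for t j
  proof -
    obtain D where "((\<lambda>s. fourier_coeff T (\<psi> s) j) has_vector_derivative D) (at t within {0..})"
      and "\<i> * D = - (1/2) * (2 * of_real pi * \<i> * of_int j / of_real T)\<^sup>2 * fourier_coeff T (\<psi> t) j
                + fourier_coeff T (gp_lower_order 1 \<epsilon> \<zeta> (gp_potential V0 k) (\<psi> t)) j"
      using assms t unfolding gp_solution_def by blast
    then have "((\<lambda>s. fourier_coeff T (\<psi> s) j) has_vector_derivative flow (fourier_h1 T (\<psi> t)) j) (at t within {0..})"
      by (simp only: flow_def i_mult_eq_iff laplace_symbol fourier_coeff_gp_lower_order[OF mem[OF t]] coef_fourier_h1[OF T_pos mem[OF t]])
    then show ?thesis
      by (rule has_vector_derivative_transform[rotated 2])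
         (use t in \<open>auto simp: coef_fourier_h1[OF T_pos mem]\<close>)
  qed
  ultimately show ?thesis by (simp add: evolves_def)
qed

lemma fourier_h1_cong_AE:
  assumes "u \<in> sobolev_space 1 T" "v \<in> sobolev_space 1 T" "AE x in lborel. u x = v x"
  shows "fourier_h1 T u = fourier_h1 T v"
  using assms
  by (intro h1_eqI) (simp add: coef_fourier_h1[OF T_pos] fourier_coeff_cong_AE sobolev_space_def L2_circle_def)

lemma gp_solution_exists:
  assumes u: "\<psi>0 \<in> sobolev_space 1 T"
  shows "\<exists>\<psi>. gp_solution T 1 \<epsilon> \<zeta> (gp_potential V0 k) \<psi>0 \<psi>"
proof -
  obtain a where a: "evolves {0..} a" "a 0 = fourier_h1 T \<psi>0" by (rule global_solution)
  define \<psi> where "\<psi> t x = ev (a t) (lam * x)" for t x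
  have mem: "\<psi> t \<in> sobolev_space 1 T" for t
    unfolding \<psi>_def[abs_def] by (rule ev_scaled_mem[OF T_pos lam_T])
  have h: "fourier_h1 T (\<psi> t) = a t" for t
    unfolding \<psi>_def[abs_def] by (rule fourier_h1_ev_scaled[OF T_pos lam_T])
  have c: "fourier_coeff T (\<psi> t) j = coef (a t) j" for t j
    unfolding \<psi>_def[abs_def] by (rule fourier_coeff_ev_scaled[OF T_pos lam_T])
  have "gp_solution T 1 \<epsilon> \<zeta> (gp_potential V0 k) \<psi>0 \<psi>"
    unfolding gp_solution_def
  proof (intro conjI allI impI)
    show "\<psi> t \<in> sobolev_space 1 T" for t by (rule mem)
    fix t :: real assume t: "0 \<le> t"
    show "((\<lambda>s. sobolev_norm 1 T (\<lambda>x. \<psi> s x - \<psi> t x)) \<longlongrightarrow> 0) (at t within {0..})"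
    proof (rule Lim_null_comparison)
      show "\<forall>\<^sub>F s in at t within {0..}. norm (sobolev_norm 1 T (\<lambda>x. \<psi> s x - \<psi> t x)) \<le> max 1 lam * norm (a s - a t)"
      proof (intro always_eventually allI)
        fix s
        have "0 \<le> sobolev_norm 1 T (\<lambda>x. \<psi> s x - \<psi> t x)"
          unfolding sobolev_norm_def sobolev_weight_1 by (intro real_sqrt_ge_zero infsum_nonneg) auto
        then show "norm (sobolev_norm 1 T (\<lambda>x. \<psi> s x - \<psi> t x)) \<le> max 1 lam * norm (a s - a t)"
          using sobolev_norm_diff(2)[OF T_pos lam_T mem mem, of s t] by (simp add: h)
      qed
      have "(a \<longlongrightarrow> a t) (at t within {0..})"
        using a(1) t by (auto simp: evolves_def continuous_on_def)
      then have "((\<lambda>s. max 1 lam * norm (a s - a t)) \<longlongrightarrow> max 1 lam * norm (a t - a t)) (at t within {0..})"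
        by (intro tendsto_intros)
      then show "((\<lambda>s. max 1 lam * norm (a s - a t)) \<longlongrightarrow> 0) (at t within {0..})" by simp
    qed
    show "\<exists>D. ((\<lambda>s. fourier_coeff T (\<psi> s) j) has_vector_derivative D) (at t within {0..}) \<and>
        \<i> * D = - (1/2) * (2 * of_real pi * \<i> * of_int j / of_real T)\<^sup>2 * fourier_coeff T (\<psi> t) j
                + fourier_coeff T (gp_lower_order 1 \<epsilon> \<zeta> (gp_potential V0 k) (\<psi> t)) j" for j
      unfolding i_mult_eq_iff laplace_symbol fourier_coeff_gp_lower_order[OF mem] h c
      using a(1) t by (auto simp: evolves_def flow_def)
  next
    show "AE x in lborel. \<psi> 0 x = \<psi>0 x"
      using sobolev_AE_ev[OF T_pos lam_T u] by eventually_elim (simp add: \<psi>_def a(2))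
  qed
  then show ?thesis by blast
qed

end

section \<open>Coercivity of the Hessian\<close>

lemma integral_ev: "integral {0..2 * pi} (ev c) = 2 * pi * coef c 0"
proof -
  have "set_integrable lborel {0..2 * pi} (ev c)"
    by (intro borel_integrable_atLeastAtMost' continuous_intros)
  from set_borel_integral_eq_integral(2)[OF this] show ?thesis
    using fourier_coeff_ev[of "2 * pi" c 0] by (simp add: fourier_coeff_def field_simps)
qed

lemma parseval: "integral {0..2 * pi} (\<lambda>x. (cmod (ev b x))\<^sup>2) = 2 * pi * ip b b"
proof -
  have "(\<lambda>x. (cmod (ev b x))\<^sup>2) integrable_on {0..2 * pi}"
    by (intro integrable_continuous_interval continuous_intros)
  from integral_linear[OF this bounded_linear_of_real[where 'a = complex]]
  have "complex_of_real (integral {0..2 * pi} (\<lambda>x. (cmod (ev b x))\<^sup>2))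
      = integral {0..2 * pi} (complex_of_real \<circ> (\<lambda>x. (cmod (ev b x))\<^sup>2))" by simp
  also have "complex_of_real \<circ> (\<lambda>x. (cmod (ev b x))\<^sup>2) = ev (b * cj b)"
    by (rule ext) (simp only: o_def ev_mult ev_cj complex_norm_square)
  also note integral_ev
  finally have "complex_of_real (integral {0..2 * pi} (\<lambda>x. (cmod (ev b x))\<^sup>2)) = 2 * pi * coef (b * cj b) 0" .
  then show ?thesis by (simp add: ip_def complex_eq_iff)
qed

definition trunc_diff :: "nat \<Rightarrow> h1 \<Rightarrow> h1" where
  "trunc_diff N a = (\<Sum>j=-int N..int N. mon j (\<i> * of_int j * coef a j))"

lemma coef_trunc_diff: "coef (trunc_diff N a) j = (if \<bar>j\<bar> \<le> int N then \<i> * of_int j * coef a j else 0)"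
  by (auto simp: trunc_diff_def)

lemma ip_trunc_diff: "ip (trunc_diff N a) (trunc_diff N a) = dip (trunc N a) (trunc N a)"
proof -
  have "(cmod (coef (trunc_diff N a) j))\<^sup>2 = (of_int j)\<^sup>2 * (cmod (coef (trunc N a) j))\<^sup>2" for j
    by (simp add: coef_trunc_diff norm_mult power_mult_distrib)
  then show ?thesis
    using ip_self_has_sum[of "trunc_diff N a"] dip_self_has_sum[of "trunc N a"] by (simp add: has_sum_unique)
qed

lemma ev_trunc_deriv:
  "(ev (trunc N a) has_vector_derivative ev (trunc_diff N a) x) (at x within S)"
proof -
  have cis: "((\<lambda>x. cis (of_int j * x)) has_vector_derivative (\<i> * of_int j) * cis (of_int j * x)) (at x within S)" for j :: int
  proof -
    have "((\<lambda>z. exp (\<i> * of_int j * z)) has_field_derivative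
        (\<i> * of_int j) * exp (\<i> * of_int j * of_real x)) (at (of_real x))"
      by (auto intro!: derivative_eq_intros)
    from has_vector_derivative_real_field[OF this]
    show ?thesis by (simp add: cis_conv_exp mult.assoc)
  qed
  have "((\<lambda>x. \<Sum>j=-int N..int N. coef a j * cis (of_int j * x)) has_vector_derivative
      (\<Sum>j=-int N..int N. coef a j * ((\<i> * of_int j) * cis (of_int j * x)))) (at x within S)"
    by (intro has_vector_derivative_sum has_vector_derivative_mult_right cis)
  then show ?thesis
    unfolding ev_trunc[abs_def] by (simp add: trunc_diff_def mult_ac)
qed

text \<open>Nonnegativity of the variance about the mean \<open>t\<close>.\<close>

lemma square_integral_le:
  fixes f :: "real \<Rightarrow> real"
  assumes "a < b" and f: "continuous_on {a..b} f"
  shows "(integral {a..b} f)\<^sup>2 \<le> (b - a) * integral {a..b} (\<lambda>x. (f x)\<^sup>2)"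
proof -
  define t where "t = integral {a..b} f / (b - a)"
  have i: "f integrable_on {a..b}" "(\<lambda>x. (f x)\<^sup>2) integrable_on {a..b}"
    by (intro integrable_continuous_interval continuous_intros f)+
  have "0 \<le> integral {a..b} (\<lambda>x. (f x - t)\<^sup>2)"
    by (intro integral_nonneg integrable_continuous_interval continuous_intros f) auto
  also have "(\<lambda>x. (f x - t)\<^sup>2) = (\<lambda>x. (f x)\<^sup>2 - 2 * t * f x + t\<^sup>2)"
    by (auto simp: power2_eq_square algebra_simps)
  also have "integral {a..b} \<dots> = integral {a..b} (\<lambda>x. (f x)\<^sup>2) - 2 * t * integral {a..b} f + t\<^sup>2 * (b - a)"
  proof (rule integral_unique)
    have "((\<lambda>x. t\<^sup>2) has_integral t\<^sup>2 * (b - a)) {a..b}"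
      using has_integral_const_real[of "t\<^sup>2" a b] \<open>a < b\<close> by (simp add: mult.commute)
    then show "((\<lambda>x. (f x)\<^sup>2 - 2 * t * f x + t\<^sup>2) has_integral
        integral {a..b} (\<lambda>x. (f x)\<^sup>2) - 2 * t * integral {a..b} f + t\<^sup>2 * (b - a)) {a..b}"
      by (intro has_integral_add has_integral_diff has_integral_mult_right integrable_integral i)
  qed
  also have "\<dots> = integral {a..b} (\<lambda>x. (f x)\<^sup>2) - (integral {a..b} f)\<^sup>2 / (b - a)"
  proof -
    have "2 * t * integral {a..b} f = 2 * ((integral {a..b} f)\<^sup>2 / (b - a))"
      by (simp add: t_def power2_eq_square)
    moreover have "t\<^sup>2 * (b - a) = (integral {a..b} f)\<^sup>2 / (b - a)"
      using \<open>a < b\<close> by (simp add: t_def power2_eq_square)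
    ultimately show ?thesis by linarith
  qed
  finally show ?thesis using \<open>a < b\<close> by (simp add: field_simps)
qed

text \<open>The total weight times \<open>f x\<close> differs from the weighted integral by at most
  the total weight times the oscillation, which the integral of |f'| bounds. A weighted mean appears
  because the choice of phase controls precisely the mean with the density as weight.\<close>

lemma weighted_poincare:
  fixes f f' r :: "real \<Rightarrow> real"
  assumes ab: "a < b" and f: "\<And>x. (f has_real_derivative f' x) (at x)"
    and f': "continuous_on UNIV f'" and r: "continuous_on UNIV r" and B: "0 < B" "\<And>x. B \<le> r x"
    and x: "x \<in> {a..b}"
  shows "(f x)\<^sup>2 \<le> 2 * (integral {a..b} (\<lambda>y. r y * f y))\<^sup>2 / (B * (b - a))\<^sup>2
      + 2 * (b - a) * integral {a..b} (\<lambda>y. (f' y)\<^sup>2)"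
proof -
  have cf: "continuous_on UNIV f"
    using f by (meson DERIV_isCont continuous_at_imp_continuous_on)
  note c = continuous_on_subset[OF cf subset_UNIV] continuous_on_subset[OF f' subset_UNIV]
    continuous_on_subset[OF r subset_UNIV]
  define I where "I = integral {a..b} (\<lambda>y. \<bar>f' y\<bar>)"
  define R where "R = integral {a..b} r"
  define Z where "Z = integral {a..b} (\<lambda>y. r y * f y)"
  have osc: "\<bar>f x - f y\<bar> \<le> I" if "y \<in> {a..b}" for y
  proof -
    have *: "\<bar>f q - f p\<bar> \<le> I" if "p \<in> {a..b}" "q \<in> {a..b}" "p \<le> q" for p q
    proof -
      have "(f' has_integral (f q - f p)) {p..q}"
        using f \<open>p \<le> q\<close>
        by (intro fundamental_theorem_of_calculus)
           (auto simp: has_real_derivative_iff_has_vector_derivative[symmetric] intro: DERIV_subset)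
      then have "\<bar>f q - f p\<bar> = norm (integral {p..q} f')" by (simp add: integral_unique)
      also have "\<dots> \<le> integral {p..q} (\<lambda>y. \<bar>f' y\<bar>)"
        by (rule integral_norm_bound_integral) (auto intro!: integrable_continuous_interval continuous_intros c)
      also have "\<dots> \<le> I"
        unfolding I_def using that
        by (intro integral_subset_le integrable_continuous_interval continuous_intros c) auto
      finally show ?thesis .
    qed
    show ?thesis
      using *[of x y] *[of y x] x that by (cases "x \<le> y") (auto simp: abs_minus_commute)
  qed
  have I0: "0 \<le> I" using osc[OF x] by simp
  have "integral {a..b} (\<lambda>y. B) \<le> R"
    unfolding R_def by (intro integral_le integrable_continuous_interval continuous_intros c) (auto simp: B)
  then have R: "B * (b - a) \<le> R" using ab by (simp add: mult.commute)
  have R0: "0 < B * (b - a)" using ab B by simp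
  have "\<bar>integral {a..b} (\<lambda>y. r y * (f x - f y))\<bar> \<le> integral {a..b} (\<lambda>y. r y * I)"
  proof -
    have "norm (integral {a..b} (\<lambda>y. r y * (f x - f y))) \<le> integral {a..b} (\<lambda>y. r y * I)"
    proof (rule integral_norm_bound_integral)
      fix y assume "y \<in> {a..b}"
      then have "r y * \<bar>f x - f y\<bar> \<le> r y * I"
        using B(1) B(2)[of y] by (intro mult_left_mono osc) auto
      then show "norm (r y * (f x - f y)) \<le> r y * I"
        using B(1) B(2)[of y] by (simp add: abs_mult)
    qed (auto intro!: integrable_continuous_interval continuous_intros c)
    then show ?thesis by simp
  qed
  also have "\<dots> = R * I" by (simp add: R_def)
  also have "integral {a..b} (\<lambda>y. r y * (f x - f y)) = R * f x - Z"
    unfolding R_def Z_def right_diff_distrib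
    by (subst integral_diff) (auto intro!: integrable_continuous_interval continuous_intros c)
  finally have "\<bar>R * f x\<bar> \<le> \<bar>Z\<bar> + R * I" by linarith
  then have "R * \<bar>f x\<bar> \<le> \<bar>Z\<bar> + R * I"
    using R R0 by (simp add: abs_mult)
  then have "\<bar>f x\<bar> \<le> \<bar>Z\<bar> / R + I" using R R0 by (simp add: field_simps)
  also have "\<bar>Z\<bar> / R \<le> \<bar>Z\<bar> / (B * (b - a))"
    using R R0 by (intro divide_left_mono) auto
  finally have "\<bar>f x\<bar> \<le> \<bar>Z\<bar> / (B * (b - a)) + I" by linarith
  from power_mono[OF this, of 2] have "(f x)\<^sup>2 \<le> (\<bar>Z\<bar> / (B * (b - a)) + I)\<^sup>2" by simp
  also have "\<dots> \<le> 2 * (\<bar>Z\<bar> / (B * (b - a)))\<^sup>2 + 2 * I\<^sup>2"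
    using sum_squares_bound[of "\<bar>Z\<bar> / (B * (b - a))" I] by (simp add: power2_sum)
  also have "I\<^sup>2 \<le> (b - a) * integral {a..b} (\<lambda>y. (f' y)\<^sup>2)"
    using square_integral_le[OF ab, of "\<lambda>y. \<bar>f' y\<bar>"] by (simp add: I_def continuous_intros c)
  finally show ?thesis by (simp only: Z_def power_divide power2_abs times_divide_eq_right mult.assoc)
qed

text \<open>With C = cos (n x) and S = sin (n x), the wave is a C + i b S and the left side is
  |p'|^2 - n^2 |p|^2 for p equal to the wave times u + i v. The final bracket is an exact
  derivative; its last term comes from moving the derivative in the current coupling from u onto
  v.\<close>

lemma madelung_identity:
  fixes a b C S u v u' v' n :: real
  assumes "C\<^sup>2 + S\<^sup>2 = 1"
  shows "(n * (- a * S * u - b * C * v) + a * C * u' - b * S * v')\<^sup>2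
       + (n * (b * C * u - a * S * v) + a * C * v' + b * S * u')\<^sup>2
       - n\<^sup>2 * ((a\<^sup>2 * C\<^sup>2 + b\<^sup>2 * S\<^sup>2) * (u\<^sup>2 + v\<^sup>2))
     = (a\<^sup>2 * C\<^sup>2 + b\<^sup>2 * S\<^sup>2) * (u'\<^sup>2 + v'\<^sup>2) + 4 * (n * a * b) * u * v'
       + (n\<^sup>2 * (b\<^sup>2 - a\<^sup>2) * (C\<^sup>2 - S\<^sup>2) * (u\<^sup>2 + v\<^sup>2)
          + n * (b\<^sup>2 - a\<^sup>2) * (C * S) * (2 * u * u' + 2 * v * v')
          - 2 * (n * a * b) * (u' * v + u * v'))"
  using assms by algebra

text \<open>The 5 is 4 + 1. Completing the square in \<open>v'\<close> spends half of the
  \<open>v'\<close> term and costs \<open>4 * n^2 / B\<close> times the square of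
  \<open>2 * r * u\<close>; trading the \<open>u'\<close> term for the derivative of
  \<open>2 * r * u\<close> costs at most \<open>n^2 / B\<close> more. The 16 combines the factor 2
  from splitting a square, the 4 from doubling \<open>r * u\<close>, and
  \<open>r <= 2 * B\<close>.\<close>

lemma madelung_inequality:
  fixes A B c n r r' u v' u' :: real
  assumes B: "0 < B" and A: "0 \<le> A" "A \<le> B" and r: "B \<le> r" "r \<le> B + A"
    and c: "c\<^sup>2 = n\<^sup>2 * (B * (B + A))" and r': "r'\<^sup>2 \<le> (n * A)\<^sup>2"
  shows "(2 * r' * u + 2 * r * u')\<^sup>2 / (16 * B) - 5 * n\<^sup>2 / B * (2 * r * u)\<^sup>2 + r * v'\<^sup>2 / 2
      \<le> r * (u'\<^sup>2 + v'\<^sup>2) + 4 * c * u * v'"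
proof -
  have r0: "0 < r" using B r by linarith
  have "0 \<le> (r * v' + 4 * c * u)\<^sup>2 / (2 * r)" using r0 by simp
  also have "\<dots> = r * v'\<^sup>2 / 2 + 4 * c * u * v' + 8 * c\<^sup>2 * u\<^sup>2 / r"
    using r0 by (simp add: power2_eq_square field_simps)
  finally have 1: "0 \<le> r * v'\<^sup>2 / 2 + 4 * c * u * v' + 8 * c\<^sup>2 * u\<^sup>2 / r" .
  have "c\<^sup>2 \<le> n\<^sup>2 * (2 * r\<^sup>2)"
  proof -
    have "B * (B + A) \<le> r * (2 * r)" using B A r by (intro mult_mono) auto
    then show ?thesis unfolding c by (intro mult_left_mono) (auto simp: power2_eq_square)
  qed
  then have "8 * c\<^sup>2 * u\<^sup>2 / r \<le> 8 * (n\<^sup>2 * (2 * r\<^sup>2)) * u\<^sup>2 / r"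
    using r0 by (intro divide_right_mono mult_right_mono mult_left_mono) auto
  also have "\<dots> = 4 * n\<^sup>2 / r * (2 * r * u)\<^sup>2" using r0 by (simp add: power2_eq_square field_simps)
  also have "\<dots> \<le> 4 * n\<^sup>2 / B * (2 * r * u)\<^sup>2"
    using r B r0 by (intro mult_right_mono divide_left_mono) auto
  finally have 2: "8 * c\<^sup>2 * u\<^sup>2 / r \<le> 4 * n\<^sup>2 / B * (2 * r * u)\<^sup>2" .
  have "(2 * r' * u + 2 * r * u')\<^sup>2 \<le> 8 * r'\<^sup>2 * u\<^sup>2 + 8 * r\<^sup>2 * u'\<^sup>2"
    using sum_squares_bound[of "r' * u" "r * u'"] by (simp add: power2_eq_square algebra_simps)
  also have "\<dots> \<le> 8 * (n * A)\<^sup>2 * u\<^sup>2 + 8 * r\<^sup>2 * u'\<^sup>2"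
    using r' by (intro add_right_mono mult_right_mono mult_left_mono) auto
  also have "(n * A)\<^sup>2 \<le> (n * r)\<^sup>2"
    using A r by (simp add: power_mult_distrib mult_left_mono power_mono)
  finally have "(2 * r' * u + 2 * r * u')\<^sup>2 / (16 * B) \<le> (8 * (n * r)\<^sup>2 * u\<^sup>2 + 8 * r\<^sup>2 * u'\<^sup>2) / (16 * B)"
    using B by (intro divide_right_mono) (auto simp: mult_right_mono)
  also have "\<dots> = n\<^sup>2 / (8 * B) * (2 * r * u)\<^sup>2 + r * u'\<^sup>2 * (r / (2 * B))"
    using B by (simp add: power2_eq_square field_simps)
  also have "r * u'\<^sup>2 * (r / (2 * B)) \<le> r * u'\<^sup>2 * 1"
    using B A r r0 by (intro mult_left_mono) auto
  also have "n\<^sup>2 / (8 * B) * (2 * r * u)\<^sup>2 \<le> n\<^sup>2 / B * (2 * r * u)\<^sup>2"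
    using B by (intro mult_right_mono divide_left_mono) auto
  finally have 3: "(2 * r' * u + 2 * r * u')\<^sup>2 / (16 * B) \<le> n\<^sup>2 / B * (2 * r * u)\<^sup>2 + r * u'\<^sup>2" by simp
  have "5 * n\<^sup>2 / B * (2 * r * u)\<^sup>2 = 4 * n\<^sup>2 / B * (2 * r * u)\<^sup>2 + n\<^sup>2 / B * (2 * r * u)\<^sup>2"
    by (simp add: add_divide_distrib[symmetric] flip: distrib_right)
  then show ?thesis using 1 2 3 by (simp add: distrib_left)
qed

locale gp_wave = gp_circle +
  fixes B A :: real
  assumes B_pos: "0 < B" and A_nonneg: "0 \<le> A" and A_le_B: "A \<le> B"
    and A_m: "A * m (2 * int n) = - V0"
    and spectral: "\<And>q. 6 * k\<^sup>2 \<le> q\<^sup>2 / 16 + B * (LINT v|lborel. \<zeta> v * cos (q * \<epsilon> * v))"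
begin

definition phi :: h1 where
  "phi = mon (int n) (of_real ((sqrt B + sqrt (B + A)) / 2))
       + mon (- int n) (of_real ((sqrt B - sqrt (B + A)) / 2))"

definition eta :: "h1 \<Rightarrow> h1" where
  "eta p = cj phi * p + phi * cj p"

definition hessian :: "h1 \<Rightarrow> real" where
  "hessian p = lam\<^sup>2 / 2 * (dip p p - (real n)\<^sup>2 * ip p p) + ip (fmult m (eta p)) (eta p) / 2"

definition density :: "real \<Rightarrow> real" where
  "density x = B + A * (sin (real n * x))\<^sup>2"

definition density' :: "real \<Rightarrow> real" where
  "density' x = 2 * real n * A * (sin (real n * x) * cos (real n * x))"

lemma ev_phi: "ev phi x = Complex (sqrt B * cos (real n * x)) (sqrt (B + A) * sin (real n * x))"
  by (simp add: phi_def complex_eq_iff field_simps)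

lemma phi_trunc: "trunc n phi = phi"
  by (rule h1_eqI) (simp add: phi_def)

lemma ev_phi_deriv:
  "ev (trunc_diff n phi) x = Complex (- (real n * sqrt B * sin (real n * x))) (real n * sqrt (B + A) * cos (real n * x))"
proof -
  have "(ev phi has_vector_derivative Complex (- (real n * sqrt B * sin (real n * x))) (real n * sqrt (B + A) * cos (real n * x))) (at x)"
    unfolding has_vector_derivative_complex_iff ev_phi
    by (auto intro!: derivative_eq_intros simp: has_real_derivative_iff_has_vector_derivative[symmetric])
  moreover have "(ev phi has_vector_derivative ev (trunc_diff n phi) x) (at x)"
    using ev_trunc_deriv[of n phi x UNIV] by (simp add: phi_trunc)
  ultimately show ?thesis by (rule vector_derivative_unique_at[rotated])
qed

lemma density_bounds: "B \<le> density x" "density x \<le> B + A" "density x \<le> 2 * B"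
proof -
  have "A * (sin (real n * x))\<^sup>2 \<le> A * 1"
    using A_nonneg by (intro mult_left_mono) (auto simp: abs_square_le_1)
  then show "density x \<le> B + A" by (simp add: density_def)
  then show "density x \<le> 2 * B" using A_le_B by simp
  show "B \<le> density x" using A_nonneg by (simp add: density_def)
qed

lemma density_pos: "0 < density x"
  using density_bounds(1)[of x] B_pos by linarith

lemma density'_bound: "(density' x)\<^sup>2 \<le> (real n * A)\<^sup>2"
proof -
  have "density' x = real n * A * sin (2 * (real n * x))"
    by (simp add: density'_def sin_double)
  moreover have "(sin (2 * (real n * x)))\<^sup>2 \<le> 1" by (simp add: abs_square_le_1)
  ultimately show ?thesis
    using mult_left_mono[of "(sin (2 * (real n * x)))\<^sup>2" 1 "(real n * A)\<^sup>2"]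
    by (simp add: power_mult_distrib)
qed

lemma density_deriv: "(density has_real_derivative density' x) (at x)"
  unfolding density_def[abs_def] density'_def
  by (auto intro!: derivative_eq_intros simp: power2_eq_square)

lemma ev_phi_square: "ev phi x * cnj (ev phi x) = of_real (density x)"
  using B_pos A_nonneg
  by (simp add: ev_phi complex_eq_iff density_def cos_squared_eq algebra_simps power2_eq_square[symmetric])

text \<open>
  For a trigonometric polynomial \<open>p\<close> write \<open>p = \<phi>\<^sub>\<omega> (u + i v)\<close>.  The kinetic part of the Hessian then
  becomes a positive form in \<open>u'\<close>, \<open>v'\<close> plus the cross term \<open>4 c u v'\<close> with \<open>c\<close> the constant current
  of \<open>\<phi>\<^sub>\<omega>\<close>; completing the square in \<open>v'\<close> leaves a term in \<open>u\<close> only, that is, in \<open>\<eta> = 2 |\<phi>\<^sub>\<omega>|\<^sup>2 u\<close>, which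
  the nonlocal interaction dominates.
\<close>

context
  fixes M :: nat and p :: h1
  assumes p: "trunc M p = p"
begin

text \<open>This is \<open>p\<close> divided by the wave, written with a trigonometric polynomial
  over the positive real density so that it can be differentiated directly.\<close>

definition w :: "real \<Rightarrow> complex" where
  "w x = ev (cj phi * p) x * of_real (1 / density x)"

definition w' :: "real \<Rightarrow> complex" where
  "w' x = ev (cj phi * p) x * of_real (- (density' x / (density x)\<^sup>2))
     + ev (trunc_diff (M + n) (cj phi * p)) x * of_real (1 / density x)"

lemma coef_p_0: "\<bar>j\<bar> > int M \<Longrightarrow> coef p j = 0"
  by (metis coef_trunc not_less p)

lemma trunc_cj_phi_p: "trunc (M + n) (cj phi * p) = cj phi * p"
  by (rule h1_eqI) (simp add: phi_def distrib_right coef_p_0)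

lemma w_deriv: "(w has_vector_derivative w' x) (at x)"
proof -
  have "((\<lambda>x. 1 / density x) has_real_derivative - (density' x / (density x)\<^sup>2)) (at x)"
    using density_pos[of x]
    by (auto intro!: derivative_eq_intros density_deriv simp: power2_eq_square)
  then have d: "((\<lambda>x. complex_of_real (1 / density x)) has_vector_derivative of_real (- (density' x / (density x)\<^sup>2))) (at x)"
    by (intro has_vector_derivative_of_real) (simp add: has_real_derivative_iff_has_vector_derivative)
  have "(ev (cj phi * p) has_vector_derivative ev (trunc_diff (M + n) (cj phi * p)) x) (at x)"
    using ev_trunc_deriv[of "M + n" "cj phi * p" x UNIV] by (simp add: trunc_cj_phi_p)
  from has_vector_derivative_mult[OF this d] show ?thesis by (simp add: w_def[abs_def] w'_def)
qed

lemma p_eq_phi_w: "ev p x = ev phi x * w x"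
  using ev_phi_square[of x] density_pos[of x]
  by (simp add: w_def mult.assoc[symmetric])

lemma cmod_p: "(cmod (ev p x))\<^sup>2 = density x * ((Re (w x))\<^sup>2 + (Im (w x))\<^sup>2)"
proof -
  have "complex_of_real ((cmod (ev p x))\<^sup>2) = (ev phi x * cnj (ev phi x)) * (w x * cnj (w x))"
    unfolding complex_norm_square p_eq_phi_w by simp
  also have "\<dots> = of_real (density x * (cmod (w x))\<^sup>2)"
    unfolding ev_phi_square unfolding complex_norm_square[symmetric] by simp
  finally show ?thesis unfolding of_real_eq_iff by (simp add: cmod_power2)
qed

lemma p_deriv: "ev (trunc_diff M p) x = ev phi x * w' x + ev (trunc_diff n phi) x * w x"
proof (rule vector_derivative_unique_at)
  show "(ev p has_vector_derivative ev (trunc_diff M p) x) (at x)"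
    using ev_trunc_deriv[of M p x UNIV] by (simp add: p)
  have "(ev phi has_vector_derivative ev (trunc_diff n phi) x) (at x)"
    using ev_trunc_deriv[of n phi x UNIV] by (simp add: phi_trunc)
  from has_vector_derivative_mult[OF this w_deriv]
  show "(ev p has_vector_derivative ev phi x * w' x + ev (trunc_diff n phi) x * w x) (at x)"
    by (simp add: p_eq_phi_w[abs_def])
qed

lemma eta_w: "ev (eta p) x = of_real (2 * density x * Re (w x))"
proof -
  have "ev (eta p) x = ev (cj phi * p) x + cnj (ev (cj phi * p) x)"
    by (simp add: eta_def)
  also have "\<dots> = of_real (2 * Re (ev (cj phi * p) x))" by (simp add: complex_eq_iff)
  finally show ?thesis using density_pos[of x] by (simp add: w_def)
qed

lemma trunc_eta: "trunc (M + n) (eta p) = eta p"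
proof -
  have "eta p = cj phi * p + cj (cj phi * p)" by (simp add: eta_def)
  then show ?thesis
    using trunc_cj_phi_p by (intro h1_eqI) (metis (no_types, lifting) abs_minus_cancel coef_cj coef_simps(2) coef_trunc complex_cnj_zero add_0)
qed

abbreviation eta' :: "real \<Rightarrow> real" where
  "eta' x \<equiv> 2 * density' x * Re (w x) + 2 * density x * Re (w' x)"

lemma eta_deriv_w:
  "ev (trunc_diff (M + n) (eta p)) x = of_real (eta' x)"
proof (rule vector_derivative_unique_at)
  show "(ev (eta p) has_vector_derivative ev (trunc_diff (M + n) (eta p)) x) (at x)"
    using ev_trunc_deriv[of "M + n" "eta p" x UNIV] by (simp add: trunc_eta)
  have "((\<lambda>x. 2 * density x * Re (w x)) has_real_derivative eta' x) (at x)"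
    by (auto intro!: derivative_eq_intros density_deriv w_deriv)
  then show "(ev (eta p) has_vector_derivative of_real (eta' x)) (at x)"
    unfolding eta_w[abs_def] by (intro has_vector_derivative_of_real) (simp add: has_real_derivative_iff_has_vector_derivative)
qed

text \<open>A primitive of the exact part in \<open>madelung_identity\<close>; by periodicity its
  derivative integrates to 0.\<close>

definition boundary :: "real \<Rightarrow> real" where
  "boundary x = real n * A * (cos (real n * x) * sin (real n * x)) * ((Re (w x))\<^sup>2 + (Im (w x))\<^sup>2)
     - 2 * (real n * sqrt B * sqrt (B + A)) * (Re (w x) * Im (w x))"

definition kinetic :: "real \<Rightarrow> real" where
  "kinetic x = density x * ((Re (w' x))\<^sup>2 + (Im (w' x))\<^sup>2)
     + 4 * (real n * sqrt B * sqrt (B + A)) * Re (w x) * Im (w' x)"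

text \<open>Introduced as the defect between the kinetic form of \<open>p\<close> and
  \<open>kinetic\<close>; that it is the derivative of \<open>boundary\<close> is then the content
  of \<open>madelung_identity\<close>.\<close>

definition boundary' :: "real \<Rightarrow> real" where
  "boundary' x = (cmod (ev (trunc_diff M p) x))\<^sup>2 - (real n)\<^sup>2 * (cmod (ev p x))\<^sup>2 - kinetic x"

lemma boundary_deriv: "(boundary has_real_derivative boundary' x) (at x)"
proof -
  define a b where "a = sqrt B" and "b = sqrt (B + A)"
  define C S where "C = cos (real n * x)" and "S = sin (real n * x)"
  define u v u' v' where "u = Re (w x)" and "v = Im (w x)" and "u' = Re (w' x)" and "v' = Im (w' x)"
  have ab: "a\<^sup>2 = B" "b\<^sup>2 - a\<^sup>2 = A" using B_pos A_nonneg by (simp_all add: a_def b_def)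
  have CS: "C\<^sup>2 + S\<^sup>2 = 1" by (simp add: C_def S_def)
  have r: "density x = a\<^sup>2 * C\<^sup>2 + b\<^sup>2 * S\<^sup>2"
  proof -
    have "a\<^sup>2 * C\<^sup>2 + b\<^sup>2 * S\<^sup>2 = a\<^sup>2 * (C\<^sup>2 + S\<^sup>2) + (b\<^sup>2 - a\<^sup>2) * S\<^sup>2" by (simp add: algebra_simps)
    also have "\<dots> = a\<^sup>2 * 1 + A * S\<^sup>2" by (simp only: CS ab(2))
    finally show ?thesis by (simp add: density_def S_def ab(1))
  qed
  have "Re (ev (trunc_diff M p) x) = real n * (- a * S * u - b * C * v) + a * C * u' - b * S * v'"
    "Im (ev (trunc_diff M p) x) = real n * (b * C * u - a * S * v) + a * C * v' + b * S * u'"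
    unfolding p_deriv ev_phi ev_phi_deriv
    by (simp_all add: a_def b_def C_def S_def u_def v_def u'_def v'_def algebra_simps)
  moreover have "(cmod (ev p x))\<^sup>2 = density x * (u\<^sup>2 + v\<^sup>2)"
    by (simp only: cmod_p u_def v_def)
  ultimately have "boundary' x = real n ^ 2 * (b\<^sup>2 - a\<^sup>2) * (C\<^sup>2 - S\<^sup>2) * (u\<^sup>2 + v\<^sup>2)
          + real n * (b\<^sup>2 - a\<^sup>2) * (C * S) * (2 * u * u' + 2 * v * v')
          - 2 * (real n * a * b) * (u' * v + u * v')"
    using madelung_identity[OF CS, of "real n" a u b v u' v']
    unfolding boundary'_def kinetic_def cmod_power2[of "ev (trunc_diff M p) x"] r
    by (simp add: u_def v_def u'_def v'_def a_def b_def)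
  moreover have du: "((\<lambda>x. Re (w x)) has_real_derivative u') (at x)" "((\<lambda>x. Im (w x)) has_real_derivative v') (at x)"
    unfolding u'_def v'_def has_real_derivative_iff_has_vector_derivative
    by (rule bounded_linear.has_vector_derivative[OF bounded_linear_Re w_deriv]
        bounded_linear.has_vector_derivative[OF bounded_linear_Im w_deriv])+
  have "(boundary has_real_derivative (real n ^ 2 * A * (C\<^sup>2 - S\<^sup>2) * (u\<^sup>2 + v\<^sup>2)
          + real n * A * (C * S) * (2 * u * u' + 2 * v * v')
          - 2 * (real n * a * b) * (u' * v + u * v'))) (at x)"
    unfolding boundary_def[abs_def]
    by (rule derivative_eq_intros du refl)+
       (simp add: C_def S_def u_def v_def a_def b_def power2_eq_square algebra_simps)
  ultimately show ?thesis by (simp only: ab(2))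
qed

lemma w_continuous: "continuous_on S w" and w'_continuous: "continuous_on S w'"
proof -
  have d: "continuous_on S density" "continuous_on S density'"
    unfolding density_def[abs_def] density'_def[abs_def] by (intro continuous_intros)+
  have "density x \<noteq> 0" for x using density_pos[of x] by simp
  then show "continuous_on S w" "continuous_on S w'"
    unfolding w_def[abs_def] w'_def[abs_def] by (intro continuous_intros d; simp)+
qed

lemma sin_n_2pi: "sin (real n * (2 * pi)) = 0"
  using sin_npi[of "2 * n"] by (simp add: mult_ac)

lemma w_periodic: "w (2 * pi) = w 0"
  using ev_periodic[of "cj phi * p" 0 1] by (simp add: w_def density_def sin_n_2pi del: ev_mult)

lemma integral_boundary': "(boundary' has_integral 0) {0..2 * pi}"
proof -
  have "(boundary' has_integral (boundary (2 * pi) - boundary 0)) {0..2 * pi}"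
    by (rule fundamental_theorem_of_calculus)
       (auto simp: has_real_derivative_iff_has_vector_derivative[symmetric] intro: DERIV_subset[OF boundary_deriv])
  moreover have "boundary (2 * pi) = boundary 0"
    by (simp add: boundary_def w_periodic sin_n_2pi)
  ultimately show ?thesis by simp
qed

definition J :: real where
  "J = integral {0..2 * pi} (\<lambda>x. (Im (w' x))\<^sup>2)"

lemma J_nonneg: "0 \<le> J"
  unfolding J_def by (intro integral_nonneg integrable_continuous_interval continuous_intros w'_continuous) auto

lemma integral_eta: "integral {0..2 * pi} (\<lambda>x. (2 * density x * Re (w x))\<^sup>2) = 2 * pi * ip (eta p) (eta p)"
  "integral {0..2 * pi} (\<lambda>x. (eta' x)\<^sup>2) = 2 * pi * dip (eta p) (eta p)"
proof -
  show "integral {0..2 * pi} (\<lambda>x. (2 * density x * Re (w x))\<^sup>2) = 2 * pi * ip (eta p) (eta p)"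
    using parseval[of "eta p"] by (simp only: eta_w norm_of_real power2_abs)
  show "integral {0..2 * pi} (\<lambda>x. (eta' x)\<^sup>2) = 2 * pi * dip (eta p) (eta p)"
    using parseval[of "trunc_diff (M + n) (eta p)"]
    by (simp only: eta_deriv_w norm_of_real power2_abs ip_trunc_diff trunc_eta)
qed

lemma density_continuous: "continuous_on S density" "continuous_on S density'"
  unfolding density_def[abs_def] density'_def[abs_def] by (intro continuous_intros)+

lemmas cont = density_continuous w_continuous w'_continuous

text \<open>The pointwise inequality integrated over a period, with the exact part gone. Half of the
  phase gradient term is left; the density is at least \<open>B\<close>, and division by
  \<open>2 * pi\<close> turns \<open>B / 2\<close> into \<open>B / (4 * pi)\<close>.\<close>

lemma kinetic_lower_bound:
  "dip (eta p) (eta p) / (16 * B) - 5 * (real n)\<^sup>2 / B * ip (eta p) (eta p) + B / (4 * pi) * J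
    \<le> dip p p - (real n)\<^sup>2 * ip p p"
proof -
  let ?c = "real n * sqrt B * sqrt (B + A)"
  let ?f = "\<lambda>x. (eta' x)\<^sup>2 / (16 * B)
      - 5 * (real n)\<^sup>2 / B * (2 * density x * Re (w x))\<^sup>2 + B / 2 * (Im (w' x))\<^sup>2"
  have c: "?c\<^sup>2 = (real n)\<^sup>2 * (B * (B + A))" using B_pos A_nonneg by (simp add: power_mult_distrib)
  have "?f x \<le> kinetic x" for x
  proof -
    have "B / 2 * (Im (w' x))\<^sup>2 \<le> density x * (Im (w' x))\<^sup>2 / 2"
      using mult_right_mono[OF density_bounds(1)[of x], of "(Im (w' x))\<^sup>2"] by simp
    then show ?thesis
      using madelung_inequality[where r = "density x" and r' = "density' x" and u = "Re (w x)" and u' = "Re (w' x)"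
          and v' = "Im (w' x)", OF B_pos A_nonneg A_le_B density_bounds(1,2) c density'_bound]
      unfolding kinetic_def by linarith
  qed
  moreover have ki: "kinetic integrable_on {0..2 * pi}"
    unfolding kinetic_def[abs_def] by (intro integrable_continuous_interval continuous_intros cont)
  moreover have "(?f has_integral (2 * pi * dip (eta p) (eta p) / (16 * B)
      - 5 * (real n)\<^sup>2 / B * (2 * pi * ip (eta p) (eta p)) + B / 2 * J)) {0..2 * pi}"
    unfolding integral_eta[symmetric] J_def
    by (intro has_integral_add has_integral_diff has_integral_divide has_integral_mult_right integrable_integral
        integrable_continuous_interval continuous_intros cont)
  ultimately have "2 * pi * dip (eta p) (eta p) / (16 * B)
      - 5 * (real n)\<^sup>2 / B * (2 * pi * ip (eta p) (eta p)) + B / 2 * J \<le> integral {0..2 * pi} kinetic"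
    by (intro has_integral_le[OF _ integrable_integral]) auto
  also have "integral {0..2 * pi} kinetic = 2 * pi * (dip p p - (real n)\<^sup>2 * ip p p)"
  proof -
    have "kinetic = (\<lambda>x. (cmod (ev (trunc_diff M p) x))\<^sup>2 - (real n)\<^sup>2 * (cmod (ev p x))\<^sup>2 - boundary' x)"
      by (simp add: boundary'_def)
    moreover have "((\<lambda>x. (cmod (ev (trunc_diff M p) x))\<^sup>2 - (real n)\<^sup>2 * (cmod (ev p x))\<^sup>2 - boundary' x)
        has_integral 2 * pi * ip (trunc_diff M p) (trunc_diff M p) - (real n)\<^sup>2 * (2 * pi * ip p p) - 0) {0..2 * pi}"
      unfolding parseval[symmetric]
      by (intro has_integral_diff has_integral_mult_right integral_boundary' integrable_integral
        integrable_continuous_interval continuous_intros)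
    ultimately show ?thesis by (simp add: integral_unique ip_trunc_diff p algebra_simps)
  qed
  finally have "2 * pi * (dip (eta p) (eta p) / (16 * B) - 5 * (real n)\<^sup>2 / B * ip (eta p) (eta p) + B / (4 * pi) * J)
      \<le> 2 * pi * (dip p p - (real n)\<^sup>2 * ip p p)"
    by (simp add: algebra_simps)
  then show ?thesis by (rule mult_left_le_imp_le) simp
qed

text \<open>Amplitude and phase are bounded separately: the first by \<open>eta\<close>, the second
  by the weighted Poincare inequality.\<close>

lemma ip_upper_bound:
  "ip p p \<le> ip (eta p) (eta p) / (4 * B) + (4 / B * (Im (coef (cj phi * p) 0))\<^sup>2 + 8 * pi * B * J)"
proof -
  define Y where "Y = Im (coef (cj phi * p) 0)"
  \<comment> \<open>The mean of the phase component with the density as weight is the quantity that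
    the choice of phase sets to 0.\<close>
  have "integral {0..2 * pi} (\<lambda>x. density x * Im (w x)) = 2 * pi * Y"
  proof -
    have "ev (cj phi * p) integrable_on {0..2 * pi}"
      by (intro integrable_continuous_interval continuous_intros)
    from integral_linear[OF this bounded_linear_Im]
    have "integral {0..2 * pi} (\<lambda>x. Im (ev (cj phi * p) x)) = 2 * pi * Y"
      unfolding integral_ev by (simp add: o_def Y_def)
    moreover have "density x * Im (w x) = Im (ev (cj phi * p) x)" for x
      using density_pos[of x] by (simp add: w_def)
    ultimately show ?thesis by simp
  qed
  then have "(Im (w x))\<^sup>2 \<le> 2 * (2 * pi * Y)\<^sup>2 / (B * (2 * pi - 0))\<^sup>2 + 2 * (2 * pi - 0) * J" if "x \<in> {0..2 * pi}" for x
    unfolding J_def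
    using weighted_poincare[of 0 "2 * pi" "\<lambda>x. Im (w x)" "\<lambda>x. Im (w' x)" density B x] that B_pos density_bounds(1)
      bounded_linear.has_vector_derivative[OF bounded_linear_Im w_deriv]
    by (simp add: has_real_derivative_iff_has_vector_derivative continuous_intros cont)
  then have v: "(Im (w x))\<^sup>2 \<le> 2 / B\<^sup>2 * Y\<^sup>2 + 4 * pi * J" if "x \<in> {0..2 * pi}" for x
    using that by (simp add: power_mult_distrib)
  have "(cmod (ev p x))\<^sup>2 \<le> (2 * density x * Re (w x))\<^sup>2 / (4 * B) + (4 / B * Y\<^sup>2 + 8 * pi * B * J)"
    if "x \<in> {0..2 * pi}" for x
  proof -
    have "density x * (Re (w x))\<^sup>2 * B \<le> density x * (Re (w x))\<^sup>2 * density x"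
      using density_bounds(1)[of x] density_pos[of x] by (intro mult_left_mono) auto
    then have "density x * (Re (w x))\<^sup>2 \<le> (2 * density x * Re (w x))\<^sup>2 / (4 * B)"
      using B_pos by (simp add: field_simps power2_eq_square)
    moreover have "density x * (Im (w x))\<^sup>2 \<le> 2 * B * (2 / B\<^sup>2 * Y\<^sup>2 + 4 * pi * J)"
      using v[OF that] density_bounds(3)[of x] B_pos by (intro mult_mono) auto
    moreover have "2 * B * (2 / B\<^sup>2 * Y\<^sup>2 + 4 * pi * J) = 4 / B * Y\<^sup>2 + 8 * pi * B * J"
      using B_pos by (simp add: distrib_left power2_eq_square)
    ultimately show ?thesis unfolding cmod_p distrib_left by linarith
  qed
  moreover have "((\<lambda>x. (cmod (ev p x))\<^sup>2) has_integral 2 * pi * ip p p) {0..2 * pi}"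
    unfolding parseval[symmetric]
    by (intro integrable_integral integrable_continuous_interval continuous_intros)
  moreover have "((\<lambda>x. (2 * density x * Re (w x))\<^sup>2 / (4 * B) + (4 / B * Y\<^sup>2 + 8 * pi * B * J)) has_integral
      2 * pi * ip (eta p) (eta p) / (4 * B) + 2 * pi * (4 / B * Y\<^sup>2 + 8 * pi * B * J)) {0..2 * pi}"
    unfolding integral_eta[symmetric]
    using has_integral_const_real[of "4 / B * Y\<^sup>2 + 8 * pi * B * J" 0 "2 * pi"]
    by (intro has_integral_add has_integral_divide integrable_integral
          integrable_continuous_interval continuous_intros cont) simp
  ultimately have "2 * pi * ip p p \<le> 2 * pi * (ip (eta p) (eta p) / (4 * B) + (4 / B * Y\<^sup>2 + 8 * pi * B * J))"
    using has_integral_le[of "\<lambda>x. (cmod (ev p x))\<^sup>2"] by (fastforce simp: distrib_left)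
  then show ?thesis unfolding Y_def by (rule mult_left_le_imp_le) simp
qed

end

text \<open>Both sides are diagonal in the Fourier modes, so \<open>spectral\<close> at
  \<open>q = lam * j\<close>, divided by \<open>B\<close>, settles each mode.\<close>

lemma interaction_lower_bound:
  "k\<^sup>2 / B * ip h h \<le> ip (fmult m h) h + lam\<^sup>2 / (16 * B) * dip h h - 5 * k\<^sup>2 / B * ip h h"
proof (rule has_sum_mono)
  let ?c = "\<lambda>j. (cmod (coef h j))\<^sup>2"
  show "((\<lambda>j. k\<^sup>2 / B * ?c j) has_sum k\<^sup>2 / B * ip h h) UNIV"
    by (intro has_sum_cmult_right ip_self_has_sum)
  have "((\<lambda>j. m j * ?c j + lam\<^sup>2 / (16 * B) * ((of_int j)\<^sup>2 * ?c j) + (- (5 * k\<^sup>2 / B)) * ?c j) has_sum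
      (ip (fmult m h) h + lam\<^sup>2 / (16 * B) * dip h h + (- (5 * k\<^sup>2 / B)) * ip h h)) UNIV"
    by (intro has_sum_add has_sum_cmult_right ip_self_has_sum dip_self_has_sum ip_fmult_self_has_sum m_abs)
  then show "((\<lambda>j. m j * ?c j + lam\<^sup>2 / (16 * B) * ((of_int j)\<^sup>2 * ?c j) - 5 * k\<^sup>2 / B * ?c j) has_sum
      (ip (fmult m h) h + lam\<^sup>2 / (16 * B) * dip h h - 5 * k\<^sup>2 / B * ip h h)) UNIV" by simp
  fix j
  have "6 * k\<^sup>2 \<le> (lam * of_int j)\<^sup>2 / 16 + B * m j"
    using spectral[of "lam * of_int j"] by (simp add: m_def)
  then have "k\<^sup>2 / B \<le> (B * m j + lam\<^sup>2 / 16 * (of_int j)\<^sup>2 - 5 * k\<^sup>2) / B"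
    using B_pos by (intro divide_right_mono) (auto simp: power_mult_distrib)
  also have "\<dots> = m j + lam\<^sup>2 / (16 * B) * (of_int j)\<^sup>2 - 5 * k\<^sup>2 / B"
    using B_pos by (simp add: add_divide_distrib diff_divide_distrib)
  finally have "k\<^sup>2 / B \<le> m j + lam\<^sup>2 / (16 * B) * (of_int j)\<^sup>2 - 5 * k\<^sup>2 / B" .
  from mult_right_mono[OF this, of "?c j"]
  show "k\<^sup>2 / B * ?c j \<le> m j * ?c j + lam\<^sup>2 / (16 * B) * ((of_int j)\<^sup>2 * ?c j) - 5 * k\<^sup>2 / B * ?c j"
    by (simp add: algebra_simps)
qed

text \<open>The Hessian vanishes in the direction i times \<open>phi\<close>, the tangent of the
  phase orbit; the added square makes up for this.\<close>

theorem hessian_coercive: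
  obtains c K where "c > 0" "\<And>p. c * (norm p)\<^sup>2 \<le> hessian p + K * (Im (coef (cj phi * p) 0))\<^sup>2"
proof -
  define K0 where "K0 = 1 / (4 * B) + 4 / B + 8 * pi * B"
  define c0 where "c0 = min (k\<^sup>2 / (2 * B)) (lam\<^sup>2 * B / (8 * pi))"
  define D where "D = 25 * ((1 + (real n)\<^sup>2) * (K0 / c0) + 2 / lam\<^sup>2)"
  have K0: "K0 > 0" unfolding K0_def using B_pos by (intro add_pos_pos) auto
  have c0: "c0 > 0" unfolding c0_def using B_pos lam_pos k by simp
  have D: "D > 0"
    unfolding D_def using K0 c0 lam_pos by (intro mult_pos_pos add_pos_pos divide_pos_pos add_pos_nonneg) auto
  \<comment> \<open>The amplitude and phase estimates are available for trigonometric polynomials;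
    the general case follows by density at the end.\<close>
  have trig: "1 / D * (norm p)\<^sup>2 \<le> hessian p + c0 * (Im (coef (cj phi * p) 0))\<^sup>2"
    if p: "trunc M p = p" for M p
  proof -
    define h where "h = eta p"
    define j where "j = J M p"
    define Y where "Y = (Im (coef (cj phi * p) 0))\<^sup>2"
    have nn: "0 \<le> ip h h" "0 \<le> j" "0 \<le> Y"
      using ip_self_nonneg J_nonneg[OF p] by (auto simp: j_def Y_def)
    have "lam\<^sup>2 / 2 * (dip h h / (16 * B) - 5 * (real n)\<^sup>2 / B * ip h h + B / (4 * pi) * j)
        \<le> lam\<^sup>2 / 2 * (dip p p - (real n)\<^sup>2 * ip p p)"
      unfolding h_def j_def by (intro mult_left_mono kinetic_lower_bound[OF p]) simp
    moreover have "lam\<^sup>2 / 2 * (dip h h / (16 * B) - 5 * (real n)\<^sup>2 / B * ip h h + B / (4 * pi) * j)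
        = (lam\<^sup>2 / (16 * B) * dip h h - 5 * (lam * real n)\<^sup>2 / B * ip h h) / 2 + lam\<^sup>2 * B / (8 * pi) * j"
      by (simp add: field_simps power_mult_distrib)
    ultimately have "(lam\<^sup>2 / (16 * B) * dip h h - 5 * k\<^sup>2 / B * ip h h) / 2 + lam\<^sup>2 * B / (8 * pi) * j
        + ip (fmult m h) h / 2 \<le> hessian p"
      unfolding lam_n hessian_def h_def by linarith
    moreover have "c0 * ip h h \<le> k\<^sup>2 / (2 * B) * ip h h" "c0 * j \<le> lam\<^sup>2 * B / (8 * pi) * j"
      using nn by (intro mult_right_mono; simp add: c0_def)+
    moreover have "k\<^sup>2 / (2 * B) * ip h h = k\<^sup>2 / B * ip h h / 2" by simp
    ultimately have "c0 * ip h h + c0 * j \<le> hessian p"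
      using interaction_lower_bound[of h] by argo
    then have le: "c0 * (ip h h + j + Y) \<le> hessian p + c0 * Y" by (simp add: distrib_left)
    have "ip p p \<le> 1 / (4 * B) * ip h h + 4 / B * Y + 8 * pi * B * j"
      using ip_upper_bound[OF p] by (simp add: h_def j_def Y_def)
    also have "\<dots> \<le> K0 * ip h h + K0 * Y + K0 * j"
    proof (intro add_mono mult_right_mono nn)
      have "0 \<le> 1 / (4 * B)" "0 \<le> 4 / B" "0 \<le> 8 * pi * B" using B_pos by auto
      then show "1 / (4 * B) \<le> K0" "4 / B \<le> K0" "8 * pi * B \<le> K0" unfolding K0_def by linarith+
    qed
    also have "\<dots> = K0 / c0 * (c0 * (ip h h + j + Y))" using c0 by (simp add: algebra_simps)
    also have "\<dots> \<le> K0 / c0 * (hessian p + c0 * Y)" using le K0 c0 by (intro mult_left_mono) auto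
    finally have "(1 + (real n)\<^sup>2) * ip p p \<le> (1 + (real n)\<^sup>2) * (K0 / c0 * (hessian p + c0 * Y))"
      by (intro mult_left_mono) auto
    \<comment> \<open>The derivative is read off from the Hessian itself: the interaction part is
      nonnegative, so only \<open>(real n)^2 * ip p p\<close> is missing, and that has just been
      bounded.\<close>
    moreover have "dip p p \<le> (real n)\<^sup>2 * ip p p + 2 / lam\<^sup>2 * (hessian p + c0 * Y)"
    proof -
      have "0 \<le> ip (fmult m h) h"
        by (rule has_sum_nonneg[OF ip_fmult_self_has_sum[OF m_abs]]) (simp add: m_nonneg)
      moreover have "0 \<le> c0 * Y" using c0 nn by simp
      ultimately have "lam\<^sup>2 / 2 * (dip p p - (real n)\<^sup>2 * ip p p) \<le> hessian p + c0 * Y"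
        unfolding hessian_def h_def by linarith
      from mult_left_mono[OF this, of "2 / lam\<^sup>2"]
      have "2 / lam\<^sup>2 * (lam\<^sup>2 / 2 * (dip p p - (real n)\<^sup>2 * ip p p)) \<le> 2 / lam\<^sup>2 * (hessian p + c0 * Y)"
        by simp
      also have "2 / lam\<^sup>2 * (lam\<^sup>2 / 2 * (dip p p - (real n)\<^sup>2 * ip p p)) = dip p p - (real n)\<^sup>2 * ip p p"
        using lam_pos by simp
      finally show ?thesis by linarith
    qed
    ultimately have "(norm p)\<^sup>2 \<le> D * (hessian p + c0 * Y)"
      unfolding norm_h1_eq_ip D_def distrib_right by argo
    then show ?thesis using D by (simp add: field_simps Y_def)
  qed
  have "1 / D * (norm p)\<^sup>2 \<le> hessian p + c0 * (Im (coef (cj phi * p) 0))\<^sup>2" for p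
  proof (rule tendsto_le[OF sequentially_bot])
    note t = trunc_tendsto[of p]
    have te: "(\<lambda>N. eta (trunc N p)) \<longlonglongrightarrow> eta p"
      unfolding eta_def by (intro tendsto_intros bounded_linear.tendsto[OF bounded_linear_cj] t)
    show "(\<lambda>N. 1 / D * (norm (trunc N p))\<^sup>2) \<longlonglongrightarrow> 1 / D * (norm p)\<^sup>2"
      by (intro tendsto_intros t)
    show "(\<lambda>N. hessian (trunc N p) + c0 * (Im (coef (cj phi * trunc N p) 0))\<^sup>2)
        \<longlonglongrightarrow> hessian p + c0 * (Im (coef (cj phi * p) 0))\<^sup>2"
      unfolding hessian_def
      by (intro tendsto_intros ip.tendsto dip.tendsto R.tendsto te t bounded_linear.tendsto[OF bounded_linear_coef]) simp
    have "trunc N (trunc N p) = trunc N p" for N by (rule h1_eqI) simp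
    then show "\<forall>\<^sub>F N in sequentially. 1 / D * (norm (trunc N p))\<^sup>2
        \<le> hessian (trunc N p) + c0 * (Im (coef (cj phi * trunc N p) 0))\<^sup>2"
      by (intro always_eventually allI trig)
  qed
  then show ?thesis using that[of "1 / D" c0] D by simp
qed

end

section \<open>Orbital stability\<close>

context gp_wave
begin

text \<open>The subtracted constant is \<open>omega\<close> at \<open>\<alpha> = 1\<close>:
  \<open>A_m\<close> turns \<open>- V0 / (2 * beta)\<close> into \<open>A / 2\<close>, the symbol at
  \<open>2 * n\<close> being beta.\<close>

definition action :: "h1 \<Rightarrow> real" where
  "action a = energy a - (k\<^sup>2 / 2 + V0 / 2 + B + A / 2) * ip a a"

lemma m_0: "m 0 = 1"
  using admissible_zeta_cos_sin(6)[OF \<zeta>] by (simp add: m_def)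

text \<open>Apart from the mean, only the modes plus or minus 2 n occur. There the density of
  \<open>phi\<close> has the coefficient \<open>- A / 4\<close> and the potential
  \<open>- V0 / 4\<close>, and by \<open>A_m\<close> they cancel once the density is multiplied by
  the symbol.\<close>

lemma effective_potential: "V + fmult m (phi * cj phi) = mon 0 (of_real (V0 / 2 + B + A / 2))"
proof (rule h1_eqI)
  fix j
  define s d where "s = (sqrt B + sqrt (B + A)) / 2" and "d = (sqrt B - sqrt (B + A)) / 2"
  have sq: "sqrt B * sqrt B = B" "sqrt (B + A) * sqrt (B + A) = B + A" using B_pos A_nonneg by simp_all
  have sd: "s * s + d * d = B + A / 2" "s * d = - A / 4"
    using sq by (simp_all add: s_def d_def field_simps)
  have "phi * cj phi = mon 0 (of_real (s * s + d * d)) + mon (2 * int n) (of_real (s * d)) + mon (- (2 * int n)) (of_real (s * d))"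
    unfolding phi_def s_def[symmetric] d_def[symmetric]
    by (simp add: distrib_left distrib_right mon_linear_simps mult.commute)
  then have "coef (V + fmult m (phi * cj phi)) j = coef V j + of_real (m j) * coef (mon 0 (of_real (B + A / 2)) + mon (2 * int n) (of_real (- A / 4)) + mon (- (2 * int n)) (of_real (- A / 4))) j"
    by (simp only: sd coef_simps coef_R)
  moreover have "m (2 * int n) * A = - V0" "m (- (2 * int n)) * A = - V0"
    using A_m m_even[of "2 * int n"] by (simp_all add: mult.commute)
  then have "complex_of_real (m (2 * int n)) * of_real A = - of_real V0"
    "complex_of_real (m (- (2 * int n))) * of_real A = - of_real V0"
    by (metis of_real_minus of_real_mult)+
  ultimately show "coef (V + fmult m (phi * cj phi)) j = coef (mon 0 (of_real (V0 / 2 + B + A / 2))) j"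
    using n by (auto simp: V_def m_0)
qed

lemma lam_n_square: "lam\<^sup>2 * (real n)\<^sup>2 = k\<^sup>2"
  by (simp only: lam_n flip: power_mult_distrib)

lemma dip_phi: "lam\<^sup>2 * dip phi p = k\<^sup>2 * ip phi p"
proof -
  have "(of_int j)\<^sup>2 * Re (coef phi j * cnj (coef p j)) = (real n)\<^sup>2 * Re (coef phi j * cnj (coef p j))" for j
  proof (cases "j = int n \<or> j = - int n")
    case True
    then have "(real_of_int j)\<^sup>2 = (real n)\<^sup>2" by auto
    then show ?thesis by simp
  qed (simp add: phi_def)
  then have "((\<lambda>j. (real n)\<^sup>2 * Re (coef phi j * cnj (coef p j))) has_sum dip phi p) UNIV"
    using dip_has_sum[of phi p] by (simp only:)
  then have "dip phi p = (real n)\<^sup>2 * ip phi p"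
    using has_sum_cmult_right[OF ip_has_sum[of phi p], of "(real n)\<^sup>2"] has_sum_unique by blast
  then show ?thesis by (simp add: lam_n_square flip: mult.assoc)
qed

lemma ip_real_eta:
  assumes "cj x = x"
  shows "ip x (eta p) = 2 * ip (x * phi) p"
proof -
  have "ip x (phi * cj p) = ip (x * phi) p"
    using coef_cj_0[of "x * (phi * cj p)"] assms by (simp add: ip_def mult_ac del: coef_cj)
  moreover have "ip x (cj phi * p) = ip (x * phi) p"
    by (simp add: ip_def mult_ac)
  ultimately show ?thesis by (simp add: eta_def ip.add_right)
qed

lemma ip_real_density: "ip x (p * cj p) = ip (x * p) p"
  by (simp add: ip_def mult_ac)

text \<open>An exact identity, the energy being quartic. The terms linear in \<open>p\<close>
  cancel: \<open>dip_phi\<close> matches the kinetic part with \<open>k^2\<close>, the constant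
  effective potential matches the rest. The same constant also removes the potential from the
  quadratic terms.\<close>

lemma action_expansion:
  "action (phi + p) - action phi
     = hessian p + ip (fmult m (eta p)) (p * cj p) + ip (fmult m (p * cj p)) (p * cj p) / 2"
proof -
  define e q r where "e = eta p" and "q = p * cj p" and "r = phi * cj phi"
  define c where "c = V0 / 2 + B + A / 2"
  have rho: "(phi + p) * cj (phi + p) = r + e + q"
    by (simp add: e_def q_def r_def eta_def algebra_simps)
  have rr: "cj (fmult m r) = fmult m r" by (simp add: r_def cj_R mult.commute)
  have sym: "ip (fmult m x) y = ip (fmult m y) x" for x y
    by (simp only: ip_R[of x] ip_commute[of x])
  have quart: "ip (fmult m (r + e + q)) (r + e + q)
      = ip (fmult m r) r + ip (fmult m e) e + ip (fmult m q) q
        + 2 * ip (fmult m r) e + 2 * ip (fmult m r) q + 2 * ip (fmult m e) q"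
    using sym[of e r] sym[of q r] sym[of q e]
    by (simp add: R.add ip.add_left ip.add_right)
  have re: "ip (fmult m r) e = 2 * ip (fmult m r * phi) p" unfolding e_def by (rule ip_real_eta[OF rr])
  have rq: "ip (fmult m r) q = ip (fmult m r * p) p" unfolding q_def by (rule ip_real_density)
  have Vs: "ip (V * p) phi = ip (V * phi) p"
    by (simp only: ip_mult_left[of V p] V_real ip_commute[of p])
  have cst: "ip (mon 0 (of_real s) * x) y = s * ip x y" for s x y
  proof -
    have "mon 0 (of_real s) * x = s *\<^sub>R x" by (rule h1_eqI) (simp add: scaleR_conv_of_real)
    then show ?thesis by (simp add: ip.scaleR_left)
  qed
  have pot: "ip (V * x) y + ip (fmult m r * x) y = c * ip x y" for x y
    unfolding cst[symmetric] c_def effective_potential[symmetric] r_def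
    by (simp add: distrib_right ip.add_left)
  have "energy (phi + p) = (lam\<^sup>2 / 2 * dip phi phi + lam\<^sup>2 * dip phi p + lam\<^sup>2 / 2 * dip p p)
      + (ip (V * phi) phi + 2 * ip (V * phi) p + ip (V * p) p)
      + (ip (fmult m r) r + ip (fmult m e) e + ip (fmult m q) q
        + 4 * ip (fmult m r * phi) p + 2 * ip (fmult m r * p) p + 2 * ip (fmult m e) q) / 2"
    unfolding energy_def rho quart re rq
    by (simp add: distrib_left dip.add_left dip.add_right ip.add_left ip.add_right Vs dip_commute[of p phi])
  moreover have "energy phi = lam\<^sup>2 / 2 * dip phi phi + ip (V * phi) phi + ip (fmult m r) r / 2"
    by (simp add: energy_def r_def)
  moreover have "action (phi + p) - action phi = energy (phi + p) - energy phi
      - (k\<^sup>2 * ip phi p + k\<^sup>2 / 2 * ip p p) - (2 * (c * ip phi p) + c * ip p p)"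
    by (simp add: action_def c_def ip.add_left ip.add_right ip_commute[of p phi] algebra_simps)
  moreover have "hessian p = lam\<^sup>2 / 2 * dip p p - k\<^sup>2 / 2 * ip p p + ip (fmult m e) e / 2"
    unfolding lam_n_square[symmetric] hessian_def e_def by (simp add: algebra_simps)
  ultimately show ?thesis
    using pot[of phi p] pot[of p p] dip_phi[of p]
    unfolding e_def[symmetric] q_def[symmetric] by argo
qed

text \<open>The quartic remainder is nonnegative and is dropped, so only the cubic term has to be
  paid for.\<close>

lemma action_lower_bound:
  obtains c K where "c > 0" "K > 0"
    "\<And>p. Im (coef (cj phi * p) 0) = 0 \<Longrightarrow> c * (norm p)\<^sup>2 - K * (norm p) ^ 3 \<le> action (phi + p) - action phi"
proof -
  obtain c K0 where c: "c > 0" "\<And>p. c * (norm p)\<^sup>2 \<le> hessian p + K0 * (Im (coef (cj phi * p) 0))\<^sup>2"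
    using hessian_coercive by metis
  define K where "K = 2 * norm phi + 1"
  have "c * (norm p)\<^sup>2 - K * (norm p) ^ 3 \<le> action (phi + p) - action phi"
    if "Im (coef (cj phi * p) 0) = 0" for p
  proof -
    have "norm (eta p) \<le> 2 * norm phi * norm p"
      unfolding eta_def
      using norm_triangle_ineq[of "cj phi * p" "phi * cj p"] norm_mult_ineq[of "cj phi" p] norm_mult_ineq[of phi "cj p"]
      by simp
    moreover have "norm (p * cj p) \<le> (norm p)\<^sup>2"
      using norm_mult_ineq[of p "cj p"] by (simp add: power2_eq_square)
    ultimately have "norm (fmult m (eta p)) * norm (p * cj p) \<le> (2 * norm phi * norm p) * (norm p)\<^sup>2"
      using norm_R_le[of "eta p"] by (intro mult_mono) auto
    then have "\<bar>ip (fmult m (eta p)) (p * cj p)\<bar> \<le> (2 * norm phi * norm p) * (norm p)\<^sup>2"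
      using ip_le order_trans by blast
    also have "\<dots> \<le> K * (norm p) ^ 3"
      by (simp add: K_def power3_eq_cube power2_eq_square distrib_right)
    finally have "- (K * (norm p) ^ 3) \<le> ip (fmult m (eta p)) (p * cj p)" by linarith
    moreover have "0 \<le> ip (fmult m (p * cj p)) (p * cj p)"
      by (rule has_sum_nonneg[OF ip_fmult_self_has_sum[OF m_abs]]) (simp add: m_nonneg)
    ultimately show ?thesis using c(2)[of p] that by (simp add: action_expansion)
  qed
  moreover have "K > 0" using norm_ge_zero[of phi] unfolding K_def by linarith
  ultimately show ?thesis using that c(1) by blast
qed

lemma action_phase:
  assumes "cmod u = 1"
  shows "action (mon 0 u * a) = action a"
proof -
  note u = cst_cnj_cst_mult[OF assms]
  have ip: "ip (mon 0 u * x) (mon 0 u * y) = ip x y" for x y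
    using u[of y] by (simp add: ip_mult_left)
  have "mon 0 u * a * cj (mon 0 u * a) = mon 0 (cnj u) * (mon 0 u * (a * cj a))"
    by (simp add: mult_ac del: mon_mult)
  then have "mon 0 u * a * cj (mon 0 u * a) = a * cj a" unfolding u .
  moreover have "ip (V * (mon 0 u * a)) (mon 0 u * a) = ip (V * a) a"
    by (simp only: mult.left_commute[of V] ip)
  moreover have "dip (mon 0 u * a) (mon 0 u * a) = dip a a" unfolding dip_cst_mult u ..
  ultimately show ?thesis by (simp add: action_def energy_def ip)
qed

definition orbit :: "h1 set" where
  "orbit = (\<lambda>\<theta>. mon 0 (cis \<theta>) * phi) ` {0..<2 * pi}"

lemma unit_mult_phi_orbit:
  assumes "cmod u = 1"
  shows "mon 0 u * phi \<in> orbit"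
proof -
  have "u = cis (Arg2pi u)" using Arg2pi[of u] assms by (simp add: is_Arg_def cis_conv_exp)
  then show ?thesis using Arg2pi[of u] unfolding orbit_def by (metis atLeastLessThan_iff imageI)
qed

lemma phi_in_orbit: "phi \<in> orbit"
  using unit_mult_phi_orbit[of 1] by (simp flip: one_h1_def)

lemma dist_orbit_obtain:
  assumes "infdist a orbit < r"
  obtains \<theta> where "\<theta> \<in> {0..<2 * pi}" "norm (a - mon 0 (cis \<theta>) * phi) < r"
proof -
  have "(INF x\<in>orbit. dist a x) < r" using assms phi_in_orbit by (simp add: infdist_def split: if_splits)
  then obtain x where "x \<in> orbit" "dist a x < r"
    using phi_in_orbit by (subst (asm) cINF_less_iff) (auto intro: bdd_belowI2[of _ 0])
  then show ?thesis using that by (auto simp: orbit_def dist_norm)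
qed

lemma ip_phi_pos: "0 < ip phi phi"
proof -
  have "0 < (sqrt B + sqrt (B + A)) / 2" using B_pos A_nonneg by (simp add: add_pos_nonneg)
  moreover have "coef phi (int n) = of_real ((sqrt B + sqrt (B + A)) / 2)" using n by (simp add: phi_def)
  ultimately have "0 < (cmod (coef phi (int n)))\<^sup>2" by (simp only: norm_of_real) simp
  also have "\<dots> \<le> ip phi phi"
    using has_sum_mono2[OF has_sum_finite[of "{int n}" "\<lambda>j. (cmod (coef phi j))\<^sup>2"] ip_self_has_sum[of phi]] by simp
  finally show ?thesis .
qed

text \<open>
  The phase is fixed by \<open>Im \<langle>\<phi>\<^sub>\<omega>, a\<rangle> = 0\<close>, which removes the one neutral direction of the Hessian.
\<close>

lemma phase_normalisation:
  obtains r K where "r > 0" "K > 0" "\<And>b. norm b \<le> r \<Longrightarrow>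
    \<exists>u p. cmod u = 1 \<and> mon 0 u * (phi + b) = phi + p \<and> norm p \<le> K * norm b \<and> Im (coef (cj phi * p) 0) = 0"
proof -
  define N where "N = ip phi phi"
  have N: "N > 0" unfolding N_def by (rule ip_phi_pos)
  \<comment> \<open>\<open>r\<close> keeps the perturbation of the pairing with \<open>phi\<close>
    at most half of its unperturbed value \<open>N\<close>, so the pairing \<open>z\<close> is
    nonzero and its phase can be removed.\<close>
  define r where "r = N / (2 * (norm phi + 1))"
  define K where "K = 1 + 4 * (norm phi)\<^sup>2 / N"
  have r: "r > 0" unfolding r_def using N by (intro divide_pos_pos mult_pos_pos add_nonneg_pos) auto
  have K: "K > 0" unfolding K_def using N by (intro add_pos_nonneg) auto
  have "\<exists>u p. cmod u = 1 \<and> mon 0 u * (phi + b) = phi + p \<and> norm p \<le> K * norm b \<and> Im (coef (cj phi * p) 0) = 0"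
    if b: "norm b \<le> r" for b
  proof -
    define z1 where "z1 = coef (cj phi * b) 0"
    define z where "z = coef (cj phi * (phi + b)) 0"
    have phi0: "coef (cj phi * phi) 0 = of_real N"
    proof -
      have "coef (phi * cj phi) 0 = cnj (coef (phi * cj phi) 0)"
        using coef_cj_0[of "phi * cj phi"] by (simp add: mult.commute del: coef_cj)
      then show ?thesis by (simp add: N_def ip_def complex_eq_iff mult.commute)
    qed
    have z: "z = of_real N + z1" by (simp add: z_def z1_def distrib_left phi0)
    have z1: "cmod z1 \<le> norm phi * norm b"
      unfolding z1_def using cmod_coef_le_norm[of "cj phi * b" 0] norm_mult_ineq[of "cj phi" b] by simp
    also have "\<dots> \<le> (norm phi + 1) * r" using b by (intro mult_mono) auto
    also have "\<dots> = N / 2"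
    proof -
      have "x * (N / (2 * x)) = N / 2" if "x \<noteq> 0" for x using that by simp
      moreover have "norm phi + 1 \<noteq> 0" using norm_ge_zero[of phi] by linarith
      ultimately show ?thesis unfolding r_def by blast
    qed
    finally have z1N: "cmod z1 \<le> N / 2" .
    have zN: "N / 2 \<le> cmod z"
      using norm_diff_ineq[of "of_real N" z1] z1N N by (simp add: z)
    then have z0: "z \<noteq> 0" using N by auto
    \<comment> \<open>The rotation that makes the pairing with \<open>phi\<close> real and
      positive.\<close>
    define u where "u = cnj (sgn z)"
    have u1: "cmod u = 1" using z0 by (simp add: u_def norm_sgn)
    have uz: "u * z = of_real (cmod z)"
      using z0 complex_norm_square[of z] by (simp add: u_def sgn_div_norm scaleR_conv_of_real divide_simps power2_eq_square mult.commute)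
    define p where "p = mon 0 u * (phi + b) - phi"
    have "coef (cj phi * p) 0 = u * z - of_real N"
    proof -
      have "cj phi * p = mon 0 u * (cj phi * (phi + b)) - cj phi * phi"
        by (simp add: p_def algebra_simps)
      then show ?thesis by (simp add: z_def phi0)
    qed
    then have "Im (coef (cj phi * p) 0) = 0" by (simp add: uz)
    moreover have "norm p \<le> K * norm b"
    proof -
      have "cmod (u - 1) * cmod z = cmod (u * z - z)"
        by (simp add: norm_mult[symmetric] algebra_simps)
      also have "u * z - z = (of_real (cmod z) - of_real N) - z1"
        unfolding uz using z by (simp add: diff_diff_eq)
      also have "cmod \<dots> \<le> cmod (of_real (cmod z) - of_real N) + cmod z1"
        by (rule norm_triangle_ineq4)
      also have "cmod (of_real (cmod z) - of_real N) = \<bar>cmod z - cmod (of_real N)\<bar>"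
        using N by (simp flip: of_real_diff)
      also have "\<dots> \<le> cmod z1"
        using norm_triangle_ineq3[of z "of_real N"] z by simp
      finally have "cmod (u - 1) * (N / 2) \<le> 2 * cmod z1"
        using mult_left_mono[OF zN, of "cmod (u - 1)"] by simp
      then have u_le: "cmod (u - 1) \<le> 4 * (norm phi * norm b) / N" using N z1 by (simp add: field_simps)
      have "p = mon 0 u * b + mon 0 (u - 1) * phi"
        by (rule h1_eqI) (simp add: p_def distrib_left left_diff_distrib)
      then have "norm p \<le> norm b + cmod (u - 1) * norm phi"
        using norm_triangle_ineq[of "mon 0 u * b" "mon 0 (u - 1) * phi"] by (simp add: norm_cst_mult u1)
      also have "\<dots> \<le> norm b + 4 * (norm phi * norm b) / N * norm phi"
        by (intro add_left_mono mult_right_mono u_le) simp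
      also have "\<dots> = K * norm b" by (simp add: K_def power2_eq_square algebra_simps)
      finally show ?thesis .
    qed
    ultimately show ?thesis using u1 by (intro exI[of _ u] exI[of _ p]) (simp add: p_def)
  qed
  then show ?thesis using that r K by blast
qed

lemma orbit_coercive:
  obtains r c where "r > 0" "c > 0" "\<And>a. infdist a orbit < r \<Longrightarrow> c * (infdist a orbit)\<^sup>2 \<le> action a - action phi"
proof -
  obtain c K where c: "c > 0" "K > 0" and lower:
    "\<And>p. Im (coef (cj phi * p) 0) = 0 \<Longrightarrow> c * (norm p)\<^sup>2 - K * (norm p) ^ 3 \<le> action (phi + p) - action phi"
    using action_lower_bound by metis
  obtain r0 K1 where r0: "r0 > 0" "K1 > 0" and norml: "\<And>b. norm b \<le> r0 \<Longrightarrow>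
    \<exists>u p. cmod u = 1 \<and> mon 0 u * (phi + b) = phi + p \<and> norm p \<le> K1 * norm b \<and> Im (coef (cj phi * p) 0) = 0"
    using phase_normalisation by metis
  \<comment> \<open>Within this radius the normalised perturbation satisfies
    \<open>K * norm p <= c / 2\<close>, so the cubic term takes at most half of the quadratic
    one.\<close>
  define r where "r = min r0 (c / (2 * K * K1))"
  have r: "r > 0" using r0 c by (simp add: r_def)
  have "c / 2 * (infdist a orbit)\<^sup>2 \<le> action a - action phi" if a: "infdist a orbit < r" for a
  proof -
    obtain \<theta> where \<theta>: "norm (a - mon 0 (cis \<theta>) * phi) < r" using dist_orbit_obtain[OF a] by blast
    define b where "b = mon 0 (cis (- \<theta>)) * a - phi"
    have "b = mon 0 (cis (- \<theta>)) * (a - mon 0 (cis \<theta>) * phi)"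
      using cst_cnj_cst_mult[of "cis \<theta>" phi] by (simp add: b_def right_diff_distrib cis_cnj)
    then have nb: "norm b < r" using \<theta> by (simp add: norm_cst_mult)
    then obtain u p where u: "cmod u = 1" "mon 0 u * (phi + b) = phi + p" "norm p \<le> K1 * norm b"
      "Im (coef (cj phi * p) 0) = 0"
      using norml[of b] by (auto simp: r_def)
    define v where "v = u * cis (- \<theta>)"
    have v: "cmod v = 1" by (simp add: v_def norm_mult u(1))
    have va: "mon 0 v * a = phi + p"
      using u(2) by (simp add: v_def b_def mult.assoc[symmetric])
    have "K * norm p \<le> c / 2"
    proof -
      have "K * norm p \<le> K * (K1 * (c / (2 * K * K1)))"
        using u(3) nb c r0 by (intro mult_left_mono order_trans[OF u(3)]) (auto simp: r_def)
      then show ?thesis using c r0 by simp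
    qed
    then have "K * (norm p) ^ 3 \<le> c / 2 * (norm p)\<^sup>2"
      using mult_right_mono[of "K * norm p" "c / 2" "(norm p)\<^sup>2"] by (simp add: power3_eq_cube power2_eq_square mult.assoc)
    then have "c / 2 * (norm p)\<^sup>2 \<le> action (phi + p) - action phi"
      using lower[OF u(4)] by (simp add: field_simps)
    also have "action (phi + p) = action a" unfolding va[symmetric] by (rule action_phase[OF v])
    finally have "c / 2 * (norm p)\<^sup>2 \<le> action a - action phi" .
    moreover have "infdist a orbit \<le> norm p"
    proof (rule infdist_le2[OF unit_mult_phi_orbit[of "cnj v"]])
      have "a = mon 0 (cnj v) * (phi + p)" using cst_cnj_cst_mult[OF v, of a] unfolding va by simp
      then have "a - mon 0 (cnj v) * phi = mon 0 (cnj v) * p" by (simp add: distrib_left)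
      then show "dist a (mon 0 (cnj v) * phi) \<le> norm p" by (simp add: dist_norm norm_cst_mult v)
    qed (simp add: v)
    then have "c / 2 * (infdist a orbit)\<^sup>2 \<le> c / 2 * (norm p)\<^sup>2"
      using c infdist_nonneg by (intro mult_left_mono power_mono) auto
    ultimately show ?thesis by linarith
  qed
  then show ?thesis using that[of r "c / 2"] r c by simp
qed

lemma evolves_subset: "evolves I a \<Longrightarrow> I' \<subseteq> I \<Longrightarrow> evolves I' a"
  unfolding evolves_def
  by (meson continuous_on_subset has_vector_derivative_within_subset subsetD)

text \<open>A barrier argument: to leave, the distance to the orbit must take the value
  \<open>r\<close>, where coercivity demands an action at least \<open>c * r^2\<close> above that of
  the orbit, more than the conserved initial excess.\<close>

theorem orbit_stable:
  assumes "\<rho> > 0"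
  obtains \<delta> where "\<delta> > 0"
    "\<And>a t. evolves {0..} a \<Longrightarrow> norm (a 0 - phi) < \<delta> \<Longrightarrow> t \<ge> 0 \<Longrightarrow> infdist (a t) orbit < \<rho>"
proof -
  obtain r0 c where r0: "r0 > 0" "c > 0"
    and coer: "\<And>a. infdist a orbit < r0 \<Longrightarrow> c * (infdist a orbit)\<^sup>2 \<le> action a - action phi"
    using orbit_coercive by metis
  \<comment> \<open>Halving \<open>r0\<close> makes coercivity available at distance exactly
    \<open>r\<close>.\<close>
  define r where "r = min \<rho> (r0 / 2)"
  have r: "0 < r" "r \<le> \<rho>" "r < r0" using assms r0 by (auto simp: r_def)
  have "(action \<longlongrightarrow> action phi) (at phi)"
    unfolding action_def by (intro tendsto_intros ip.tendsto)
  then have "\<forall>\<^sub>F a in at phi. dist (action a) (action phi) < c * r\<^sup>2"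
    by (rule tendstoD) (use r r0 in auto)
  then obtain d where d: "d > 0" "\<And>a. a \<noteq> phi \<Longrightarrow> dist a phi < d \<Longrightarrow> dist (action a) (action phi) < c * r\<^sup>2"
    unfolding eventually_at by auto
  have "infdist (a t) orbit < \<rho>" if a: "evolves {0..} a" "norm (a 0 - phi) < min d r" "t \<ge> 0" for a t
  proof (rule ccontr)
    assume "\<not> infdist (a t) orbit < \<rho>"
    then have "r \<le> infdist (a t) orbit" using r by simp
    moreover have "infdist (a 0) orbit \<le> r"
      by (rule infdist_le2[OF phi_in_orbit]) (use a(2) in \<open>simp add: dist_norm\<close>)
    moreover have "continuous_on {0..t} a"
      by (rule continuous_on_subset[of "{0..}"]) (use a(1) in \<open>auto simp: evolves_def\<close>)
    then have "continuous_on {0..t} (\<lambda>s. infdist (a s) orbit)" by (rule continuous_on_infdist)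
    ultimately obtain s where s: "0 \<le> s" "s \<le> t" "infdist (a s) orbit = r"
      using IVT'[of "\<lambda>s. infdist (a s) orbit" 0 r t] a(3) by blast
    have "evolves {0..s} a" by (rule evolves_subset[OF a(1)]) auto
    then have "action (a s) = action (a 0)"
      using energy_mass_conserved[OF s(1)] by (simp add: action_def)
    moreover have "c * r\<^sup>2 \<le> action (a s) - action phi" using coer[of "a s"] s(3) r(3) by simp
    moreover have "action (a 0) - action phi < c * r\<^sup>2"
      using d(2)[of "a 0"] a(2) r r0 by (cases "a 0 = phi") (auto simp: dist_norm dist_real_def)
    ultimately show False by simp
  qed
  then show ?thesis using that[of "min d r"] d(1) r(1) by auto
qed

lemma orbitally_stable_if_profile:
  assumes \<phi>: "\<And>x. \<phi> x = ev phi (lam * x)"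
  shows "orbitally_stable T 1 \<epsilon> \<zeta> (gp_potential V0 k) \<phi>"
  unfolding orbitally_stable_def
proof (intro allI impI)
  fix \<rho> :: real assume "\<rho> > 0"
  define C where "C = max 1 lam"
  have C: "C > 0" by (simp add: C_def)
  define D where "D = 5 * max 1 (1 / lam)"
  have D: "D > 0" by (simp add: D_def)
  \<comment> \<open>The target is halved because a supremum of values below a bound may attain it,
    while the definition asks for strict inequality; \<open>C\<close> converts the \<open>h1\<close>
    norm into that for period \<open>T\<close>.\<close>
  obtain \<delta> where \<delta>: "\<delta> > 0"
    "\<And>a t. evolves {0..} a \<Longrightarrow> norm (a 0 - phi) < \<delta> \<Longrightarrow> t \<ge> 0 \<Longrightarrow> infdist (a t) orbit < \<rho> / (2 * C)"
    by (rule orbit_stable[of "\<rho> / (2 * C)"]) (use \<open>\<rho> > 0\<close> C in auto)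
  have \<phi>': "\<phi> = (\<lambda>x. ev phi (lam * x))" by (rule ext) (rule \<phi>)
  have mem: "\<phi> \<in> sobolev_space 1 T" unfolding \<phi>' by (rule ev_scaled_mem[OF T_pos lam_T])
  let ?d = "\<lambda>\<psi> t. INF c\<in>{0..<2 * pi}. ereal (sobolev_norm 1 T (\<lambda>x. \<psi> t x - \<phi> x * exp (\<i> * of_real c)))"
  show "\<exists>\<delta>>0. \<forall>\<psi>0\<in>sobolev_space 1 T. sobolev_norm 1 T (\<lambda>x. \<psi>0 x - \<phi> x) < \<delta> \<longrightarrow>
        (\<exists>\<psi>. gp_solution T 1 \<epsilon> \<zeta> (gp_potential V0 k) \<psi>0 \<psi>) \<and>
        (\<forall>\<psi>. gp_solution T 1 \<epsilon> \<zeta> (gp_potential V0 k) \<psi>0 \<psi> \<longrightarrow>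
           (SUP t\<in>{0<..}. ?d \<psi> t) < ereal \<rho>)"
  proof (intro exI[of _ "\<delta> / D"] conjI ballI impI allI)
    show "0 < \<delta> / D" using \<delta>(1) D by simp
    fix \<psi>0 assume \<psi>0: "\<psi>0 \<in> sobolev_space 1 T" and close: "sobolev_norm 1 T (\<lambda>x. \<psi>0 x - \<phi> x) < \<delta> / D"
    show "\<exists>\<psi>. gp_solution T 1 \<epsilon> \<zeta> (gp_potential V0 k) \<psi>0 \<psi>" by (rule gp_solution_exists[OF \<psi>0])
    fix \<psi> assume sol: "gp_solution T 1 \<epsilon> \<zeta> (gp_potential V0 k) \<psi>0 \<psi>"
    define a where "a t = fourier_h1 T (\<psi> t)" for t
    have smem: "\<psi> t \<in> sobolev_space 1 T" if "t \<ge> 0" for t using sol that by (simp add: gp_solution_def)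
    have ev: "evolves {0..} a" unfolding a_def[abs_def] by (rule gp_solution_evolves[OF sol])
    have "a 0 = fourier_h1 T \<psi>0"
      unfolding a_def using sol by (intro fourier_h1_cong_AE smem \<psi>0) (auto simp: gp_solution_def)
    moreover have "fourier_h1 T \<phi> = phi" unfolding \<phi>' by (rule fourier_h1_ev_scaled[OF T_pos lam_T])
    ultimately have "norm (a 0 - phi) \<le> D * sobolev_norm 1 T (\<lambda>x. \<psi>0 x - \<phi> x)"
      using sobolev_norm_diff(1)[OF T_pos lam_T \<psi>0 mem] by (simp add: D_def)
    also have "\<dots> < \<delta>" using close D by (simp add: field_simps)
    finally have near: "norm (a 0 - phi) < \<delta>" .
    have "?d \<psi> t \<le> ereal (\<rho> / 2)"
      if t: "t \<in> {0<..}" for t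
    proof -
      have t0: "t \<ge> 0" using t by simp
      obtain \<theta> where \<theta>: "\<theta> \<in> {0..<2 * pi}" "norm (a t - mon 0 (cis \<theta>) * phi) < \<rho> / (2 * C)"
        by (rule dist_orbit_obtain[OF \<delta>(2)[OF ev near t0]])
      have e: "(\<lambda>x. \<phi> x * exp (\<i> * of_real \<theta>)) = (\<lambda>x. ev (mon 0 (cis \<theta>) * phi) (lam * x))"
        by (simp add: \<phi> cis_conv_exp mult.commute fun_eq_iff)
      have "sobolev_norm 1 T (\<lambda>x. \<psi> t x - ev (mon 0 (cis \<theta>) * phi) (lam * x)) \<le> C * norm (a t - mon 0 (cis \<theta>) * phi)"
        using sobolev_norm_diff(2)[OF T_pos lam_T smem[OF t0] ev_scaled_mem[OF T_pos lam_T]]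
        unfolding fourier_h1_ev_scaled[OF T_pos lam_T] C_def a_def .
      also have "\<dots> \<le> C * (\<rho> / (2 * C))" using \<theta>(2) C by (intro mult_left_mono) auto
      also have "\<dots> = \<rho> / 2" using C by simp
      finally have "sobolev_norm 1 T (\<lambda>x. \<psi> t x - \<phi> x * exp (\<i> * of_real \<theta>)) \<le> \<rho> / 2"
        using fun_cong[OF e] by simp
      then show ?thesis using \<theta>(1) by (intro INF_lower2[of \<theta>]) auto
    qed
    then have "(SUP t\<in>{0<..}. ?d \<psi> t) \<le> ereal (\<rho> / 2)"
      by (rule SUP_least)
    also have "\<dots> < ereal \<rho>" using \<open>\<rho> > 0\<close> by simp
    finally show "(SUP t\<in>{0<..}. ?d \<psi> t) < ereal \<rho>" .
  qed
qed

end

text \<open>Dominated convergence makes the transform continuous, and a positive continuous function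
  has a positive minimum on a compact interval.\<close>

lemma zeta_transform_lower_bound:
  assumes \<zeta>: "admissible_zeta \<zeta>"
  obtains c where "c > 0" "\<And>q. \<bar>q\<bar> \<le> Q \<Longrightarrow> c \<le> (LINT v|lborel. \<zeta> v * cos (q * v))"
proof -
  define F where "F q = (LINT v|lborel. \<zeta> v * cos (q * v))" for q
  note iz = admissible_zeta_cos_sin(5)[OF \<zeta>]
  have mz: "\<zeta> \<in> borel_measurable borel" using borel_measurable_integrable[OF iz] by simp
  have "continuous_on {- \<bar>Q\<bar>..\<bar>Q\<bar>} F"
  proof (rule continuous_on_sequentiallyI)
    fix u :: "nat \<Rightarrow> real" and q assume "u \<longlonglongrightarrow> q"
    show "(\<lambda>i. F (u i)) \<longlonglongrightarrow> F q"
      unfolding F_def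
    proof (rule integral_dominated_convergence[where w = "\<lambda>v. \<bar>\<zeta> v\<bar>"])
      show "AE v in lborel. (\<lambda>i. \<zeta> v * cos (u i * v)) \<longlonglongrightarrow> \<zeta> v * cos (q * v)"
        using \<open>u \<longlonglongrightarrow> q\<close> by (intro AE_I2 tendsto_intros)
      show "AE v in lborel. norm (\<zeta> v * cos (u i * v)) \<le> \<bar>\<zeta> v\<bar>" for i
        by (intro AE_I2) (simp add: abs_mult mult_left_le)
    qed (use mz iz in auto)
  qed
  then have "\<exists>q0\<in>{- \<bar>Q\<bar>..\<bar>Q\<bar>}. \<forall>q\<in>{- \<bar>Q\<bar>..\<bar>Q\<bar>}. F q0 \<le> F q"
    by (intro continuous_attains_inf) auto
  then obtain q0 where q0: "\<And>q. q \<in> {- \<bar>Q\<bar>..\<bar>Q\<bar>} \<Longrightarrow> F q0 \<le> F q" by blast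
  show ?thesis
  proof (rule that[of "F q0"])
    show "0 < F q0" unfolding F_def by (rule admissible_zeta_cos_sin(3)[OF \<zeta>])
    show "F q0 \<le> (LINT v|lborel. \<zeta> v * cos (q * v))" if "\<bar>q\<bar> \<le> Q" for q
      using q0[of q] that by (auto simp: F_def abs_le_iff)
  qed
qed

theorem theorem3:
  fixes \<alpha> \<epsilon> k :: real and \<zeta> :: "real \<Rightarrow> real"
  assumes "\<alpha> = 1" and "\<epsilon> > 0" and "k > 0"
    and "admissible_zeta \<zeta>"
  shows "\<exists>B0 v0. v0 > 0 \<and>
    (\<forall>B V0. B \<ge> B0 \<and> B \<ge> max (- A_const \<alpha> \<epsilon> \<zeta> V0 k) 0 \<and> V0 < 0 \<and> \<bar>V0\<bar> < v0 \<longrightarrow>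
      (\<forall>n::nat. n \<ge> 1 \<longrightarrow>
        orbitally_stable (2 * pi * real n / k) \<alpha> \<epsilon> \<zeta> (gp_potential V0 k)
          (phi_omega \<alpha> \<epsilon> \<zeta> V0 k B)))"
proof -
  \<comment> \<open>The value \<open>10 * k\<close> splits the frequencies \<open>q\<close>: beyond
    it \<open>q^2 / 16\<close> is at least 6.25 times \<open>k^2\<close> without help from the
    interaction; up to it \<open>B * c\<close> has to supply \<open>6 * k^2\<close>, which
    determines \<open>B0\<close>.\<close>
  obtain c where c: "c > 0" and c_le: "\<And>q. \<bar>q\<bar> \<le> 10 * k * \<epsilon> \<Longrightarrow> c \<le> (LINT v|lborel. \<zeta> v * cos (q * v))"
    using zeta_transform_lower_bound[OF assms(4)] by blast
  define B0 where "B0 = max 1 (6 * k\<^sup>2 / c)"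
  \<comment> \<open>This serves as the threshold for |V0|: below it \<open>A\<close> is at most 1
    and hence at most \<open>B\<close>. Neither threshold involves \<open>n\<close>.\<close>
  define b where "b = beta \<zeta> k \<epsilon>"
  have b: "b > 0" unfolding b_def by (rule beta_pos[OF assms(4,2)])
  have "orbitally_stable (2 * pi * real n / k) \<alpha> \<epsilon> \<zeta> (gp_potential V0 k) (phi_omega \<alpha> \<epsilon> \<zeta> V0 k B)"
    if B: "B \<ge> B0" and V0: "V0 < 0" "\<bar>V0\<bar> < b" and n: "n \<ge> 1" for B V0 and n :: nat
  proof -
    define A where "A = A_const \<alpha> \<epsilon> \<zeta> V0 k"
    have A: "A = - V0 / b" by (simp add: A_def A_const_def assms(1) b_def)
    have A01: "0 \<le> A" "A \<le> 1" using V0 b by (simp_all add: A field_simps)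
    have B1: "1 \<le> B" "6 * k\<^sup>2 \<le> B * c" using B c by (auto simp: B0_def field_simps)
    interpret gp_circle \<epsilon> k V0 \<zeta> n
      by unfold_locales (use assms n in auto)
    interpret gp_wave \<epsilon> k V0 \<zeta> n B A
    proof
      show "0 < B" "0 \<le> A" "A \<le> B" using A01 B1 by auto
      have "m (2 * int n) = b"
      proof -
        have "lam * of_int (2 * int n) = 2 * (lam * real n)" by simp
        then have "lam * of_int (2 * int n) = 2 * k" unfolding lam_n .
        then show ?thesis unfolding m_def b_def beta_conv[OF assms(4,2)] by (simp only:)
      qed
      then show "A * m (2 * int n) = - V0" using b by (simp add: A)
      fix q :: real
      show "6 * k\<^sup>2 \<le> q\<^sup>2 / 16 + B * (LINT v|lborel. \<zeta> v * cos (q * \<epsilon> * v))"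
      proof (cases "\<bar>q\<bar> \<le> 10 * k")
        case True
        then have "\<bar>q * \<epsilon>\<bar> \<le> 10 * k * \<epsilon>" using assms(2) by (simp add: abs_mult)
        then have "B * c \<le> B * (LINT v|lborel. \<zeta> v * cos (q * \<epsilon> * v))"
          using B1 by (intro mult_left_mono c_le) auto
        then show ?thesis using B1(2) zero_le_power2[of q] by linarith
      next
        case False
        then have "(10 * k)\<^sup>2 \<le> \<bar>q\<bar>\<^sup>2" using assms(3) by (intro power_mono) auto
        then have "100 * k\<^sup>2 \<le> q\<^sup>2" by (simp add: power_mult_distrib)
        then have "6 * k\<^sup>2 \<le> q\<^sup>2 / 16" using zero_le_power2[of k] by linarith
        moreover have "0 \<le> B * (LINT v|lborel. \<zeta> v * cos (q * \<epsilon> * v))"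
          using B1 admissible_zeta_cos_sin(3)[OF assms(4), of "q * \<epsilon>"] by simp
        ultimately show ?thesis by linarith
      qed
    qed
    have "phi_omega \<alpha> \<epsilon> \<zeta> V0 k B x = ev phi (lam * x)" for x
    proof -
      have "real n * (lam * x) = (lam * real n) * x" by simp
      then have e: "real n * (lam * x) = k * x" unfolding lam_n .
      show ?thesis unfolding ev_phi e by (simp add: phi_omega_def complex_eq_iff flip: A_def)
    qed
    from orbitally_stable_if_profile[OF this] show ?thesis
      by (simp add: assms(1) T_def)
  qed
  then show ?thesis using b by (intro exI[of _ B0] exI[of _ b]) blast
qed

end
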